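(* Let $n\ge2$. If two sets of fundamental functions $(f_1,\dots,f_{n-1})$ in $H^\infty(\mathcal B(\mathcal E))$ and $(g_1,\dots,g_{n-1})$ in $H^\infty(\mathcal B(\mathcal E'))$ are unitarily equivalent, then their associated pure (canonical) Agler-Young isometries are unitarily equivalent. Conversely, if $\underline A=(A_1,\dots,A_n)$ and $\underline B=(B_1,\dots,B_n)$ are two pure Agler-Young isometries with $\dim\mathcal D_{A_n^*}<\infty$ and $\dim\mathcal D_{B_n^*}<\infty$, and if $\underline A$ and $\underline B$ are unitarily equivalent, then their fundamental functions are unitarily equivalent.
   Context: For a contraction $T$, $D_T=(I-T^*T)^{1/2}$ and $\mathcal D_T=\overline{\mathrm{Ran}}\,D_T$. $(S_1,\dots,S_n)$ (not assumed commuting) is an Agler-Young isometry if $S_n$ is an isometry and $S_i=S_{n-i}^*S_n$ for $i=1,\dots,n-1$; it is pure if $(S_n^* )^k\to0$ strongly. For a Hilbert space $\mathcal E$, $H^2(\mathcal E)$ is the $\mathcal E$-valued Hardy space and $T_\varphi$ ($\varphi\in L^\infty(\mathcal B(\mathcal E))$) the Toeplitz operator $T_\varphi g=P_+(\varphi g)$ on it; $H^\infty(\mathcal B(\mathcal E))$ is the set of bounded $\mathcal B(\mathcal E)$-valued holomorphic functions. For $\boldsymbol f=(f_1,\dots,f_{n-1})$ in $H^\infty(\mathcal B(\mathcal E))$ put $\varphi_i(z)=zf_i(z)+f_{n-i}(z)^*$ on the unit circle. The tuple $(T_{\varphi_1},\dots,T_{\varphi_{n-1}},T_z)$ on $H^2(\mathcal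 E)$ is the canonical Agler-Young isometry associated with $\boldsymbol f$, and $f_1,\dots,f_{n-1}$ are its fundamental functions. For a pure Agler-Young isometry $\underline S$ with $\dim\mathcal D_{S_n^*}<\infty$, its fundamental functions are the functions in $H^\infty(\mathcal B(\mathcal D_{S_n^*}))$ such that $\underline S$ is unitarily equivalent to the associated canonical Agler-Young isometry. Two sets of fundamental functions are unitarily equivalent if there is one unitary $U:\mathcal E\to\mathcal E'$ with $g_i(z)=Uf_i(z)U^*$ for all $z\in\mathbb D$ and $i=1,\dots,n-1$. Two operator tuples are unitarily equivalent if one unitary simultaneously conjugates corresponding entries. *)

theory Defs
  imports "HOL-Analysis.Analysis"
begin

section \<open>Complex inner product spaces\<close>

text \<open>
  The complex inner product is linear in the first argument.  The underlying real inner product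
  is its real part, so that norm and topology are inherited from the class \<^class>\<open>real_inner\<close>.
\<close>

class complex_inner = real_inner +
  fixes scaleC :: "complex \<Rightarrow> 'a \<Rightarrow> 'a"  (infixr "*\<^sub>C" 75)
    and cinner :: "'a \<Rightarrow> 'a \<Rightarrow> complex"
  assumes scaleC_add_right: "a *\<^sub>C (x + y) = a *\<^sub>C x + a *\<^sub>C y"
    and scaleC_add_left: "(a + b) *\<^sub>C x = a *\<^sub>C x + b *\<^sub>C x"
    and scaleC_scaleC: "a *\<^sub>C (b *\<^sub>C x) = (a * b) *\<^sub>C x"
    and scaleC_of_real: "complex_of_real r *\<^sub>C x = r *\<^sub>R x"
    and cinner_commute: "cinner x y = cnj (cinner y x)"
    and cinner_add_left: "cinner (x + y) z = cinner x z + cinner y z"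
    and cinner_scaleC_left: "cinner (a *\<^sub>C x) y = a * cinner x y"
    and inner_eq_Re_cinner: "inner x y = Re (cinner x y)"

instantiation complex :: complex_inner
begin

definition "scaleC (a::complex) (x::complex) = a * x"

definition "cinner (x::complex) (y::complex) = x * cnj y"

instance
  by standard
    (auto simp: scaleC_complex_def cinner_complex_def inner_complex_def algebra_simps scaleR_conv_of_real)

end

lemma scaleC_one: "1 *\<^sub>C (x::'a::complex_inner) = x"
  by (metis of_real_1 scaleC_of_real scaleR_one)

context complex_inner
begin

lemma Im_cinner: "Im (cinner x y) = inner x (\<i> *\<^sub>C y)"
proof -
  have "cinner x (\<i> *\<^sub>C y) = - \<i> * cinner x y"
    by (metis cinner_commute cinner_scaleC_left complex_cnj_cnj complex_cnj_i complex_cnj_mult)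
  then show ?thesis
    by (simp add: inner_eq_Re_cinner)
qed

lemma cinner_same: "cinner x x = complex_of_real (inner x x)"
  by (metis Reals_cnj_iff cinner_commute inner_eq_Re_cinner of_real_Re)

lemma cinner_add_right: "cinner x (y + z) = cinner x y + cinner x z"
  by (metis cinner_add_left cinner_commute complex_cnj_add)

lemma cinner_scaleC_right: "cinner x (a *\<^sub>C y) = cnj a * cinner x y"
  by (metis cinner_commute cinner_scaleC_left complex_cnj_mult)

end

lemma norm_scaleC: "norm (a *\<^sub>C (x::'a::complex_inner)) = norm a * norm x"
proof -
  have "cinner (a *\<^sub>C x) (a *\<^sub>C x) = (a * cnj a) * cinner x x"
    by (simp add: cinner_scaleC_left cinner_scaleC_right)
  then have "complex_of_real (inner (a *\<^sub>C x) (a *\<^sub>C x)) = complex_of_real ((norm a)\<^sup>2 * inner x x)"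
    by (simp add: cinner_same flip: complex_norm_square)
  then have "inner (a *\<^sub>C x) (a *\<^sub>C x) = (norm a)\<^sup>2 * inner x x"
    by (simp only: of_real_eq_iff)
  then show ?thesis
    by (simp add: norm_eq_sqrt_inner real_sqrt_mult)
qed

lemma bounded_linear_scaleC: "bounded_linear ((*\<^sub>C) a :: 'a::complex_inner \<Rightarrow> 'a)"
proof (rule bounded_linear_intro[where K = "norm a"])
  show "a *\<^sub>C (r *\<^sub>R x) = r *\<^sub>R (a *\<^sub>C x)" for r :: real and x :: 'a
    by (metis mult.commute scaleC_of_real scaleC_scaleC)
qed (auto simp: scaleC_add_right norm_scaleC mult.commute)


section \<open>Hilbert spaces and operators\<close>

text \<open>
  A Hilbert space is a complete complex subspace \<open>H\<close> of an ambient inner product space (possibly all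
  of it); this covers closed subspaces of Hilbert spaces such as defect spaces and Hardy spaces.
  Operators on \<open>H\<close> are functions on the ambient type whose values outside \<open>H\<close> are irrelevant.
\<close>

definition hilbert_space :: "'a::complex_inner set \<Rightarrow> bool" where
  "hilbert_space H \<longleftrightarrow>
     0 \<in> H \<and> (\<forall>x\<in>H. \<forall>y\<in>H. x + y \<in> H) \<and> (\<forall>a. \<forall>x\<in>H. a *\<^sub>C x \<in> H) \<and> complete H"

definition finite_cdim :: "'a::complex_inner set \<Rightarrow> bool" where
  "finite_cdim V \<longleftrightarrow>
     (\<exists>B. finite B \<and> B \<subseteq> V \<and> (\<forall>x\<in>V. \<exists>c. x = (\<Sum>b\<in>B. c b *\<^sub>C b)))"

definition clinear_on :: "'a::complex_inner set \<Rightarrow> ('a \<Rightarrow> 'b::complex_inner) \<Rightarrow> bool" where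
  "clinear_on H T \<longleftrightarrow>
     (\<forall>x\<in>H. \<forall>y\<in>H. T (x + y) = T x + T y) \<and> (\<forall>a. \<forall>x\<in>H. T (a *\<^sub>C x) = a *\<^sub>C T x)"

definition bounded_op :: "'a::complex_inner set \<Rightarrow> ('a \<Rightarrow> 'a) \<Rightarrow> bool" where
  "bounded_op H T \<longleftrightarrow>
     T ` H \<subseteq> H \<and> clinear_on H T \<and> (\<exists>C. \<forall>x\<in>H. norm (T x) \<le> C * norm x)"

text \<open>The adjoint of an operator defined on \<open>H\<close>; it is determined on the target space of \<open>T\<close>.\<close>

definition adj :: "'a::complex_inner set \<Rightarrow> ('a \<Rightarrow> 'b::complex_inner) \<Rightarrow> 'b \<Rightarrow> 'a" where
  "adj H T y = (THE z. z \<in> H \<and> (\<forall>x\<in>H. cinner (T x) y = cinner x z))"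

definition unitary_op ::
    "'a::complex_inner set \<Rightarrow> 'b::complex_inner set \<Rightarrow> ('a \<Rightarrow> 'b) \<Rightarrow> bool" where
  "unitary_op H K U \<longleftrightarrow>
     clinear_on H U \<and> U ` H = K \<and> (\<forall>x\<in>H. \<forall>y\<in>H. cinner (U x) (U y) = cinner x y)"

definition orth_proj :: "'a::complex_inner set \<Rightarrow> 'a \<Rightarrow> 'a" where
  "orth_proj M x = (THE y. y \<in> M \<and> (\<forall>z\<in>M. cinner (x - y) z = 0))"

definition positive_op :: "'a::complex_inner set \<Rightarrow> ('a \<Rightarrow> 'a) \<Rightarrow> bool" where
  "positive_op H T \<longleftrightarrow>
     bounded_op H T \<and> (\<forall>x\<in>H. cinner (T x) x \<in> \<real> \<and> 0 \<le> Re (cinner (T x) x))"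

text \<open>
  The defect operator is the positive square root of \<open>I - T\<^sup>* T\<close>.  Its values on \<open>H\<close> are unique;
  the choice operator only selects values outside \<open>H\<close>.
\<close>

definition defect_op :: "'a::complex_inner set \<Rightarrow> ('a \<Rightarrow> 'a) \<Rightarrow> 'a \<Rightarrow> 'a" where
  "defect_op H T =
     (SOME D. positive_op H D \<and> (\<forall>x\<in>H. D (D x) = x - adj H T (T x)))"

definition defect_space :: "'a::complex_inner set \<Rightarrow> ('a \<Rightarrow> 'a) \<Rightarrow> 'a set" where
  "defect_space H T = closure (defect_op H T ` H)"


section \<open>Operator tuples and Agler-Young isometries\<close>

text \<open>
  A tuple \<open>(S\<^sub>1, \<dots>, S\<^sub>n)\<close> is a function on \<^typ>\<open>nat\<close> of which only the values at \<open>1, \<dots>, n\<close> matter.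
\<close>

definition tuple_unitarily_equiv ::
    "nat \<Rightarrow> 'a::complex_inner set \<Rightarrow> (nat \<Rightarrow> 'a \<Rightarrow> 'a) \<Rightarrow>
     'b::complex_inner set \<Rightarrow> (nat \<Rightarrow> 'b \<Rightarrow> 'b) \<Rightarrow> bool" where
  "tuple_unitarily_equiv n H S K T \<longleftrightarrow>
     (\<exists>W. unitary_op H K W \<and> (\<forall>i\<in>{1..n}. \<forall>y\<in>K. T i y = W (S i (adj H W y))))"

definition agler_young_isometry ::
    "nat \<Rightarrow> 'a::complex_inner set \<Rightarrow> (nat \<Rightarrow> 'a \<Rightarrow> 'a) \<Rightarrow> bool" where
  "agler_young_isometry n H S \<longleftrightarrow>
     (\<forall>i\<in>{1..n}. bounded_op H (S i)) \<and>
     (\<forall>x\<in>H. norm (S n x) = norm x) \<and>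
     (\<forall>i\<in>{1..n-1}. \<forall>x\<in>H. S i x = adj H (S (n - i)) (S n x))"

definition pure_agler_young_isometry ::
    "nat \<Rightarrow> 'a::complex_inner set \<Rightarrow> (nat \<Rightarrow> 'a \<Rightarrow> 'a) \<Rightarrow> bool" where
  "pure_agler_young_isometry n H S \<longleftrightarrow>
     agler_young_isometry n H S \<and>
     (\<forall>x\<in>H. (\<lambda>k. (adj H (S n) ^^ k) x) \<longlonglongrightarrow> 0)"


section \<open>The space of square integrable functions on the unit circle\<close>

text \<open>
  Normalized arc length measure, completed.  It lives on all of \<^typ>\<open>complex\<close> and is concentrated
  on the unit circle.
\<close>

definition circle_measure :: "complex measure" where
  "circle_measure = completion (distr (uniform_measure lborel {0..2*pi}) borel cis)"

text \<open>
  Strong (Bochner) measurability.  This, rather than Borel measurability, is the right notion for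
  values in a possibly nonseparable space.
\<close>

definition strongly_measurable :: "'a measure \<Rightarrow> ('a \<Rightarrow> 'b::topological_space) \<Rightarrow> bool" where
  "strongly_measurable M f \<longleftrightarrow>
     (\<exists>s. (\<forall>k::nat. simple_function M (s k)) \<and> (AE x in M. (\<lambda>k. s k x) \<longlonglongrightarrow> f x))"

definition sq_integrable :: "(complex \<Rightarrow> 'e::complex_inner) \<Rightarrow> bool" where
  "sq_integrable f \<longleftrightarrow>
     strongly_measurable circle_measure f \<and> integrable circle_measure (\<lambda>\<zeta>. (norm (f \<zeta>))\<^sup>2)"

lemma space_circle_measure [simp]: "space circle_measure = UNIV"
  by (simp add: circle_measure_def)

lemma borel_measurable_completion_AE_cong:
  fixes f g :: "'a \<Rightarrow> 'b::topological_space"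
  assumes f: "f \<in> borel_measurable (completion M)" and ae: "AE x in completion M. f x = g x"
  shows "g \<in> borel_measurable (completion M)"
proof (rule measurableI)
  fix A :: "'b set" assume A: "A \<in> sets borel"
  show "g -` A \<inter> space (completion M) \<in> sets (completion M)"
  proof (rule completion.in_sets_AE)
    show "AE x in completion M. x \<in> f -` A \<inter> space (completion M) \<longleftrightarrow>
        x \<in> g -` A \<inter> space (completion M)"
      using ae by eventually_elim auto
  qed (use measurable_sets[OF f A] in auto)
qed auto

lemma borel_measurable_completion_AE_LIMSEQ:
  fixes f :: "'a \<Rightarrow> 'b::metric_space"
  assumes s: "\<And>k. s k \<in> borel_measurable (completion M)"
    and ae: "AE x in completion M. (\<lambda>k. s k x) \<longlonglongrightarrow> f x"
  shows "f \<in> borel_measurable (completion M)"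
proof -
  define t where "t k x = (if (\<lambda>k. s k x) \<longlonglongrightarrow> f x then s k x else f x)" for k x
  have "t k \<in> borel_measurable (completion M)" for k
    by (rule borel_measurable_completion_AE_cong[OF s[of k]])
      (use ae in \<open>eventually_elim, simp add: t_def\<close>)
  moreover have "(\<lambda>k. t k x) \<longlonglongrightarrow> f x" for x
    by (cases "(\<lambda>k. s k x) \<longlonglongrightarrow> f x") (auto simp: t_def)
  ultimately show ?thesis
    by (rule borel_measurable_LIMSEQ_metric)
qed

lemma strongly_measurable_compose2:
  assumes f: "strongly_measurable M f" and g: "strongly_measurable M g"
    and h: "\<And>u v. isCont (\<lambda>p. h (fst p) (snd p)) (u, v)"
  shows "strongly_measurable M (\<lambda>x. h (f x) (g x))"
proof -
  obtain s t where s: "\<And>k::nat. simple_function M (s k)" "AE x in M. (\<lambda>k. s k x) \<longlonglongrightarrow> f x"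
    and t: "\<And>k::nat. simple_function M (t k)" "AE x in M. (\<lambda>k. t k x) \<longlonglongrightarrow> g x"
    using f g unfolding strongly_measurable_def by auto
  have "AE x in M. (\<lambda>k. h (s k x) (t k x)) \<longlonglongrightarrow> h (f x) (g x)"
    using s(2) t(2)
  proof eventually_elim
    case (elim x)
    then have "(\<lambda>k. (s k x, t k x)) \<longlonglongrightarrow> (f x, g x)"
      by (rule tendsto_Pair)
    from isCont_tendsto_compose[OF h this] show ?case
      by simp
  qed
  moreover have "simple_function M (\<lambda>x. h (s k x) (t k x))" for k
    using s(1) t(1) by (rule simple_function_compose2)
  ultimately show ?thesis
    unfolding strongly_measurable_def by (intro exI[of _ "\<lambda>k x. h (s k x) (t k x)"]) auto
qed

lemma strongly_measurable_compose:
  assumes f: "strongly_measurable M f" and h: "\<And>u. isCont h u"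
  shows "strongly_measurable M (\<lambda>x. h (f x))"
  by (rule strongly_measurable_compose2[OF f f, where h = "\<lambda>x y. h x"])
    (use h in \<open>auto intro!: continuous_intros isCont_o2[of _ fst]\<close>)

lemma strongly_measurable_const: "strongly_measurable M (\<lambda>x. c)"
  unfolding strongly_measurable_def by (intro exI[of _ "\<lambda>k x. c"]) auto

lemma strongly_measurable_borel:
  fixes f :: "complex \<Rightarrow> 'b::metric_space"
  assumes "strongly_measurable circle_measure f"
  shows "f \<in> borel_measurable circle_measure"
  using assms unfolding strongly_measurable_def circle_measure_def
  by (auto intro: borel_measurable_completion_AE_LIMSEQ borel_measurable_simple_function)

lemma borel_measurable_norm_square:
  assumes "strongly_measurable circle_measure f"
  shows "(\<lambda>\<zeta>. (norm (f \<zeta> :: 'b::real_normed_vector))\<^sup>2) \<in> borel_measurable circle_measure"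
  by (rule strongly_measurable_borel, rule strongly_measurable_compose[OF assms])
    (intro continuous_intros)

lemma sq_integrable_zero: "sq_integrable (\<lambda>\<zeta>. 0)"
  by (simp add: sq_integrable_def strongly_measurable_const)

lemma sq_integrable_linear:
  assumes f: "sq_integrable f" and h: "bounded_linear h"
  shows "sq_integrable (\<lambda>\<zeta>. h (f \<zeta>))"
proof -
  obtain K where K: "\<And>x. norm (h x) \<le> norm x * K" "0 \<le> K"
    using bounded_linear.nonneg_bounded[OF h] by auto
  have sm: "strongly_measurable circle_measure (\<lambda>\<zeta>. h (f \<zeta>))"
    by (rule strongly_measurable_compose)
      (use f h in \<open>simp_all add: sq_integrable_def linear_continuous_at\<close>)
  have "integrable circle_measure (\<lambda>\<zeta>. (norm (h (f \<zeta>)))\<^sup>2)"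
  proof (rule Bochner_Integration.integrable_bound)
    show "integrable circle_measure (\<lambda>\<zeta>. K\<^sup>2 * (norm (f \<zeta>))\<^sup>2)"
      using f by (auto simp: sq_integrable_def)
    show "(\<lambda>\<zeta>. (norm (h (f \<zeta>)))\<^sup>2) \<in> borel_measurable circle_measure"
      by (rule borel_measurable_norm_square[OF sm])
    have "(norm (h x))\<^sup>2 \<le> K\<^sup>2 * (norm x)\<^sup>2" for x
      using power_mono[OF K(1)[of x], of 2] by (simp add: power_mult_distrib mult.commute)
    then show "AE \<zeta> in circle_measure. norm ((norm (h (f \<zeta>)))\<^sup>2) \<le> norm (K\<^sup>2 * (norm (f \<zeta>))\<^sup>2)"
      by simp
  qed
  with sm show ?thesis
    by (simp add: sq_integrable_def)
qed

lemma sq_integrable_add: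
  assumes f: "sq_integrable f" and g: "sq_integrable g"
  shows "sq_integrable (\<lambda>\<zeta>. f \<zeta> + g \<zeta>)"
proof -
  have sm: "strongly_measurable circle_measure (\<lambda>\<zeta>. f \<zeta> + g \<zeta>)"
    by (rule strongly_measurable_compose2[where h = "\<lambda>x y. x + y"])
      (use f g in \<open>auto simp: sq_integrable_def intro!: continuous_intros\<close>)
  have "integrable circle_measure (\<lambda>\<zeta>. (norm (f \<zeta> + g \<zeta>))\<^sup>2)"
  proof (rule Bochner_Integration.integrable_bound)
    show "integrable circle_measure (\<lambda>\<zeta>. 2 * (norm (f \<zeta>))\<^sup>2 + 2 * (norm (g \<zeta>))\<^sup>2)"
      using f g by (auto simp: sq_integrable_def)
    show "(\<lambda>\<zeta>. (norm (f \<zeta> + g \<zeta>))\<^sup>2) \<in> borel_measurable circle_measure"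
      by (rule borel_measurable_norm_square[OF sm])
    have "(norm (x + y))\<^sup>2 \<le> 2 * (norm x)\<^sup>2 + 2 * (norm y)\<^sup>2" for x y :: 'a
    proof -
      have "(norm (x + y))\<^sup>2 \<le> (norm x + norm y)\<^sup>2"
        by (simp add: norm_triangle_ineq power_mono)
      also have "\<dots> \<le> 2 * (norm x)\<^sup>2 + 2 * (norm y)\<^sup>2"
        using sum_squares_bound[of "norm x" "norm y"] by (simp add: power2_sum)
      finally show ?thesis .
    qed
    then show "AE \<zeta> in circle_measure. norm ((norm (f \<zeta> + g \<zeta>))\<^sup>2)
        \<le> norm (2 * (norm (f \<zeta>))\<^sup>2 + 2 * (norm (g \<zeta>))\<^sup>2)"
      by simp
  qed
  with sm show ?thesis
    by (simp add: sq_integrable_def)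
qed

lemmas sq_integrable_minus =
    sq_integrable_linear[OF _ bounded_linear_minus[OF bounded_linear_ident]]
  and sq_integrable_scaleR = sq_integrable_linear[OF _ bounded_linear_scaleR_right]
  and sq_integrable_scaleC = sq_integrable_linear[OF _ bounded_linear_scaleC]

lemma sq_integrable_diff:
  assumes "sq_integrable f" and "sq_integrable g"
  shows "sq_integrable (\<lambda>\<zeta>. f \<zeta> - g \<zeta>)"
  using sq_integrable_add[OF assms(1) sq_integrable_minus[OF assms(2)]] by simp

lemmas sq_integrable_intros = sq_integrable_zero sq_integrable_add sq_integrable_diff sq_integrable_minus
  sq_integrable_scaleR sq_integrable_scaleC

lemma integrable_inner_sq_integrable:
  assumes f: "sq_integrable f" and g: "sq_integrable g"
  shows "integrable circle_measure (\<lambda>\<zeta>. inner (f \<zeta>) (g \<zeta>))"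
proof (rule Bochner_Integration.integrable_bound)
  show "integrable circle_measure (\<lambda>\<zeta>. (norm (f \<zeta>))\<^sup>2 + (norm (g \<zeta>))\<^sup>2)"
    using f g by (auto simp: sq_integrable_def)
  show "(\<lambda>\<zeta>. inner (f \<zeta>) (g \<zeta>)) \<in> borel_measurable circle_measure"
    by (rule strongly_measurable_borel, rule strongly_measurable_compose2[where h = "\<lambda>x y. inner x y"])
      (use f g in \<open>auto simp: sq_integrable_def intro!: continuous_intros\<close>)
  have "\<bar>inner x y\<bar> \<le> (norm x)\<^sup>2 + (norm y)\<^sup>2" for x y :: 'a
    using Cauchy_Schwarz_ineq2[of x y] sum_squares_bound[of "norm x" "norm y"]
      mult_nonneg_nonneg[OF norm_ge_zero norm_ge_zero, of x y] by linarith
  then show "AE \<zeta> in circle_measure. norm (inner (f \<zeta>) (g \<zeta>))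
      \<le> norm ((norm (f \<zeta>))\<^sup>2 + (norm (g \<zeta>))\<^sup>2)"
    by simp
qed

lemma integrable_cinner_sq_integrable:
  assumes f: "sq_integrable f" and g: "sq_integrable g"
  shows "integrable circle_measure (\<lambda>\<zeta>. cinner (f \<zeta>) (g \<zeta>))"
proof -
  have "integrable circle_measure (\<lambda>\<zeta>. complex_of_real (inner (f \<zeta>) (g \<zeta>)) +
      \<i> * complex_of_real (inner (f \<zeta>) (\<i> *\<^sub>C g \<zeta>)))"
    by (intro Bochner_Integration.integrable_add integrable_mult_right
        integrable_bounded_linear[OF bounded_linear_of_real]
        integrable_inner_sq_integrable f sq_integrable_scaleC g)
  then show ?thesis
    by (simp add: inner_eq_Re_cinner[of "f _" "g _"] Im_cinner[symmetric] flip: complex_eq)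
qed

quotient_type (overloaded) 'e L2_circle =
  "complex \<Rightarrow> 'e::complex_inner" / partial:
  "\<lambda>f g. sq_integrable f \<and> sq_integrable g \<and> (AE \<zeta> in circle_measure. f \<zeta> = g \<zeta>)"
proof (rule part_equivpI)
  show "\<exists>f::complex \<Rightarrow> 'e. sq_integrable f \<and> sq_integrable f \<and> (AE \<zeta> in circle_measure. f \<zeta> = f \<zeta>)"
    by (intro exI[of _ "\<lambda>\<zeta>. 0"]) (simp add: sq_integrable_zero)
  show "symp (\<lambda>f g::complex \<Rightarrow> 'e. sq_integrable f \<and> sq_integrable g \<and>
      (AE \<zeta> in circle_measure. f \<zeta> = g \<zeta>))"
    by (auto simp: symp_def elim: eventually_mono)
  show "transp (\<lambda>f g::complex \<Rightarrow> 'e. sq_integrable f \<and> sq_integrable g \<and>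
      (AE \<zeta> in circle_measure. f \<zeta> = g \<zeta>))"
    by (rule transpI) (auto elim: eventually_elim2)
qed

lemma AE_cong_integral:
  fixes F G :: "complex \<Rightarrow> 'b::{banach, second_countable_topology}"
  assumes "integrable circle_measure F" "integrable circle_measure G"
    and "AE \<zeta> in circle_measure. F \<zeta> = G \<zeta>"
  shows "integral\<^sup>L circle_measure F = integral\<^sup>L circle_measure G"
  by (rule integral_cong_AE) (use assms in auto)

instantiation L2_circle :: (complex_inner) complex_inner
begin

lift_definition zero_L2_circle :: "'a L2_circle" is "\<lambda>\<zeta>. 0"
  by (simp add: sq_integrable_zero)

lift_definition plus_L2_circle :: "'a L2_circle \<Rightarrow> 'a L2_circle \<Rightarrow> 'a L2_circle"
  is "\<lambda>f g \<zeta>. f \<zeta> + g \<zeta>"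
  by (auto intro!: sq_integrable_intros)

lift_definition uminus_L2_circle :: "'a L2_circle \<Rightarrow> 'a L2_circle" is "\<lambda>f \<zeta>. - f \<zeta>"
  by (auto intro!: sq_integrable_intros)

lift_definition minus_L2_circle :: "'a L2_circle \<Rightarrow> 'a L2_circle \<Rightarrow> 'a L2_circle"
  is "\<lambda>f g \<zeta>. f \<zeta> - g \<zeta>"
  by (auto intro!: sq_integrable_intros)

lift_definition scaleR_L2_circle :: "real \<Rightarrow> 'a L2_circle \<Rightarrow> 'a L2_circle"
  is "\<lambda>r f \<zeta>. r *\<^sub>R f \<zeta>"
  by (auto intro!: sq_integrable_intros)

lift_definition scaleC_L2_circle :: "complex \<Rightarrow> 'a L2_circle \<Rightarrow> 'a L2_circle"
  is "\<lambda>a f \<zeta>. a *\<^sub>C f \<zeta>"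
  by (auto intro!: sq_integrable_intros)

lift_definition cinner_L2_circle :: "'a L2_circle \<Rightarrow> 'a L2_circle \<Rightarrow> complex"
  is "\<lambda>f g. \<integral>\<zeta>. cinner (f \<zeta>) (g \<zeta>) \<partial>circle_measure"
  by (intro AE_cong_integral integrable_cinner_sq_integrable) auto

lift_definition inner_L2_circle :: "'a L2_circle \<Rightarrow> 'a L2_circle \<Rightarrow> real"
  is "\<lambda>f g. \<integral>\<zeta>. inner (f \<zeta>) (g \<zeta>) \<partial>circle_measure"
  by (intro AE_cong_integral integrable_inner_sq_integrable) auto

definition norm_L2_circle :: "'a L2_circle \<Rightarrow> real" where
  "norm_L2_circle f = sqrt (inner f f)"

definition sgn_L2_circle :: "'a L2_circle \<Rightarrow> 'a L2_circle" where
  "sgn_L2_circle f = inverse (norm f) *\<^sub>R f"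

definition dist_L2_circle :: "'a L2_circle \<Rightarrow> 'a L2_circle \<Rightarrow> real" where
  "dist_L2_circle f g = norm (f - g)"

definition
  "(uniformity :: ('a L2_circle \<times> 'a L2_circle) filter) =
     (INF e\<in>{0 <..}. principal {(x, y). dist x y < e})"

definition open_L2_circle :: "'a L2_circle set \<Rightarrow> bool" where
  "open_L2_circle U =
     (\<forall>x\<in>U. eventually (\<lambda>(x', y). x' = x \<longrightarrow> y \<in> U) uniformity)"

instance
proof
  fix f g h :: "'a L2_circle" and r s :: real and a b :: complex
  show "dist f g = norm (f - g)" by (rule dist_L2_circle_def)
  show "sgn f = inverse (norm f) *\<^sub>R f" by (rule sgn_L2_circle_def)
  show "norm f = sqrt (inner f f)" by (rule norm_L2_circle_def)
  show "f + g + h = f + (g + h)"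
    by transfer (auto simp: add.assoc intro!: sq_integrable_intros)
  show "f + g = g + f"
    by transfer (auto simp: add.commute intro!: sq_integrable_intros)
  show "0 + f = f"
    by transfer auto
  show "- f + f = 0"
    by transfer (auto simp: sq_integrable_zero)
  show "f - g = f + - g"
    by transfer (auto intro!: sq_integrable_intros)
  show "r *\<^sub>R (f + g) = r *\<^sub>R f + r *\<^sub>R g"
    by transfer (auto simp: scaleR_add_right intro!: sq_integrable_intros)
  show "(r + s) *\<^sub>R f = r *\<^sub>R f + s *\<^sub>R f"
    by transfer (auto simp: scaleR_add_left intro!: sq_integrable_intros)
  show "r *\<^sub>R s *\<^sub>R f = (r * s) *\<^sub>R f"
    by transfer (auto intro!: sq_integrable_intros)
  show "1 *\<^sub>R f = f"
    by transfer auto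
  show "a *\<^sub>C (f + g) = a *\<^sub>C f + a *\<^sub>C g"
    by transfer (auto simp: scaleC_add_right intro!: sq_integrable_intros)
  show "(a + b) *\<^sub>C f = a *\<^sub>C f + b *\<^sub>C f"
    by transfer (auto simp: scaleC_add_left intro!: sq_integrable_intros)
  show "a *\<^sub>C b *\<^sub>C f = (a * b) *\<^sub>C f"
    by transfer (auto simp: scaleC_scaleC intro!: sq_integrable_intros)
  show "complex_of_real r *\<^sub>C f = r *\<^sub>R f"
    by transfer (auto simp: scaleC_of_real intro!: sq_integrable_intros)
  show "inner f g = inner g f"
    by transfer (simp add: inner_commute)
  show "inner (f + g) h = inner f h + inner g h"
    by transfer (simp add: inner_add_left integrable_inner_sq_integrable)
  show "inner (r *\<^sub>R f) g = r * inner f g"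
    by transfer simp
  show "0 \<le> inner f f"
    by transfer (auto intro!: integral_nonneg_AE)
  show "inner f f = 0 \<longleftrightarrow> f = 0"
  proof transfer
    fix f :: "complex \<Rightarrow> 'a"
    assume *: "sq_integrable f \<and> sq_integrable f \<and> (AE \<zeta> in circle_measure. f \<zeta> = f \<zeta>)"
    have "(\<integral>\<zeta>. inner (f \<zeta>) (f \<zeta>) \<partial>circle_measure) = 0 \<longleftrightarrow>
        (AE \<zeta> in circle_measure. inner (f \<zeta>) (f \<zeta>) = 0)"
      using * by (intro integral_nonneg_eq_0_iff_AE integrable_inner_sq_integrable) auto
    then show "(\<integral>\<zeta>. inner (f \<zeta>) (f \<zeta>) \<partial>circle_measure) = 0 \<longleftrightarrow>
        (sq_integrable f \<and> sq_integrable (\<lambda>\<zeta>. 0 :: 'a) \<and> (AE \<zeta> in circle_measure. f \<zeta> = 0))"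
      using * by (simp add: sq_integrable_zero)
  qed
  show "cinner f g = cnj (cinner g f)"
  proof transfer
    fix f g :: "complex \<Rightarrow> 'a"
    show "(\<integral>\<zeta>. cinner (f \<zeta>) (g \<zeta>) \<partial>circle_measure) =
        cnj (\<integral>\<zeta>. cinner (g \<zeta>) (f \<zeta>) \<partial>circle_measure)"
      by (simp add: cinner_commute[of "f _" "g _"])
  qed
  show "cinner (f + g) h = cinner f h + cinner g h"
    by transfer (simp add: cinner_add_left integrable_cinner_sq_integrable)
  show "cinner (a *\<^sub>C f) g = a * cinner f g"
    by transfer (simp add: cinner_scaleC_left)
  show "inner f g = Re (cinner f g)"
    by transfer (simp add: inner_eq_Re_cinner integral_Re integrable_cinner_sq_integrable)
qed (rule uniformity_L2_circle_def open_L2_circle_def)+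

end


section \<open>Hardy spaces and Toeplitz operators\<close>

text \<open>
  The functions in \<open>L\<^sup>2\<close> of the circle, with values in \<open>E\<close>, whose Fourier coefficients of negative
  index \<open>- k\<close> vanish.  Vanishing is tested against vectors of \<open>E\<close>, so that only
  scalar integrals occur.
\<close>

definition hardy_space :: "'e::complex_inner set \<Rightarrow> 'e L2_circle set" where
  "hardy_space E = {g. (AE \<zeta> in circle_measure. rep_L2_circle g \<zeta> \<in> E) \<and>
     (\<forall>k\<ge>1. \<forall>x\<in>E. (\<integral>\<zeta>. \<zeta> ^ k * cinner (rep_L2_circle g \<zeta>) x \<partial>circle_measure) = 0)}"

text \<open>
  Multiplication by an operator-valued function, followed by the projection onto the Hardy
  space.  A product that is not square integrable is replaced by \<open>0\<close>; this does not happen for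
  bounded symbols.
\<close>

definition mult_op :: "(complex \<Rightarrow> 'e \<Rightarrow> 'e) \<Rightarrow> 'e::complex_inner L2_circle \<Rightarrow> 'e L2_circle" where
  "mult_op \<phi> g =
     (let h = (\<lambda>\<zeta>. \<phi> \<zeta> (rep_L2_circle g \<zeta>)) in if sq_integrable h then abs_L2_circle h else 0)"

definition toeplitz ::
    "'e::complex_inner set \<Rightarrow> (complex \<Rightarrow> 'e \<Rightarrow> 'e) \<Rightarrow> 'e L2_circle \<Rightarrow> 'e L2_circle" where
  "toeplitz E \<phi> g = orth_proj (hardy_space E) (mult_op \<phi> g)"

text \<open>
  Bounded holomorphic functions on the unit disc with values in the bounded operators on \<open>E\<close>;
  holomorphic means complex differentiable in operator norm at every point of the disc.
\<close>

definition H_infinity :: "'e::complex_inner set \<Rightarrow> (complex \<Rightarrow> 'e \<Rightarrow> 'e) set" where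
  "H_infinity E = {f.
     (\<forall>z\<in>ball 0 1. bounded_op E (f z)) \<and>
     (\<exists>C. \<forall>z\<in>ball 0 1. \<forall>x\<in>E. norm (f z x) \<le> C * norm x) \<and>
     (\<forall>z\<in>ball 0 1. \<exists>L. bounded_op E L \<and>
        (\<forall>\<epsilon>>0. \<exists>\<delta>>0. \<forall>w\<in>ball 0 1. norm (w - z) < \<delta> \<longrightarrow>
           (\<forall>x\<in>E. norm (f w x - f z x - (w - z) *\<^sub>C L x) \<le> \<epsilon> * norm (w - z) * norm x)))}"

text \<open>
  Radial boundary values in the strong operator topology, with value \<open>0\<close> where the limit does not
  exist.  For functions in \<open>H\<^sup>\<infinity>\<close> and their adjoints the limit exists at almost every point, for
  all \<open>x\<close> simultaneously if \<open>E\<close> is separable.  In general it still exists at almost every point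
  for all \<open>x\<close> in a given separable subspace, hence for all values of a strongly
  measurable function, so that the multiplication operator is well defined for every \<open>E\<close>.
\<close>

definition boundary_value ::
    "(complex \<Rightarrow> 'e \<Rightarrow> 'e) \<Rightarrow> complex \<Rightarrow> 'e::complex_inner \<Rightarrow> 'e" where
  "boundary_value F \<zeta> x =
     (if \<exists>l. ((\<lambda>r. F (complex_of_real r * \<zeta>) x) \<longlongrightarrow> l) (at_left 1)
      then Lim (at_left 1) (\<lambda>r. F (complex_of_real r * \<zeta>) x) else 0)"

text \<open>
  The function \<open>z f\<^sub>i(z) + f\<^bsub>n-i\<^esub>(z)\<^sup>*\<close> on the circle.  The boundary function of the adjoint is the
  strong limit of the adjoints \<open>f\<^bsub>n-i\<^esub>(r \<zeta>)\<^sup>*\<close>.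
\<close>

definition ay_symbol ::
    "nat \<Rightarrow> 'e::complex_inner set \<Rightarrow> (nat \<Rightarrow> complex \<Rightarrow> 'e \<Rightarrow> 'e) \<Rightarrow> nat \<Rightarrow> complex \<Rightarrow> 'e \<Rightarrow> 'e" where
  "ay_symbol n E f i \<zeta> x =
     \<zeta> *\<^sub>C boundary_value (f i) \<zeta> x + boundary_value (\<lambda>z. adj E (f (n - i) z)) \<zeta> x"

definition canonical_ay ::
    "nat \<Rightarrow> 'e::complex_inner set \<Rightarrow> (nat \<Rightarrow> complex \<Rightarrow> 'e \<Rightarrow> 'e) \<Rightarrow>
     nat \<Rightarrow> 'e L2_circle \<Rightarrow> 'e L2_circle" where
  "canonical_ay n E f i =
     (if i = n then toeplitz E (\<lambda>\<zeta> x. \<zeta> *\<^sub>C x) else toeplitz E (ay_symbol n E f i))"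

definition fundamental_functions ::
    "nat \<Rightarrow> 'a::complex_inner set \<Rightarrow> (nat \<Rightarrow> 'a \<Rightarrow> 'a) \<Rightarrow> (nat \<Rightarrow> complex \<Rightarrow> 'a \<Rightarrow> 'a) \<Rightarrow> bool" where
  "fundamental_functions n H S f \<longleftrightarrow>
     (let D = defect_space H (adj H (S n)) in
        (\<forall>i\<in>{1..n-1}. f i \<in> H_infinity D) \<and>
        tuple_unitarily_equiv n H S (hardy_space D) (canonical_ay n D f))"

definition functions_unitarily_equiv ::
    "nat \<Rightarrow> 'a::complex_inner set \<Rightarrow> (nat \<Rightarrow> complex \<Rightarrow> 'a \<Rightarrow> 'a) \<Rightarrow>
     'b::complex_inner set \<Rightarrow> (nat \<Rightarrow> complex \<Rightarrow> 'b \<Rightarrow> 'b) \<Rightarrow> bool" where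
  "functions_unitarily_equiv n E f F g \<longleftrightarrow>
     (\<exists>U. unitary_op E F U \<and>
        (\<forall>i\<in>{1..n-1}. \<forall>z\<in>ball 0 1. \<forall>y\<in>F. g i z y = U (f i z (adj E U y))))"

end

theory Submission
  imports Defs "HOL-Complex_Analysis.Cauchy_Integral_Formula"
begin

text \<open>
  If \<open>g\<^sub>i = U f\<^sub>i U\<^sup>*\<close>, then pointwise application of \<open>U\<close> is a unitary between the Hardy spaces
  that intertwines the symbols, hence the Toeplitz operators. Existence of the projection onto
  \<open>H\<^sup>2(E)\<close> rests on the completeness of \<open>L\<^sup>2\<close> of the circle.

  Conversely, composing the given equivalences yields a unitary \<open>V\<close> between the Hardy spaces that
  intertwines the canonical tuples. As \<open>V\<close> commutes with the shifts, it maps the wandering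
  subspaces, the constants, to each other and is therefore of the form \<open>I \<otimes> U\<close>. The positive Fourier
  coefficients of \<open>z f\<^sub>i + f\<^bsub>n-i\<^esub>\<^sup>*\<close>, which the Toeplitz operator determines, are the Taylor
  coefficients of \<open>f\<^sub>i\<close>, so \<open>U\<close> conjugates \<open>f\<^sub>i\<close> to \<open>g\<^sub>i\<close>. That radial boundary values exist and
  carry these coefficients is Fatou's theorem, deduced from the almost everywhere radial
  convergence of Poisson integrals at Lebesgue points.
\<close>

section \<open>Operators on complex inner product spaces\<close>

text \<open>Both directions meet default values: \<open>boundary_value\<close> is 0 where the radial
  limit fails to exist, and \<open>mult_op\<close> is 0 on products that are not square integrable.
  In the forward direction these cases are not excluded but transported: \<open>U\<close> and its
  inverse extend to bounded operators of the ambient types, so a limit exists, or a product is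
  square integrable, on one side exactly when it does on the other. This direction therefore covers
  every dimension and does not involve Fatou's theorem. The converse has to know the boundary
  functions. Scalar theory applies to the entries \<open>cinner (f i z x) y\<close>, and finite
  dimension of the defect spaces enters where finitely many entries must control a vector: for the
  norm convergence of radial limits, and for recognizing constants by their Fourier coefficients.
  Since \<open>defect_op\<close> is chosen by \<open>SOME\<close>, even the fact that a defect space
  is a Hilbert space requires a square root to be exhibited; for the adjoint of an isometry T it is
  the projection I - T T*.\<close>

lemma scaleC_minus_one: "(-1) *\<^sub>C x = - (x::'a::complex_inner)"
  using scaleC_of_real[of "-1" x] by simp

lemma scaleC_zero_right [simp]: "a *\<^sub>C (0::'a::complex_inner) = 0"
  by (rule linear_0[OF bounded_linear.linear[OF bounded_linear_scaleC]])

lemma scaleC_zero_left [simp]: "0 *\<^sub>C (x::'a::complex_inner) = 0"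
  using scaleC_of_real[of 0 x] by simp

lemma scaleC_diff_right: "a *\<^sub>C (x - y) = a *\<^sub>C x - a *\<^sub>C (y::'a::complex_inner)"
  by (rule linear_diff[OF bounded_linear.linear[OF bounded_linear_scaleC]])

lemma scaleC_one_left [simp]: "1 *\<^sub>C x = (x::'a::complex_inner)"
  by (rule scaleC_one)

lemma cinner_zero_left [simp]: "cinner 0 (x::'a::complex_inner) = 0"
  using cinner_add_left[of 0 0 x] by simp

lemma cinner_zero_right [simp]: "cinner (x::'a::complex_inner) 0 = 0"
  using cinner_add_right[of x 0 0] by simp

lemma cinner_minus_left: "cinner (- x) y = - cinner x (y::'a::complex_inner)"
  using cinner_scaleC_left[of "-1" x y] by (simp add: scaleC_minus_one)

lemma cinner_minus_right: "cinner x (- y) = - cinner x (y::'a::complex_inner)"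
  using cinner_scaleC_right[of x "-1" y] by (simp add: scaleC_minus_one)

lemma cinner_diff_left: "cinner (x - y) z = cinner x z - cinner y (z::'a::complex_inner)"
  using cinner_add_left[of x "- y" z] by (simp add: cinner_minus_left)

lemma cinner_diff_right: "cinner x (y - z) = cinner x y - cinner x (z::'a::complex_inner)"
  using cinner_add_right[of x y "- z"] by (simp add: cinner_minus_right)

lemma cinner_sum_left: "cinner (\<Sum>i\<in>A. f i) y = (\<Sum>i\<in>A. cinner (f i) (y::'a::complex_inner))"
  by (induction A rule: infinite_finite_induct) (auto simp: cinner_add_left)

lemma cinner_sum_right: "cinner y (\<Sum>i\<in>A. f i) = (\<Sum>i\<in>A. cinner (y::'a::complex_inner) (f i))"
  by (induction A rule: infinite_finite_induct) (auto simp: cinner_add_right)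

lemmas cinner_simps = cinner_add_left cinner_add_right cinner_diff_left cinner_diff_right
  cinner_minus_left cinner_minus_right cinner_scaleC_left cinner_scaleC_right

lemma cinner_self_norm: "cinner x x = complex_of_real ((norm (x::'a::complex_inner))\<^sup>2)"
  by (simp add: cinner_same dot_square_norm)

lemma cinner_self_eq_0 [simp]: "cinner x x = 0 \<longleftrightarrow> x = (0::'a::complex_inner)"
  by (simp add: cinner_self_norm)

lemma norm_cinner_le: "norm (cinner x y) \<le> norm x * norm (y::'a::complex_inner)"
proof (cases "cinner x y = 0")
  case False
  \<comment> \<open>Rotating \<open>x\<close> by the conjugate phase makes the inner product real
    and non-negative, so the real Cauchy-Schwarz inequality applies.\<close>
  define a where "a = cnj (sgn (cinner x y))"
  have a: "norm a = 1"
    using False by (simp add: a_def norm_sgn)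
  have "cinner (a *\<^sub>C x) y = complex_of_real (norm (cinner x y))"
    using False by (simp add: a_def cinner_scaleC_left sgn_eq complex_norm_square[symmetric] power2_eq_square)
      (simp add: mult.commute complex_norm_square[symmetric] power2_eq_square)
  then have "norm (cinner x y) = inner (a *\<^sub>C x) y"
    by (simp add: inner_eq_Re_cinner)
  also have "\<dots> \<le> norm (a *\<^sub>C x) * norm y"
    by (rule norm_cauchy_schwarz)
  finally show ?thesis
    by (simp add: norm_scaleC a)
qed simp

lemma scaleR_eq_scaleC: "r *\<^sub>R x = complex_of_real r *\<^sub>C (x::'a::complex_inner)"
  by (simp add: scaleC_of_real)

text \<open>Sesquilinear over the complex numbers, but bilinear over the reals, which suffices for
  the limit and continuity rules.\<close>

lemma bounded_bilinear_cinner: "bounded_bilinear (cinner :: 'a::complex_inner \<Rightarrow> 'a \<Rightarrow> complex)"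
proof
  show "\<exists>K. \<forall>(a::'a) b. norm (cinner a b) \<le> norm a * norm b * K"
    by (rule exI[of _ 1]) (simp add: norm_cinner_le)
qed (auto simp: cinner_simps scaleR_eq_scaleC scaleC_complex_def)

lemmas tendsto_cinner = bounded_bilinear.tendsto[OF bounded_bilinear_cinner]

lemma bounded_bilinear_scaleC:
  "bounded_bilinear (scaleC :: complex \<Rightarrow> 'a::complex_inner \<Rightarrow> 'a)"
proof
  show "(r *\<^sub>R a) *\<^sub>C b = r *\<^sub>R a *\<^sub>C b" for r :: real and a :: complex and b :: 'a
    by (simp add: scaleR_eq_scaleC[of r "a *\<^sub>C b"] scaleC_scaleC scaleR_conv_of_real)
  show "a *\<^sub>C r *\<^sub>R b = r *\<^sub>R a *\<^sub>C b" for r :: real and a :: complex and b :: 'a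
    by (simp add: scaleR_eq_scaleC scaleC_scaleC mult.commute)
  show "\<exists>K. \<forall>a (b::'a). norm (a *\<^sub>C b) \<le> norm a * norm b * K"
    by (rule exI[of _ 1]) (simp add: norm_scaleC)
qed (auto simp: scaleC_add_left scaleC_add_right)

lemmas tendsto_scaleC = bounded_bilinear.tendsto[OF bounded_bilinear_scaleC]

text \<open>Separated from completeness because much of the algebra, and the range of the defect
  operator before its closure is taken, calls only for the linear part of
  \<open>hilbert_space\<close>.\<close>

definition complex_subspace :: "'a::complex_inner set \<Rightarrow> bool" where
  "complex_subspace M \<longleftrightarrow> 0 \<in> M \<and> (\<forall>x\<in>M. \<forall>y\<in>M. x + y \<in> M) \<and> (\<forall>a. \<forall>x\<in>M. a *\<^sub>C x \<in> M)"

lemma hilbert_space_iff: "hilbert_space H \<longleftrightarrow> complex_subspace H \<and> complete H"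
  by (auto simp: hilbert_space_def complex_subspace_def)

lemma complex_subspaceD:
  assumes "complex_subspace M"
  shows "0 \<in> M" "x \<in> M \<Longrightarrow> y \<in> M \<Longrightarrow> x + y \<in> M" "x \<in> M \<Longrightarrow> a *\<^sub>C x \<in> M"
    "x \<in> M \<Longrightarrow> y \<in> M \<Longrightarrow> x - y \<in> M" "x \<in> M \<Longrightarrow> r *\<^sub>R x \<in> M" "x \<in> M \<Longrightarrow> - x \<in> M"
proof -
  show 1: "0 \<in> M" "x \<in> M \<Longrightarrow> y \<in> M \<Longrightarrow> x + y \<in> M" "x \<in> M \<Longrightarrow> a *\<^sub>C x \<in> M" for x y a
    using assms by (auto simp: complex_subspace_def)
  show 2: "x \<in> M \<Longrightarrow> - x \<in> M" for x
    using 1(3)[of x "-1"] by (simp add: scaleC_minus_one)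
  show "x \<in> M \<Longrightarrow> y \<in> M \<Longrightarrow> x - y \<in> M"
    using 1(2)[of x "- y"] 2[of y] by simp
  show "x \<in> M \<Longrightarrow> r *\<^sub>R x \<in> M"
    using 1(3)[of x] by (simp add: scaleR_eq_scaleC)
qed

lemma complex_subspace_sum:
  assumes "complex_subspace M" "\<And>i. i \<in> A \<Longrightarrow> f i \<in> M"
  shows "(\<Sum>i\<in>A. f i) \<in> M"
  using assms(2) by (induction A rule: infinite_finite_induct) (auto intro: complex_subspaceD[OF assms(1)])

section \<open>Orthogonality and projections onto complete subspaces\<close>

lemma eq_if_cinner_eq:
  assumes "complex_subspace M" "y \<in> M" "z \<in> M" "\<And>x. x \<in> M \<Longrightarrow> cinner x y = cinner x z"
  shows "y = z"
proof -
  have "cinner (y - z) (y - z) = 0"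
    using assms(4)[OF complex_subspaceD(4)[OF assms(1-3)]] by (simp add: cinner_diff_right)
  then show ?thesis by simp
qed

lemma eq_if_cinner_eq':
  assumes "complex_subspace M" "y \<in> M" "z \<in> M" "\<And>x. x \<in> M \<Longrightarrow> cinner y x = cinner z x"
  shows "y = z"
  by (rule eq_if_cinner_eq[OF assms(1-3)]) (metis assms(4) cinner_commute)

text \<open>The imaginary part of \<open>cinner x z\<close> is the real inner product of
  \<open>x\<close> with \<i> z, and M is closed under multiplication by \<i>.\<close>

lemma cinner_eq_0_if_inner_eq_0:
  assumes M: "complex_subspace M" and "\<And>z. z \<in> M \<Longrightarrow> inner x z = 0" "z \<in> M"
  shows "cinner x z = 0"
  using assms(2)[OF assms(3)] assms(2)[OF complex_subspaceD(3)[OF M assms(3)], of \<i>]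
  by (simp add: complex_eq_iff Im_cinner inner_eq_Re_cinner[symmetric])

text \<open>A minimizing sequence for the distance from \<open>x\<close> to M converges by
  completeness of M; the ambient type is not assumed complete.\<close>

lemma ex_orthogonal_decomposition:
  assumes M: "complex_subspace M" and "complete M"
  shows "\<exists>y\<in>M. \<forall>z\<in>M. cinner (x - y) z = 0"
proof -
  note MD = complex_subspaceD[OF M]
  define d where "d = (INF m\<in>M. (norm (x - m))\<^sup>2)"
  have bdd: "bdd_below ((\<lambda>m. (norm (x - m))\<^sup>2) ` M)"
    by (rule bdd_belowI2[of _ 0]) simp
  have d: "d \<le> (norm (x - m))\<^sup>2" if "m \<in> M" for m
    unfolding d_def using that bdd by (rule cINF_lower[rotated])
  have "\<exists>m\<in>M. (norm (x - m))\<^sup>2 < d + inverse (real (Suc n))" for n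
    using cINF_less_iff[of M "\<lambda>m. (norm (x - m))\<^sup>2" "d + inverse (real (Suc n))"] MD(1) bdd
    by (auto simp: d_def)
  then obtain Y where Y: "\<And>n. Y n \<in> M" "\<And>n. (norm (x - Y n))\<^sup>2 < d + inverse (real (Suc n))"
    by metis
  \<comment> \<open>Parallelogram law: the midpoint of \<open>a\<close> and \<open>b\<close> lies in
    M, so its squared distance from \<open>x\<close> is at least \<open>d\<close>.\<close>
  have par: "(norm (a - b))\<^sup>2 \<le> 2 * ((norm (x - a))\<^sup>2 - d) + 2 * ((norm (x - b))\<^sup>2 - d)"
    if "a \<in> M" "b \<in> M" for a b
  proof -
    have "d \<le> (norm (x - (1/2) *\<^sub>R (a + b)))\<^sup>2"
      by (intro d MD that)
    moreover have "(norm (a - b))\<^sup>2 =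
        2 * (norm (x - a))\<^sup>2 + 2 * (norm (x - b))\<^sup>2 - 4 * (norm (x - (1/2) *\<^sub>R (a + b)))\<^sup>2"
      by (simp add: power2_norm_eq_inner algebra_simps inner_commute inner_add_left inner_add_right inner_diff_left inner_diff_right)
    ultimately show ?thesis by argo
  qed
  have "Cauchy Y"
  proof (rule metric_CauchyI)
    fix e :: real assume "e > 0"
    then obtain N where N: "inverse (real (Suc N)) < e\<^sup>2 / 4"
      using reals_Archimedean[of "e\<^sup>2/4"] by auto
    have "dist (Y m) (Y n) < e" if "m \<ge> N" "n \<ge> N" for m n
    proof -
      have "inverse (real (Suc m)) \<le> inverse (real (Suc N))" "inverse (real (Suc n)) \<le> inverse (real (Suc N))"
        using that by (auto intro!: le_imp_inverse_le)
      with par[OF Y(1)[of m] Y(1)[of n]] Y(2)[of m] Y(2)[of n] N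
      have "(norm (Y m - Y n))\<^sup>2 < e\<^sup>2" by argo
      then show ?thesis
        using \<open>e > 0\<close> by (simp add: dist_norm power_less_imp_less_base)
    qed
    then show "\<exists>M. \<forall>m\<ge>M. \<forall>n\<ge>M. dist (Y m) (Y n) < e" by blast
  qed
  then obtain y where y: "y \<in> M" "Y \<longlonglongrightarrow> y"
    using \<open>complete M\<close> Y(1) unfolding complete_def by blast
  have "(norm (x - y))\<^sup>2 \<le> d + 0"
  proof (rule LIMSEQ_le)
    show "(\<lambda>n. (norm (x - Y n))\<^sup>2) \<longlonglongrightarrow> (norm (x - y))\<^sup>2"
      by (intro tendsto_intros y)
    show "(\<lambda>n. d + inverse (real (Suc n))) \<longlonglongrightarrow> d + 0"
      by (intro tendsto_intros LIMSEQ_inverse_real_of_nat)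
    show "\<exists>N. \<forall>n\<ge>N. (norm (x - Y n))\<^sup>2 \<le> d + inverse (real (Suc n))"
      using Y(2) by (auto intro: less_imp_le)
  qed
  then have yd: "(norm (x - y))\<^sup>2 \<le> d" by simp
  have "inner (x - y) z = 0" if "z \<in> M" for z
  proof (cases "z = 0")
    case False
    \<comment> \<open>The step length that minimizes the squared distance from \<open>x\<close>
      along the line through \<open>y\<close> in direction \<open>z\<close>; minimality of
      \<open>y\<close> forces the gain to vanish.\<close>
    define t where "t = inner (x - y) z / inner z z"
    have "d \<le> (norm (x - (y + t *\<^sub>R z)))\<^sup>2"
      by (intro d MD y that)
    also have "\<dots> = (norm (x - y))\<^sup>2 - 2 * t * inner (x - y) z + t * t * inner z z"
      by (simp add: power2_norm_eq_inner algebra_simps inner_commute inner_add_left inner_add_right inner_diff_left inner_diff_right)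
    also have "\<dots> = (norm (x - y))\<^sup>2 - (inner (x - y) z)\<^sup>2 / inner z z"
      using False by (simp add: t_def power2_eq_square)
    finally have "(inner (x - y) z)\<^sup>2 / inner z z \<le> 0" using yd by linarith
    then show ?thesis
      using False inner_ge_zero[of z] by (auto simp: divide_le_0_iff)
  qed simp
  then show ?thesis
    using y(1) cinner_eq_0_if_inner_eq_0[OF M] by blast
qed

lemma orth_proj_eqI:
  assumes M: "complex_subspace M" and y: "y \<in> M" "\<And>z. z \<in> M \<Longrightarrow> cinner (x - y) z = 0"
  shows "orth_proj M x = y"
  unfolding orth_proj_def
proof (rule the_equality)
  fix y' assume y': "y' \<in> M \<and> (\<forall>z\<in>M. cinner (x - y') z = 0)"
  show "y' = y"
  proof (rule eq_if_cinner_eq'[OF M])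
    fix z assume "z \<in> M"
    then show "cinner y' z = cinner y z"
      using y(2)[of z] y' by (auto simp: cinner_diff_left)
  qed (use y y' in auto)
qed (use y in auto)

lemma orth_proj:
  assumes "hilbert_space M"
  shows orth_proj_in: "orth_proj M x \<in> M"
    and orth_proj_orth: "z \<in> M \<Longrightarrow> cinner (x - orth_proj M x) z = 0"
proof -
  obtain y where "y \<in> M" "\<forall>z\<in>M. cinner (x - y) z = 0"
    using ex_orthogonal_decomposition assms by (metis hilbert_space_iff)
  moreover from this have "orth_proj M x = y"
    using assms by (intro orth_proj_eqI) (auto simp: hilbert_space_iff)
  ultimately show "orth_proj M x \<in> M" "z \<in> M \<Longrightarrow> cinner (x - orth_proj M x) z = 0" by auto
qed

lemma orth_proj_cinner:
  assumes "hilbert_space M" "z \<in> M"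
  shows "cinner (orth_proj M x) z = cinner x z"
  using orth_proj_orth[OF assms, of x] by (simp add: cinner_diff_left)

lemma orth_proj_id:
  assumes "complex_subspace M" "x \<in> M"
  shows "orth_proj M x = x"
  using assms by (intro orth_proj_eqI) auto

lemma bounded_linear_orth_proj:
  assumes M: "hilbert_space M"
  shows "bounded_linear (orth_proj M)"
    and orth_proj_scaleC: "orth_proj M (a *\<^sub>C x) = a *\<^sub>C orth_proj M x"
proof -
  note S = M[unfolded hilbert_space_iff, THEN conjunct1]
  note MD = complex_subspaceD[OF S] and in_M = orth_proj_in[OF M]
  show sc: "orth_proj M (a *\<^sub>C x) = a *\<^sub>C orth_proj M x" for a x
    by (rule orth_proj_eqI[OF S])
      (auto intro!: MD in_M simp: scaleC_diff_right[symmetric] cinner_simps(7) orth_proj_orth[OF M])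
  show "bounded_linear (orth_proj M)"
  proof (rule bounded_linear_intro[where K = 1])
    show "orth_proj M (x + y) = orth_proj M x + orth_proj M y" for x y
    proof (rule orth_proj_eqI[OF S])
      show "cinner (x + y - (orth_proj M x + orth_proj M y)) z = 0" if "z \<in> M" for z
        using that by (simp add: cinner_simps orth_proj_cinner[OF M])
    qed (auto intro!: MD in_M)
    show "orth_proj M (r *\<^sub>R x) = r *\<^sub>R orth_proj M x" for r x
      by (simp add: scaleR_eq_scaleC sc)
    show "norm (orth_proj M x) \<le> norm x * 1" for x
    proof -
      have "(norm (orth_proj M x))\<^sup>2 = inner (orth_proj M x) (orth_proj M x)"
        by (rule power2_norm_eq_inner)
      also have "\<dots> = inner x (orth_proj M x)"
        by (simp add: inner_eq_Re_cinner orth_proj_cinner[OF M in_M])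
      also have "\<dots> \<le> norm x * norm (orth_proj M x)"
        by (rule norm_cauchy_schwarz)
      finally show ?thesis
        by (cases "norm (orth_proj M x) = 0") (auto simp: power2_eq_square)
    qed
  qed
qed

text \<open>If \<phi> is nonzero, the bound makes its kernel N complete. The component
  \<open>v\<close>, orthogonal to N, of a vector outside N is then nonzero, and a multiple of it
  represents \<phi>.\<close>

lemma Riesz_representation:
  assumes H: "hilbert_space H" and add: "\<And>x y. x \<in> H \<Longrightarrow> y \<in> H \<Longrightarrow> \<phi> (x + y) = \<phi> x + \<phi> y"
    and scale: "\<And>a x. x \<in> H \<Longrightarrow> \<phi> (a *\<^sub>C x) = a * \<phi> x"
    and bound: "\<And>x. x \<in> H \<Longrightarrow> norm (\<phi> x :: complex) \<le> C * norm x"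
  shows "\<exists>z\<in>H. \<forall>x\<in>H. \<phi> x = cinner x z"
proof (cases "\<forall>x\<in>H. \<phi> x = 0")
  case True
  then show ?thesis
    using H by (auto simp: hilbert_space_def intro!: bexI[of _ 0])
next
  case False
  then obtain u where u: "u \<in> H" "\<phi> u \<noteq> 0" by blast
  have S: "complex_subspace H" and cH: "complete H"
    using H by (auto simp: hilbert_space_iff)
  note HD = complex_subspaceD[OF S]
  have dif: "\<phi> (x - y) = \<phi> x - \<phi> y" if "x \<in> H" "y \<in> H" for x y
    using add[of x "- y"] scale[of y "-1"] that HD by (simp add: scaleC_minus_one)
  define N where "N = {x\<in>H. \<phi> x = 0}"
  have N: "complex_subspace N"
    unfolding complex_subspace_def N_def using HD(1-3) add scale scale[of 0 0] by auto
  have "complete N"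
    unfolding complete_def
  proof (intro allI impI)
    fix s assume s: "(\<forall>n. s n \<in> N) \<and> Cauchy s"
    then obtain l where l: "l \<in> H" "s \<longlonglongrightarrow> l"
      using cH unfolding complete_def N_def by blast
    have "(\<lambda>n. C * norm (s n - l)) \<longlonglongrightarrow> C * norm (l - l)"
      by (intro tendsto_intros l)
    then have "(\<lambda>n. C * norm (s n - l)) \<longlonglongrightarrow> 0" by simp
    moreover have "norm (\<phi> (s n - l)) \<le> C * norm (s n - l)" for n
      using s l HD(4) bound by (auto simp: N_def)
    ultimately have "(\<lambda>n. \<phi> (s n - l)) \<longlonglongrightarrow> 0"
      by (metis (mono_tags, lifting) Lim_null_comparison always_eventually)
    moreover have "\<phi> (s n - l) = - \<phi> l" for n
      using s l dif[of "s n" l] by (auto simp: N_def)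
    ultimately have "\<phi> l = 0" by (simp add: LIMSEQ_const_iff)
    then show "\<exists>l\<in>N. s \<longlonglongrightarrow> l" using l by (auto simp: N_def)
  qed
  then obtain p where p: "p \<in> N" "\<forall>z\<in>N. cinner (u - p) z = 0"
    using ex_orthogonal_decomposition[OF N] by blast
  define v where "v = u - p"
  have v: "v \<in> H" "\<phi> v = \<phi> u"
    using u p HD(4) dif by (auto simp: v_def N_def)
  have v0: "v \<noteq> 0" using v u scale[of 0 0] HD(1) by force
  show ?thesis
  proof (intro bexI ballI)
    fix x assume x: "x \<in> H"
    \<comment> \<open>\<open>v\<close> carries the whole value of \<phi>, so removing the right
      multiple of it from \<open>x\<close> leaves a vector of the kernel, which is orthogonal to
      \<open>v\<close>.\<close>
    have "x - (\<phi> x / \<phi> v) *\<^sub>C v \<in> N"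
      using x v u HD by (simp add: N_def dif scale)
    then have "cinner (x - (\<phi> x / \<phi> v) *\<^sub>C v) v = 0"
      using p(2) cinner_commute v_def by (metis complex_cnj_zero)
    then have "cinner x v = \<phi> x / \<phi> v * cinner v v"
      by (simp add: cinner_simps)
    then show "\<phi> x = cinner x (cnj (\<phi> v / cinner v v) *\<^sub>C v)"
      using v0 v u by (simp add: cinner_simps)
  qed (use v HD in auto)
qed

section \<open>Adjoints and unitary operators\<close>

lemma adj_eqI:
  assumes "complex_subspace H" "z \<in> H" "\<And>x. x \<in> H \<Longrightarrow> cinner (T x) y = cinner x z"
  shows "adj H T y = z"
  unfolding adj_def
proof (rule the_equality)
  fix z' assume "z' \<in> H \<and> (\<forall>x\<in>H. cinner (T x) y = cinner x z')"
  then show "z' = z"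
    using assms by (intro eq_if_cinner_eq[of H]) auto
qed (use assms in auto)

text \<open>\<open>adj\<close> is a definite description; Riesz applied to
  \<open>cinner (T x) y\<close> as a functional of \<open>x\<close> supplies the vector it denotes,
  for every \<open>y\<close> of the target type.\<close>

lemma
  assumes H: "hilbert_space H" and T: "clinear_on H T" and bound: "\<And>x. x \<in> H \<Longrightarrow> norm (T x) \<le> C * norm x"
  shows adj_in: "adj H T y \<in> H"
    and cinner_adj: "x \<in> H \<Longrightarrow> cinner (T x) y = cinner x (adj H T y)"
proof -
  have "\<exists>z\<in>H. \<forall>x\<in>H. cinner (T x) y = cinner x z"
  proof (rule Riesz_representation[OF H, where C = "C * norm y"])
    show "norm (cinner (T x) y) \<le> C * norm y * norm x" if "x \<in> H" for x
      using norm_cinner_le[of "T x" y] mult_right_mono[OF bound[OF that] norm_ge_zero[of y]]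
      by (simp add: mult_ac)
  qed (use T in \<open>auto simp: clinear_on_def cinner_simps\<close>)
  then obtain z where z: "z \<in> H" "\<forall>x\<in>H. cinner (T x) y = cinner x z" by blast
  moreover have "adj H T y = z"
    using H z by (intro adj_eqI) (auto simp: hilbert_space_iff)
  ultimately show "adj H T y \<in> H" "x \<in> H \<Longrightarrow> cinner (T x) y = cinner x (adj H T y)" by auto
qed

lemma clinear_onD:
  assumes "complex_subspace H" "clinear_on H T"
  shows "x \<in> H \<Longrightarrow> y \<in> H \<Longrightarrow> T (x + y) = T x + T y" "x \<in> H \<Longrightarrow> T (a *\<^sub>C x) = a *\<^sub>C T x"
    "x \<in> H \<Longrightarrow> y \<in> H \<Longrightarrow> T (x - y) = T x - T y" "T 0 = 0"
proof -
  note HD = complex_subspaceD[OF assms(1)]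
  show 1: "x \<in> H \<Longrightarrow> y \<in> H \<Longrightarrow> T (x + y) = T x + T y" "x \<in> H \<Longrightarrow> T (a *\<^sub>C x) = a *\<^sub>C T x" for x y a
    using assms(2) by (auto simp: clinear_on_def)
  show "x \<in> H \<Longrightarrow> y \<in> H \<Longrightarrow> T (x - y) = T x - T y"
    using 1(1)[of x "- y"] 1(2)[of y "-1"] HD(6)[of y] by (simp add: scaleC_minus_one)
  show "T 0 = 0" using 1(2)[of 0 0] HD(1) by simp
qed

lemma adj_bounded:
  assumes H: "hilbert_space H" and T: "bounded_op H T"
  shows "bounded_op H (adj H T)" and "x \<in> H \<Longrightarrow> adj H (adj H T) x = T x"
    and bounded_adj_in: "adj H T y \<in> H" and bounded_cinner_adj: "x \<in> H \<Longrightarrow> cinner (T x) y = cinner x (adj H T y)"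
proof -
  have S: "complex_subspace H" using H by (simp add: hilbert_space_iff)
  note HD = complex_subspaceD[OF S]
  obtain C where T: "T ` H \<subseteq> H" "clinear_on H T" "\<And>x. x \<in> H \<Longrightarrow> norm (T x) \<le> C * norm x"
    using T by (auto simp: bounded_op_def)
  show i: "adj H T y \<in> H" and a: "x \<in> H \<Longrightarrow> cinner (T x) y = cinner x (adj H T y)" for x y
    using adj_in[OF H T(2,3)] cinner_adj[OF H T(2,3)] by blast+
  have a': "cinner (adj H T y) x = cinner y (T x)" if "x \<in> H" for x y
    using a[OF that, of y] by (metis cinner_commute)
  show "bounded_op H (adj H T)"
    unfolding bounded_op_def clinear_on_def
  proof (intro conjI ballI allI)
    show "adj H T (x + y) = adj H T x + adj H T y" for x y
      by (rule adj_eqI[OF S]) (auto intro!: HD i simp: cinner_simps a)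
    show "adj H T (c *\<^sub>C x) = c *\<^sub>C adj H T x" for c x
      by (rule adj_eqI[OF S]) (auto intro!: HD i simp: cinner_simps a)
    have "norm (adj H T y) \<le> C * norm y" if "y \<in> H" for y
    proof -
      have "(norm (adj H T y))\<^sup>2 = Re (cinner (adj H T y) (adj H T y))"
        by (simp add: cinner_self_norm)
      also have "\<dots> = Re (cinner (T (adj H T y)) y)" by (simp add: a i)
      also have "\<dots> \<le> norm (T (adj H T y)) * norm y"
        using complex_Re_le_cmod norm_cinner_le order_trans by blast
      also have "\<dots> \<le> C * norm (adj H T y) * norm y"
        by (intro mult_right_mono T i) auto
      finally show ?thesis
      proof (cases "norm (adj H T y) = 0")
        case True
        show ?thesis
        proof (cases "y = 0")
          case False
          \<comment> \<open>C may be negative a priori, so non-negativity of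
            \<open>C * norm y\<close> is read off from the bound at \<open>y\<close> itself.\<close>
          have "0 \<le> norm (T y)" by simp
          also have "\<dots> \<le> C * norm y" by (rule T(3)[OF that])
          finally show ?thesis using True by simp
        qed (use True in simp)
      qed (auto simp: power2_eq_square mult_ac)
    qed
    then show "\<exists>C. \<forall>x\<in>H. norm (adj H T x) \<le> C * norm x" by blast
  qed (use i in blast)
  show "adj H (adj H T) x = T x" if "x \<in> H"
    using T(1) that by (intro adj_eqI[OF S]) (auto simp: a')
qed

text \<open>Since U preserves \<open>cinner\<close>, the vector \<open>x\<close> itself meets the
  condition that defines the adjoint at \<open>U x\<close>; uniqueness suffices and Riesz does not
  enter.\<close>

lemma unitary_op_adj:
  assumes S: "complex_subspace H" and U: "unitary_op H K U"
  shows "x \<in> H \<Longrightarrow> adj H U (U x) = x" "y \<in> K \<Longrightarrow> adj H U y \<in> H" "y \<in> K \<Longrightarrow> U (adj H U y) = y"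
proof -
  show 1: "x \<in> H \<Longrightarrow> adj H U (U x) = x" for x
    using U by (intro adj_eqI[OF S]) (auto simp: unitary_op_def)
  show "y \<in> K \<Longrightarrow> adj H U y \<in> H" "y \<in> K \<Longrightarrow> U (adj H U y) = y"
    using U 1 by (auto simp: unitary_op_def)
qed

lemma unitary_opD:
  assumes "unitary_op H K U"
  shows "clinear_on H U" "x \<in> H \<Longrightarrow> U x \<in> K" "x \<in> H \<Longrightarrow> y \<in> H \<Longrightarrow> cinner (U x) (U y) = cinner x y"
    "x \<in> H \<Longrightarrow> norm (U x) = norm x"
proof -
  show 1: "clinear_on H U" "x \<in> H \<Longrightarrow> U x \<in> K" "x \<in> H \<Longrightarrow> y \<in> H \<Longrightarrow> cinner (U x) (U y) = cinner x y" for x y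
    using assms by (auto simp: unitary_op_def)
  show "x \<in> H \<Longrightarrow> norm (U x) = norm x"
    using 1(3)[of x x] by (simp add: norm_eq_sqrt_inner inner_eq_Re_cinner)
qed

lemma unitary_op_adj_unitary:
  assumes S: "complex_subspace H" and U: "unitary_op H K U"
  shows "unitary_op K H (adj H U)"
proof -
  note A = unitary_op_adj[OF S U] and D = unitary_opD[OF U] and L = clinear_onD[OF S unitary_opD(1)[OF U]]
  note HD = complex_subspaceD[OF S]
  have KU: "K = U ` H" using U by (auto simp: unitary_op_def)
  show ?thesis
    unfolding unitary_op_def clinear_on_def KU
    using A(1) D(3) HD L(1,2)[symmetric] by (auto simp: image_iff)
qed

lemma unitary_op_compose:
  assumes "unitary_op H K U" "unitary_op K L V"
  shows "unitary_op H L (\<lambda>x. V (U x))"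
  using assms unfolding unitary_op_def clinear_on_def
  by auto

text \<open>Trades conjugation by W for an intertwining relation, a form in which equivalences
  compose without handling adjoints.\<close>

lemma tuple_unitarily_equivE:
  assumes S: "complex_subspace H" and eq: "tuple_unitarily_equiv n H S K T"
  obtains W where "unitary_op H K W" "\<And>i x. i \<in> {1..n} \<Longrightarrow> x \<in> H \<Longrightarrow> T i (W x) = W (S i x)"
proof -
  obtain W where W: "unitary_op H K W" "\<forall>i\<in>{1..n}. \<forall>y\<in>K. T i y = W (S i (adj H W y))"
    using eq by (auto simp: tuple_unitarily_equiv_def)
  then have "T i (W x) = W (S i x)" if "i \<in> {1..n}" "x \<in> H" for i x
    using unitary_op_adj[OF S W(1)] unitary_opD[OF W(1)] that by auto
  with W(1) show ?thesis using that by blast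
qed

lemma tuple_unitarily_equivI:
  assumes S: "complex_subspace H" and W: "unitary_op H K W"
    and "\<And>i x. i \<in> {1..n} \<Longrightarrow> x \<in> H \<Longrightarrow> T i (W x) = W (S i x)"
  shows "tuple_unitarily_equiv n H S K T"
  unfolding tuple_unitarily_equiv_def
  using assms(3) unitary_op_adj[OF S W] by (intro exI[of _ W] conjI W) metis

text \<open>\<open>defect_op\<close> is a \<open>SOME\<close> term, so a positive square root must
  be shown to exist before anything is known about it. For an isometry T, I - T T* is the projection
  onto the complement of the range of T, hence positive and its own square root.\<close>

lemma defect_op_adj_isometry:
  assumes H: "hilbert_space H" and T: "bounded_op H T" and iso: "\<And>x. x \<in> H \<Longrightarrow> norm (T x) = norm x"
  shows "positive_op H (defect_op H (adj H T))"
proof -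
  have S: "complex_subspace H" using H by (simp add: hilbert_space_iff)
  note HD = complex_subspaceD[OF S]
  note A = adj_bounded[OF H T]
  have Tin: "T x \<in> H" if "x \<in> H" for x using T that by (auto simp: bounded_op_def)
  have L: "clinear_on H T" "clinear_on H (adj H T)" using T A(1) by (auto simp: bounded_op_def)
  note TL = clinear_onD[OF S L(1)] and AL = clinear_onD[OF S L(2)]
  \<comment> \<open>T* T = I follows from norm preservation by polarization; real parts suffice
    because only a norm has to vanish.\<close>
  have AT: "adj H T (T x) = x" if x: "x \<in> H" for x
  proof -
    have d: "x - adj H T (T x) \<in> H" by (intro HD(4) x A(3))
    have "cinner (x - adj H T (T x)) (x - adj H T (T x)) = 0"
    proof -
      have "Re (cinner (T a) (T b)) = Re (cinner a b)" if "a \<in> H" "b \<in> H" for a b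
      proof -
        have "norm (T (a + b)) = norm (a + b)" "norm (T (a - b)) = norm (a - b)" using iso[OF HD(2)[OF that]] iso[OF HD(4)[OF that]] by auto
        then have "inner (T a + T b) (T a + T b) - inner (T a - T b) (T a - T b) =
          inner (a + b) (a + b) - inner (a - b) (a - b)"
          using that by (simp add: TL dot_square_norm)
        then show ?thesis
          by (simp add: inner_eq_Re_cinner[symmetric] inner_simps inner_commute)
      qed
      from this[OF d x] have "Re (cinner (x - adj H T (T x)) (adj H T (T x))) = Re (cinner (x - adj H T (T x)) x)"
        using d A(4) by metis
      then have "Re (cinner (x - adj H T (T x)) (x - adj H T (T x))) = 0"
        by (simp add: cinner_diff_right[of "x - adj H T (T x)"])
      then show ?thesis by (simp add: cinner_self_norm)
    qed
    then show ?thesis by simp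
  qed
  define D where "D x = x - T (adj H T x)" for x
  have Din: "D x \<in> H" if "x \<in> H" for x using that by (auto simp: D_def intro!: HD(4) Tin A(3))
  \<comment> \<open>T* D = 0 yields both that D is idempotent and that \<open>cinner (D x) x\<close>
    equals \<open>cinner (D x) (D x)\<close>, hence positivity.\<close>
  have aD: "adj H T (D x) = 0" if "x \<in> H" for x
    using that by (simp add: D_def AL(3) Tin A(3) AT)
  have DD: "D (D x) = D x" if "x \<in> H" for x
    using aD[OF that] by (simp add: D_def[of "D x"] TL(4))
  have Dx: "cinner (D x) x = cinner (D x) (D x)" if "x \<in> H" for x
  proof -
    have "cinner (D x) (T (adj H T x)) = cnj (cinner (T (adj H T x)) (D x))" by (rule cinner_commute)
    also have "\<dots> = 0" using A(4)[OF A(3), of x "D x"] aD[OF that] by simp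
    finally show ?thesis by (simp add: D_def[of x] cinner_diff_right[of "x - T (adj H T x)"])
  qed
  have "positive_op H D"
    unfolding positive_op_def bounded_op_def
  proof (intro conjI ballI)
    show "clinear_on H D"
      unfolding clinear_on_def D_def using TL AL A(3) by (simp add: scaleC_diff_right)
    show "\<exists>C. \<forall>x\<in>H. norm (D x) \<le> C * norm x"
    proof (intro exI ballI)
      fix x assume x: "x \<in> H"
      have "(norm (D x))\<^sup>2 = Re (cinner (D x) x)" by (simp add: Dx x cinner_self_norm)
      also have "\<dots> \<le> norm (D x) * norm x" using complex_Re_le_cmod norm_cinner_le order_trans by blast
      finally show "norm (D x) \<le> 1 * norm x"
        by (cases "norm (D x) = 0") (auto simp: power2_eq_square)
    qed
  qed (use Din in \<open>auto simp: Dx cinner_self_norm\<close>)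
  moreover have "\<forall>x\<in>H. D (D x) = x - adj H (adj H T) (adj H T x)"
    using A DD by (auto simp: D_def)
  ultimately have "\<exists>D. positive_op H D \<and> (\<forall>x\<in>H. D (D x) = x - adj H (adj H T) (adj H T x))" by blast
  from someI_ex[OF this] show ?thesis
    unfolding defect_op_def by blast
qed

text \<open>The closure is taken in the ambient type; it stays inside the closed set H and inherits
  completeness from H as a closed part of it.\<close>

lemma hilbert_space_closure:
  assumes H: "hilbert_space H" and M: "complex_subspace M" "M \<subseteq> H"
  shows "hilbert_space (closure M)"
proof -
  note MD = complex_subspaceD[OF M(1)]
  have "closed H" using H by (simp add: hilbert_space_def complete_imp_closed)
  then have sub: "closure M \<subseteq> H" using M by (simp add: closure_minimal)
  have "complete H" using H by (simp add: hilbert_space_def)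
  then have "complete (H \<inter> closure M)" by (rule complete_Int_closed) simp
  then have "complete (closure M)" using sub by (simp add: Int_absorb1)
  moreover have "complex_subspace (closure M)"
    unfolding complex_subspace_def
  proof (intro conjI ballI allI)
    show "0 \<in> closure M" by (rule subsetD[OF closure_subset MD(1)])
  next
    fix x y assume "x \<in> closure M" "y \<in> closure M"
    then obtain s t where "\<forall>n. s n \<in> M" "s \<longlonglongrightarrow> x" "\<forall>n. t n \<in> M" "t \<longlonglongrightarrow> y"
      unfolding closure_sequential by blast
    then show "x + y \<in> closure M" unfolding closure_sequential
      by (intro exI[of _ "\<lambda>n. s n + t n"]) (auto intro: MD(2) tendsto_add)
  next
    fix a x assume "x \<in> closure M"
    then obtain s where "\<forall>n. s n \<in> M" "s \<longlonglongrightarrow> x"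
      unfolding closure_sequential by blast
    then show "a *\<^sub>C x \<in> closure M" unfolding closure_sequential
      by (intro exI[of _ "\<lambda>n. a *\<^sub>C s n"]) (auto intro: MD(3) bounded_linear.tendsto[OF bounded_linear_scaleC])
  qed
  ultimately show ?thesis by (simp add: hilbert_space_iff)
qed

lemma hilbert_space_defect_space:
  assumes H: "hilbert_space H" and T: "bounded_op H T" and iso: "\<And>x. x \<in> H \<Longrightarrow> norm (T x) = norm x"
  shows "hilbert_space (defect_space H (adj H T))"
proof -
  have S: "complex_subspace H" using H by (simp add: hilbert_space_iff)
  note HD = complex_subspaceD[OF S]
  have *: "defect_op H (adj H T) ` H \<subseteq> H" "clinear_on H (defect_op H (adj H T))"
    using defect_op_adj_isometry[OF assms] by (auto simp: positive_op_def bounded_op_def)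
  note L = clinear_onD[OF S *(2)]
  have "complex_subspace (defect_op H (adj H T) ` H)"
    unfolding complex_subspace_def using HD L(1,2)[symmetric] L(4)[symmetric]
    by (auto simp: image_iff)
  then show ?thesis
    unfolding defect_space_def using H * by (intro hilbert_space_closure)
qed

section \<open>Orthonormal bases of finite-dimensional subspaces\<close>

lemma orthonormalize:
  assumes S: "complex_subspace M" and "finite B" "B \<subseteq> M"
  shows "\<exists>B'. finite B' \<and> B' \<subseteq> M \<and> (\<forall>a\<in>B'. \<forall>b\<in>B'. cinner a b = (if a = b then 1 else 0)) \<and>
    (\<forall>b\<in>B. b = (\<Sum>e\<in>B'. cinner b e *\<^sub>C e))"
  using assms(2,3)
proof (induction B rule: finite_induct)
  case empty
  then show ?case by (intro exI[of _ "{}"]) auto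
next
  case (insert b B)
  note MD = complex_subspaceD[OF S]
  have "B \<subseteq> M" using insert.prems by simp
  then obtain B' where B'': "finite B' \<and> B' \<subseteq> M \<and> (\<forall>a\<in>B'. \<forall>b\<in>B'. cinner a b = (if a = b then 1 else 0)) \<and>
    (\<forall>b\<in>B. b = (\<Sum>e\<in>B'. cinner b e *\<^sub>C e))"
    using insert.IH by (elim exE meta_impE)
  then have B': "finite B'" "B' \<subseteq> M" "\<And>a b. a \<in> B' \<Longrightarrow> b \<in> B' \<Longrightarrow> cinner a b = (if a = b then 1 else 0)"
    "\<And>b. b \<in> B \<Longrightarrow> b = (\<Sum>e\<in>B'. cinner b e *\<^sub>C e)"
    by (simp_all only:)
  \<comment> \<open>Gram-Schmidt residual of \<open>b\<close>. It vanishes when \<open>b\<close>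
    depends on the earlier vectors, which must be allowed because \<open>finite_cdim\<close> only
    provides a spanning set.\<close>
  define v where "v = b - (\<Sum>e\<in>B'. cinner b e *\<^sub>C e)"
  have vM: "v \<in> M" unfolding v_def using B'(2) insert by (intro MD(4) complex_subspace_sum[OF S]) (auto intro!: MD(3))
  have orth: "cinner v e = 0" if "e \<in> B'" for e
  proof -
    have "cinner v e = cinner b e - (\<Sum>e'\<in>B'. cinner b e' * (if e' = e then 1 else 0))"
      using that by (simp add: v_def cinner_simps cinner_sum_left B'(3))
    then show ?thesis using that B'(1) by (simp add: if_distrib cong: if_cong)
  qed
  then have orth': "cinner e v = 0" if "e \<in> B'" for e
    using that cinner_commute[of e v] by simp
  show ?case
  proof (cases "v = 0")
    case True
    then show ?thesis using B'' by (intro exI[of _ B']) (auto simp: v_def)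
  next
    case False
    define w where "w = inverse (norm v) *\<^sub>R v"
    have w: "w \<in> M" "cinner w w = 1" "\<And>e. e \<in> B' \<Longrightarrow> cinner w e = 0" "\<And>e. e \<in> B' \<Longrightarrow> cinner e w = 0"
      using False vM orth orth' MD(3) by (auto simp: w_def scaleR_eq_scaleC cinner_simps cinner_self_norm power2_eq_square norm_scaleC norm_inverse)
    have wB: "w \<notin> B'" using w by force
    have 1: "b = (\<Sum>e\<in>insert w B'. cinner b e *\<^sub>C e)"
    proof -
      define s where "s = (\<Sum>e\<in>B'. cinner b e *\<^sub>C e)"
      have bs: "b = v + s" by (simp add: v_def s_def)
      have "cinner s w = 0" using w(4) by (simp add: s_def cinner_simps cinner_sum_left)
      then have "cinner b w = cinner v w"
        using arg_cong[OF bs, of "\<lambda>u. cinner u w"] by (simp add: cinner_simps)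
      also have "\<dots> = complex_of_real (norm v)"
        using False by (simp add: w_def scaleR_eq_scaleC cinner_simps cinner_self_norm power2_eq_square)
      finally have v: "cinner b w *\<^sub>C w = v"
        using False by (simp add: w_def scaleC_of_real)
      have A: "(\<Sum>e\<in>insert w B'. cinner b e *\<^sub>C e) = cinner b w *\<^sub>C w + s"
        using wB B'(1) by (simp add: s_def)
      show ?thesis unfolding A v by (rule bs)
    qed
    have 2: "x = (\<Sum>e\<in>insert w B'. cinner x e *\<^sub>C e)" if "x \<in> B" for x
    proof -
      have "cinner x w = 0"
        by (subst B'(4)[OF that]) (simp add: cinner_sum_left cinner_simps w)
      then show ?thesis using wB B'(1) by (simp add: B'(4)[OF that, symmetric])
    qed
    have 3: "\<forall>a\<in>insert w B'. \<forall>b\<in>insert w B'. cinner a b = (if a = b then 1 else 0)"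
      using B'(3) w wB by auto
    have 4: "\<forall>x\<in>insert b B. x = (\<Sum>e\<in>insert w B'. cinner x e *\<^sub>C e)"
    proof
      fix x assume "x \<in> insert b B"
      then consider "x = b" | "x \<in> B" by blast
      then show "x = (\<Sum>e\<in>insert w B'. cinner x e *\<^sub>C e)"
        by cases (hypsubst, rule 1, rule 2)
    qed
    show ?thesis
      by (intro exI[of _ "insert w B'"] conjI 3 4) (use B'(1,2) w(1) in auto)
  qed
qed

text \<open>The coefficients in \<open>finite_cdim\<close> are arbitrary; here they are inner
  products, so they depend linearly and continuously on \<open>x\<close>. This reduces vector-valued
  limits to finitely many scalar ones.\<close>

lemma finite_cdim_basis:
  assumes S: "complex_subspace M" and "finite_cdim M"
  obtains B where "finite B" "B \<subseteq> M" "\<And>x. x \<in> M \<Longrightarrow> x = (\<Sum>e\<in>B. cinner x e *\<^sub>C e)"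
proof -
  obtain C where C: "finite C" "C \<subseteq> M" "\<And>x. x \<in> M \<Longrightarrow> \<exists>c. x = (\<Sum>b\<in>C. c b *\<^sub>C b)"
    using assms(2) unfolding finite_cdim_def by blast
  obtain B where B: "finite B" "B \<subseteq> M" "\<And>b. b \<in> C \<Longrightarrow> b = (\<Sum>e\<in>B. cinner b e *\<^sub>C e)"
    using orthonormalize[OF S C(1,2)] by blast
  have "x = (\<Sum>e\<in>B. cinner x e *\<^sub>C e)" if x: "x \<in> M" for x
  proof -
    obtain c where c: "x = (\<Sum>b\<in>C. c b *\<^sub>C b)" using C(3)[OF x] by blast
    have scs: "a *\<^sub>C sum g B = (\<Sum>e\<in>B. a *\<^sub>C g e)" for a and g :: "'a \<Rightarrow> 'a"
      using bounded_linear_scaleC[of a] by (rule bounded_linear.linear[THEN linear_sum])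
    have ssl: "sum h C *\<^sub>C e = (\<Sum>b\<in>C. h b *\<^sub>C e)" for h and e :: 'a
      by (induction C rule: infinite_finite_induct) (auto simp: scaleC_add_left)
    have "x = (\<Sum>b\<in>C. c b *\<^sub>C (\<Sum>e\<in>B. cinner b e *\<^sub>C e))"
      unfolding c using B(3) by (intro sum.cong) auto
    also have "\<dots> = (\<Sum>e\<in>B. \<Sum>b\<in>C. c b *\<^sub>C cinner b e *\<^sub>C e)"
      unfolding scs by (rule sum.swap)
    also have "\<dots> = (\<Sum>e\<in>B. cinner x e *\<^sub>C e)"
      by (simp add: c cinner_sum_left cinner_simps ssl scaleC_scaleC)
    finally show ?thesis .
  qed
  with B show ?thesis using that by blast
qed

section \<open>Square integrable functions on the circle\<close>

abbreviation circle_measure_symbol ("\<mu>") where "\<mu> \<equiv> circle_measure"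

text \<open>In this form integrals over \<mu> turn into integrals over an interval by the rules for
  \<open>completion\<close>, \<open>distr\<close> and \<open>density\<close>.\<close>

lemma circle_measure_density:
  "\<mu> = completion (distr (density lborel (\<lambda>t. ennreal (indicator {0..2*pi} t / (2*pi)))) borel cis)"
proof -
  have "uniform_measure lborel {0..2*pi} = density lborel (\<lambda>t. ennreal (indicator {0..2*pi} t / (2*pi)))"
    unfolding uniform_measure_def
    by (intro arg_cong[of _ _ "density lborel"] ext) (simp add: indicator_def divide_ennreal[symmetric] del: ennreal_numeral)
  then show ?thesis by (simp add: circle_measure_def)
qed

lemma measurable_cis [measurable]: "cis \<in> borel_measurable borel"
  by (intro borel_measurable_continuous_onI continuous_intros)

lemma prob_space_circle_measure: "emeasure \<mu> UNIV = 1" "finite_measure \<mu>"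
proof -
  have "emeasure \<mu> UNIV = emeasure (distr (uniform_measure lborel {0..2*pi}) borel cis) UNIV"
    unfolding circle_measure_def by (subst emeasure_completion) (auto simp: main_part)
  also have "\<dots> = 1"
    by (subst emeasure_distr) (auto simp: emeasure_uniform_measure ennreal_divide_self del: ennreal_numeral)
  finally show 1: "emeasure \<mu> UNIV = 1" .
  show "finite_measure \<mu>"
    by (rule finite_measureI) (simp add: 1)
qed

interpretation circle: finite_measure \<mu>
  by (rule prob_space_circle_measure)

lemma measure_circle [simp]: "measure \<mu> UNIV = 1"
  by (simp add: measure_def prob_space_circle_measure)

lemma measurable_circle_measure: "f \<in> borel_measurable borel \<Longrightarrow> f \<in> borel_measurable \<mu>"
  unfolding circle_measure_def by (intro measurable_completion) simp

text \<open>The property has to be Borel here; \<open>AE_circle_if_AE_angle\<close> removes this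
  restriction.\<close>

lemma AE_circle_measureI:
  assumes "AE t in lborel. t \<in> {0..2*pi} \<longrightarrow> P (cis t)" "{z. P z} \<in> sets borel"
  shows "AE \<zeta> in \<mu>. P \<zeta>"
  unfolding circle_measure_density
  by (intro AE_completion)
    (use assms in \<open>auto simp: AE_distr_iff AE_density pred_def elim!: eventually_mono split: split_indicator_asm\<close>)

lemma AE_circle_norm: "AE \<zeta> in \<mu>. norm \<zeta> = 1"
  by (intro AE_circle_measureI) (auto simp: norm_cis)

lemma integrable_circle_iff:
  fixes F :: "complex \<Rightarrow> 'b::{banach, second_countable_topology}"
  assumes [measurable]: "F \<in> borel_measurable borel"
  shows "integrable \<mu> F \<longleftrightarrow> set_integrable lborel {0..2*pi} (\<lambda>t. F (cis t))"
proof -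
  have "integrable \<mu> F \<longleftrightarrow>
      integrable lborel (\<lambda>t. (indicator {0..2*pi} t / (2*pi)) *\<^sub>R F (cis t))"
    unfolding circle_measure_density by (simp add: integrable_completion integrable_distr_eq integrable_density)
  also have "\<dots> \<longleftrightarrow> integrable lborel (\<lambda>t. (1 / (2*pi)) *\<^sub>R indicator {0..2*pi} t *\<^sub>R F (cis t))"
    by (simp add: field_simps)
  also have "\<dots> \<longleftrightarrow> integrable lborel (\<lambda>t. indicator {0..2*pi} t *\<^sub>R F (cis t))"
    using integrable_scaleR_right[of "2*pi" lborel "\<lambda>t. (1 / (2*pi)) *\<^sub>R indicator {0..2*pi} t *\<^sub>R F (cis t)"]
      integrable_scaleR_right[of "1/(2*pi)" lborel "\<lambda>t. indicator {0..2*pi} t *\<^sub>R F (cis t)"] by auto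
  finally show ?thesis by (simp add: set_integrable_def)
qed

lemma integral_circle:
  fixes F :: "complex \<Rightarrow> 'b::{banach, second_countable_topology}"
  assumes [measurable]: "F \<in> borel_measurable borel"
  shows "integral\<^sup>L \<mu> F = (1 / (2*pi)) *\<^sub>R (LINT t:{0..2*pi}|lborel. F (cis t))"
proof -
  have "integral\<^sup>L \<mu> F =
      integral\<^sup>L lborel (\<lambda>t. (indicator {0..2*pi} t / (2*pi)) *\<^sub>R F (cis t))"
    unfolding circle_measure_density by (simp add: integral_completion integral_distr integral_density)
  also have "\<dots> = integral\<^sup>L lborel (\<lambda>t. (1 / (2*pi)) *\<^sub>R indicator {0..2*pi} t *\<^sub>R F (cis t))"
    by (simp add: field_simps)
  also have "\<dots> = (1 / (2*pi)) *\<^sub>R (LINT t:{0..2*pi}|lborel. F (cis t))"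
    unfolding set_lebesgue_integral_def by (rule integral_scaleR_right)
  finally show ?thesis .
qed

text \<open>Meant for scalar factors such as \<open>circle_power\<close>, whose strong measurability
  then follows from continuity.\<close>

lemma strongly_measurable_of_borel:
  fixes f :: "complex \<Rightarrow> 'b::{metric_space, second_countable_topology}"
  assumes "f \<in> borel_measurable \<mu>"
  shows "strongly_measurable \<mu> f"
  using borel_measurable_implies_sequence_metric[OF assms, of undefined]
  unfolding strongly_measurable_def by auto

lemma strongly_measurable_cong_AE:
  assumes "strongly_measurable M f" "AE x in M. f x = g x"
  shows "strongly_measurable M g"
proof -
  obtain s where s: "\<And>k::nat. simple_function M (s k)" "AE x in M. (\<lambda>k. s k x) \<longlonglongrightarrow> f x"
    using assms(1) unfolding strongly_measurable_def by auto
  moreover have "AE x in M. (\<lambda>k. s k x) \<longlonglongrightarrow> g x"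
    using s(2) assms(2) by eventually_elim simp
  ultimately show ?thesis unfolding strongly_measurable_def by blast
qed

text \<open>By monotone convergence the sum has a finite integral, hence is finite almost
  everywhere.\<close>

lemma AE_summable_if_summable_integral:
  assumes int: "\<And>k. integrable M (u k)" and nonneg: "\<And>k x. 0 \<le> (u k x :: real)"
    and sum: "summable (\<lambda>k. integral\<^sup>L M (u k))"
  shows "AE x in M. summable (\<lambda>k::nat. u k x)"
proof -
  have [measurable]: "u k \<in> borel_measurable M" for k using int[of k] by auto
  have "(\<integral>\<^sup>+x. (\<Sum>k. ennreal (u k x)) \<partial>M) = (\<Sum>k. \<integral>\<^sup>+x. ennreal (u k x) \<partial>M)"
    by (rule nn_integral_suminf) simp
  also have "\<dots> = (\<Sum>k. ennreal (integral\<^sup>L M (u k)))"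
    by (intro arg_cong[of _ _ suminf] ext nn_integral_eq_integral int) (use nonneg in auto)
  also have "\<dots> \<noteq> \<infinity>"
    using sum nonneg by (simp add: ennreal_suminf_neq_top)
  finally have "AE x in M. (\<Sum>k. ennreal (u k x)) \<noteq> \<infinity>"
    by (intro nn_integral_PInf_AE) auto
  then show ?thesis
    by eventually_elim (auto intro!: summable_suminf_not_top nonneg)
qed

text \<open>The approximants are chosen close in measure: the integrals of the truncated errors \<open>min 1 \<dots>\<close> are summable.\<close>

lemma strongly_measurable_AE_limit:
  fixes f :: "nat \<Rightarrow> complex \<Rightarrow> 'b::real_normed_vector"
  assumes f: "\<And>k. strongly_measurable \<mu> (f k)"
    and lim: "AE \<zeta> in \<mu>. (\<lambda>k. f k \<zeta>) \<longlonglongrightarrow> g \<zeta>"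
  shows "strongly_measurable \<mu> g"
proof -
  have "\<exists>s. simple_function \<mu> s \<and>
      (\<integral>\<zeta>. min 1 (norm (s \<zeta> - f k \<zeta>)) \<partial>\<mu>) \<le> (1/2)^k \<and>
      integrable \<mu> (\<lambda>\<zeta>. min 1 (norm (s \<zeta> - f k \<zeta>)))" for k
  proof -
    obtain s where s: "\<And>j::nat. simple_function \<mu> (s j)"
        "AE x in \<mu>. (\<lambda>j. s j x) \<longlonglongrightarrow> f k x"
      using f[of k] unfolding strongly_measurable_def by auto
    \<comment> \<open>Truncated at 1 so that the constant 1 dominates; nothing is assumed about the
      integrability of \<open>f k\<close>.\<close>
    define u where "u j \<zeta> = min 1 (norm (s j \<zeta> - f k \<zeta>))" for j \<zeta>
    have sm: "strongly_measurable \<mu> (s j)" for j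
      using s(1) unfolding strongly_measurable_def by (intro exI[of _ "\<lambda>k. s j"]) auto
    have um: "u j \<in> borel_measurable \<mu>" for j
      unfolding u_def
      by (rule strongly_measurable_borel, rule strongly_measurable_compose2[OF sm f, where h = "\<lambda>a b. min 1 (norm (a - b))"])
        (intro continuous_intros)
    have "(\<lambda>j. integral\<^sup>L \<mu> (u j)) \<longlonglongrightarrow> (\<integral>\<zeta>. 0 \<partial>\<mu>)"
    proof (rule integral_dominated_convergence[where w = "\<lambda>_. 1"])
      show "AE x in \<mu>. (\<lambda>j. u j x) \<longlonglongrightarrow> 0"
        using s(2)
      proof eventually_elim
        case (elim x)
        then have "(\<lambda>j. min 1 (norm (s j x - f k x))) \<longlonglongrightarrow> min 1 (norm (f k x - f k x))"
          by (intro tendsto_intros)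
        then show ?case by (simp add: u_def)
      qed
    qed (use um in \<open>auto simp: u_def\<close>)
    then have "\<forall>\<^sub>F j in sequentially. integral\<^sup>L \<mu> (u j) < (1/2)^k"
      by (intro order_tendstoD) auto
    then obtain j where "integral\<^sup>L \<mu> (u j) < (1/2)^k"
      by (auto simp: eventually_sequentially)
    moreover have "integrable \<mu> (u j)"
      by (rule circle.integrable_const_bound[where B = 1]) (use um in \<open>auto simp: u_def\<close>)
    ultimately show ?thesis using s(1)[of j] by (intro exI[of _ "s j"]) (auto simp flip: u_def)
  qed
  then obtain s where s: "\<And>k. simple_function \<mu> (s k)"
      "\<And>k. (\<integral>\<zeta>. min 1 (norm (s k \<zeta> - f k \<zeta>)) \<partial>\<mu>) \<le> (1/2)^k"
      "\<And>k. integrable \<mu> (\<lambda>\<zeta>. min 1 (norm (s k \<zeta> - f k \<zeta>)))"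
    by metis
  have "AE \<zeta> in \<mu>. summable (\<lambda>k. min 1 (norm (s k \<zeta> - f k \<zeta>)))"
  proof (rule AE_summable_if_summable_integral[OF s(3)])
    show "summable (\<lambda>k. \<integral>\<zeta>. min 1 (norm (s k \<zeta> - f k \<zeta>)) \<partial>\<mu>)"
      by (rule summable_comparison_test'[where g = "\<lambda>k. (1/2)^k" and N = 0])
        (use s(2) in \<open>auto simp: summable_geometric integral_nonneg_AE\<close>)
  qed auto
  with lim have "AE \<zeta> in \<mu>. (\<lambda>k. s k \<zeta>) \<longlonglongrightarrow> g \<zeta>"
  proof eventually_elim
    case (elim \<zeta>)
    have "(\<lambda>k. min 1 (norm (s k \<zeta> - f k \<zeta>))) \<longlonglongrightarrow> 0"
      by (rule summable_LIMSEQ_zero[OF elim(2)])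
    then have "(\<lambda>k. norm (s k \<zeta> - f k \<zeta>)) \<longlonglongrightarrow> 0"
    \<comment> \<open>Once the truncated error is below 1, the truncation is inactive.\<close>
    proof (rule Lim_transform_eventually)
      show "\<forall>\<^sub>F k in sequentially. min 1 (norm (s k \<zeta> - f k \<zeta>)) = norm (s k \<zeta> - f k \<zeta>)"
        using order_tendstoD(2)[OF \<open>(\<lambda>k. min 1 (norm (s k \<zeta> - f k \<zeta>))) \<longlonglongrightarrow> 0\<close>, of 1]
        by (auto elim!: eventually_mono)
    qed
    then have "(\<lambda>k. s k \<zeta> - f k \<zeta>) \<longlonglongrightarrow> 0"
      by (rule tendsto_norm_zero_cancel)
    from tendsto_add[OF this elim(1)] show ?case by simp
  qed
  with s(1) show ?thesis unfolding strongly_measurable_def by blast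
qed

lemma sq_integrable_cong_AE:
  assumes f: "sq_integrable f" and eq: "AE \<zeta> in \<mu>. f \<zeta> = g \<zeta>"
  shows "sq_integrable g"
proof -
  have sm: "strongly_measurable \<mu> g"
    using f eq strongly_measurable_cong_AE by (auto simp: sq_integrable_def)
  moreover have "integrable \<mu> (\<lambda>\<zeta>. (norm (g \<zeta>))\<^sup>2)"
    using f eq by (intro integrable_cong_AE_imp[OF _ borel_measurable_norm_square[OF sm]])
      (auto simp: sq_integrable_def elim!: eventually_mono)
  ultimately show ?thesis by (simp add: sq_integrable_def)
qed

lemma sq_integrable_bounded:
  assumes sm: "strongly_measurable \<mu> f" and "AE \<zeta> in \<mu>. norm (f \<zeta>) \<le> C"
  shows "sq_integrable f"
  unfolding sq_integrable_def
proof (intro conjI sm circle.integrable_const_bound[where B = "C\<^sup>2"])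
  show "AE \<zeta> in \<mu>. norm ((norm (f \<zeta>))\<^sup>2) \<le> C\<^sup>2"
    using assms(2) by eventually_elim (auto intro: power_mono)
qed (rule borel_measurable_norm_square[OF sm])

section \<open>Representatives of square integrable classes\<close>

lemma sq_integrable_rep [simp]: "sq_integrable (rep_L2_circle g)"
  using Quotient3_rep_reflp[OF Quotient3_L2_circle, of g] by auto

lemma AE_rep_abs:
  assumes "sq_integrable f"
  shows "AE \<zeta> in \<mu>. rep_L2_circle (abs_L2_circle f) \<zeta> = f \<zeta>"
  using Quotient3_rep_abs[OF Quotient3_L2_circle, of f] assms by auto

lemma abs_rep_L2 [simp]: "abs_L2_circle (rep_L2_circle g) = g"
  by (rule Quotient3_abs_rep[OF Quotient3_L2_circle])

lemma abs_L2_eqI: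
  assumes "sq_integrable f" "AE \<zeta> in \<mu>. f \<zeta> = g \<zeta>"
  shows "abs_L2_circle f = abs_L2_circle g"
  using assms sq_integrable_cong_AE[OF assms]
  by (intro Quotient3_rel_abs[OF Quotient3_L2_circle]) auto

lemma L2_eqI:
  assumes "AE \<zeta> in \<mu>. rep_L2_circle f \<zeta> = rep_L2_circle g \<zeta>"
  shows "f = g"
  using abs_L2_eqI[OF sq_integrable_rep assms] by simp

lemma AE_rep_add: "AE \<zeta> in \<mu>. rep_L2_circle (f + g) \<zeta> = rep_L2_circle f \<zeta> + rep_L2_circle g \<zeta>"
proof -
  have "f + g = abs_L2_circle (\<lambda>\<zeta>. rep_L2_circle f \<zeta> + rep_L2_circle g \<zeta>)"
    using plus_L2_circle.abs_eq[of "rep_L2_circle f" "rep_L2_circle g"] by simp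
  then show ?thesis
    using AE_rep_abs[OF sq_integrable_add[OF sq_integrable_rep sq_integrable_rep]] by metis
qed

lemma AE_rep_diff: "AE \<zeta> in \<mu>. rep_L2_circle (f - g) \<zeta> = rep_L2_circle f \<zeta> - rep_L2_circle g \<zeta>"
proof -
  have "f - g = abs_L2_circle (\<lambda>\<zeta>. rep_L2_circle f \<zeta> - rep_L2_circle g \<zeta>)"
    using minus_L2_circle.abs_eq[of "rep_L2_circle f" "rep_L2_circle g"] by simp
  then show ?thesis
    using AE_rep_abs[OF sq_integrable_diff[OF sq_integrable_rep sq_integrable_rep]] by metis
qed

lemma AE_rep_scaleC: "AE \<zeta> in \<mu>. rep_L2_circle (a *\<^sub>C f) \<zeta> = a *\<^sub>C rep_L2_circle f \<zeta>"
proof -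
  have "a *\<^sub>C f = abs_L2_circle (\<lambda>\<zeta>. a *\<^sub>C rep_L2_circle f \<zeta>)"
    using scaleC_L2_circle.abs_eq[of "rep_L2_circle f" a] by simp
  then show ?thesis
    using AE_rep_abs[OF sq_integrable_scaleC[OF sq_integrable_rep]] by metis
qed

lemma AE_rep_zero: "AE \<zeta> in \<mu>. rep_L2_circle 0 \<zeta> = 0"
  using AE_rep_abs[OF sq_integrable_zero] by (simp add: zero_L2_circle_def)

lemma cinner_L2: "cinner f g = (\<integral>\<zeta>. cinner (rep_L2_circle f \<zeta>) (rep_L2_circle g \<zeta>) \<partial>\<mu>)"
  using cinner_L2_circle.abs_eq[of "rep_L2_circle f" "rep_L2_circle g"] by simp

lemma cinner_abs_L2:
  assumes "sq_integrable f" "sq_integrable g"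
  shows "cinner (abs_L2_circle f) (abs_L2_circle g) = (\<integral>\<zeta>. cinner (f \<zeta>) (g \<zeta>) \<partial>\<mu>)"
  using cinner_L2_circle.abs_eq[of f g] assms by simp

lemma cinner_L2_abs:
  assumes "sq_integrable g"
  shows "cinner f (abs_L2_circle g) = (\<integral>\<zeta>. cinner (rep_L2_circle f \<zeta>) (g \<zeta>) \<partial>\<mu>)"
  using cinner_abs_L2[OF sq_integrable_rep assms, of f] by simp

lemma norm_L2: "(norm f)\<^sup>2 = (\<integral>\<zeta>. (norm (rep_L2_circle f \<zeta>))\<^sup>2 \<partial>\<mu>)"
proof -
  have "(norm f)\<^sup>2 = inner f f" by (rule power2_norm_eq_inner)
  also have "\<dots> = (\<integral>\<zeta>. inner (rep_L2_circle f \<zeta>) (rep_L2_circle f \<zeta>) \<partial>\<mu>)"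
    using inner_L2_circle.abs_eq[of "rep_L2_circle f" "rep_L2_circle f"] by simp
  finally show ?thesis by (simp add: power2_norm_eq_inner)
qed

section \<open>Completeness of the L2 space\<close>

lemma Cauchy_if_summable_norm_diff:
  fixes x :: "nat \<Rightarrow> 'a::real_normed_vector"
  assumes "summable (\<lambda>k. norm (x (Suc k) - x k))"
  shows "Cauchy x"
proof (rule metric_CauchyI)
  fix e :: real assume "e > 0"
  then obtain N where N: "\<And>m n. m \<ge> N \<Longrightarrow> norm (\<Sum>k=m..<n. norm (x (Suc k) - x k)) < e"
    using assms unfolding summable_Cauchy by blast
  have le: "dist (x m) (x n) < e" if "N \<le> m" "m \<le> n" for m n
  proof -
    have "norm (x n - x m) = norm (\<Sum>k=m..<n. x (Suc k) - x k)"
      using that by (simp add: sum_Suc_diff')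
    also have "\<dots> \<le> (\<Sum>k=m..<n. norm (x (Suc k) - x k))"
      by (rule norm_sum)
    also have "\<dots> < e" using N[OF that(1), of n] by simp
    finally show ?thesis by (simp add: dist_norm norm_minus_commute)
  qed
  show "\<exists>M. \<forall>m\<ge>M. \<forall>n\<ge>M. dist (x m) (x n) < e"
    by (rule exI[of _ N]) (metis le dist_commute linear)
qed

text \<open>Riesz-Fischer for functions with values in a complete set. Pointwise limits exist
  because the values lie in E, as the ambient type is not assumed complete; membership in E almost
  everywhere passes to the limit, as needed for the Hardy spaces.\<close>

lemma L2_circle_complete:
  fixes s :: "nat \<Rightarrow> 'e::complex_inner L2_circle"
  assumes E: "complete E" and sE: "\<And>n. AE \<zeta> in \<mu>. rep_L2_circle (s n) \<zeta> \<in> E"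
    and "Cauchy s"
  shows "\<exists>l. (AE \<zeta> in \<mu>. rep_L2_circle l \<zeta> \<in> E) \<and> s \<longlonglongrightarrow> l"
proof -
  have "\<exists>N. \<forall>m\<ge>N. \<forall>n\<ge>N. norm (s m - s n) < (1/2)^k" for k
    using CauchyD[OF \<open>Cauchy s\<close>, of "(1/2)^k"] by simp
  then obtain N where N: "\<And>k m n. m \<ge> N k \<Longrightarrow> n \<ge> N k \<Longrightarrow> norm (s m - s n) < (1/2)^k"
    by metis
  \<comment> \<open>A sum rather than the single index \<open>N k\<close>, so that
    \<open>r j\<close> is at least \<open>N k\<close> for every k up to j.\<close>
  define r where "r k = (\<Sum>i\<le>k. N i)" for k
  have rN: "N k \<le> r j" if "k \<le> j" for k j
    unfolding r_def using that by (intro member_le_sum) auto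
  have rs: "norm (s m - s (r k)) < (1/2)^k" if "m \<ge> r k" for m k
    using N[of k m "r k"] rN[of k k] that by simp
  have rr: "norm (s (r j) - s (r k)) < (1/2)^k" if "j \<ge> k" for j k
    using N[of k "r j" "r k"] rN[of k k] rN[OF that] by simp
  define x where "x k = rep_L2_circle (s (r k))" for k
  have xd: "AE \<zeta> in \<mu>. rep_L2_circle (s (r j) - s (r k)) \<zeta> = x j \<zeta> - x k \<zeta>" for j k
    unfolding x_def by (rule AE_rep_diff)
  have sqd: "sq_integrable (\<lambda>\<zeta>. x j \<zeta> - x k \<zeta>)" for j k
    unfolding x_def by (intro sq_integrable_diff sq_integrable_rep)
  have xn: "(\<integral>\<zeta>. (norm (x j \<zeta> - x k \<zeta>))\<^sup>2 \<partial>\<mu>) \<le> ((1/2)^k)\<^sup>2" if "k \<le> j" for j k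
  proof -
    have "(\<integral>\<zeta>. (norm (x j \<zeta> - x k \<zeta>))\<^sup>2 \<partial>\<mu>) = (norm (s (r j) - s (r k)))\<^sup>2"
      unfolding norm_L2 using sqd[of j k] sq_integrable_rep[of "s (r j) - s (r k)"] xd[of j k]
      by (intro AE_cong_integral) (auto simp: sq_integrable_def elim!: eventually_mono)
    also have "\<dots> \<le> ((1/2)^k)\<^sup>2"
      using rr[OF that] by (intro power_mono) auto
    finally show ?thesis .
  qed
  define d where "d k \<zeta> = norm (x (Suc k) \<zeta> - x k \<zeta>)" for k \<zeta>
  have dm: "d k \<in> borel_measurable \<mu>" for k
    unfolding d_def
    by (rule strongly_measurable_borel, rule strongly_measurable_compose[where h = norm])
      (use sqd in \<open>auto simp: sq_integrable_def\<close>)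
  \<comment> \<open>The arithmetic-geometric mean inequality with weight 2^k turns the bound 4^(-k)
    on the squared L2 norm into the summable L1 bound 2^(-k).\<close>
  have dle: "d k \<zeta> \<le> (2^k * (norm (x (Suc k) \<zeta> - x k \<zeta>))\<^sup>2 + (1/2)^k) / 2" for k \<zeta>
  proof -
    have "0 \<le> 2^k * (d k \<zeta> - (1/2)^k)\<^sup>2" by simp
    also have "\<dots> = 2^k * (d k \<zeta>)\<^sup>2 - 2 * d k \<zeta> + (1/2)^k"
      by (simp add: power2_diff field_simps power2_eq_square)
    finally show ?thesis by (simp add: d_def)
  qed
  have bi: "integrable \<mu> (\<lambda>\<zeta>. (2^k * (norm (x (Suc k) \<zeta> - x k \<zeta>))\<^sup>2 + (1/2)^k) / 2)" for k
    using sqd[of "Suc k" k] by (auto simp: sq_integrable_def)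
  have di: "integrable \<mu> (d k)" for k
    by (rule Bochner_Integration.integrable_bound[OF bi dm]) (use dle in \<open>auto simp: d_def\<close>)
  have dint: "integral\<^sup>L \<mu> (d k) \<le> (1/2)^k" for k
  proof -
    have "integral\<^sup>L \<mu> (d k) \<le>
        (\<integral>\<zeta>. (2^k * (norm (x (Suc k) \<zeta> - x k \<zeta>))\<^sup>2 + (1/2)^k) / 2 \<partial>\<mu>)"
      by (rule integral_mono[OF di bi dle])
    also have "\<dots> = (2^k * (\<integral>\<zeta>. (norm (x (Suc k) \<zeta> - x k \<zeta>))\<^sup>2 \<partial>\<mu>) + (1/2)^k) / 2"
      using sqd[of "Suc k" k] by (simp add: sq_integrable_def)
    also have "\<dots> \<le> (2^k * ((1/2)^k)\<^sup>2 + (1/2)^k) / 2"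
      using xn[of k "Suc k"] by (intro divide_right_mono add_right_mono mult_left_mono) auto
    also have "\<dots> = (1/2)^k" by (simp add: power2_eq_square field_simps)
    finally show ?thesis .
  qed
  have "AE \<zeta> in \<mu>. summable (\<lambda>k. d k \<zeta>)"
  proof (rule AE_summable_if_summable_integral[OF di])
    show "summable (\<lambda>k. integral\<^sup>L \<mu> (d k))"
      by (rule summable_comparison_test'[where g = "\<lambda>k. (1/2)^k" and N = 0])
        (use dint in \<open>auto simp: summable_geometric integral_nonneg_AE d_def\<close>)
  qed (simp add: d_def)
  moreover have "AE \<zeta> in \<mu>. \<forall>k. x k \<zeta> \<in> E"
    unfolding x_def AE_all_countable using sE by blast
  ultimately have exl: "AE \<zeta> in \<mu>. \<exists>l. l \<in> E \<and> (\<lambda>k. x k \<zeta>) \<longlonglongrightarrow> l"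
  proof eventually_elim
    case (elim \<zeta>)
    then have "Cauchy (\<lambda>k. x k \<zeta>)"
      unfolding d_def by (intro Cauchy_if_summable_norm_diff)
    then show ?case using E[unfolded complete_def, rule_format, of "\<lambda>k. x k \<zeta>"] elim(2) by auto
  qed
  \<comment> \<open>The choice is arbitrary off the set of convergence; measurability is recovered
    from the almost everywhere limit.\<close>
  define g where "g \<zeta> = (SOME l. l \<in> E \<and> (\<lambda>k. x k \<zeta>) \<longlonglongrightarrow> l)" for \<zeta>
  from exl have g: "AE \<zeta> in \<mu>. g \<zeta> \<in> E \<and> (\<lambda>k. x k \<zeta>) \<longlonglongrightarrow> g \<zeta>"
  proof eventually_elim
    case (elim \<zeta>)
    then show ?case unfolding g_def by (rule someI_ex)
  qed
  have gm: "strongly_measurable \<mu> g"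
    by (rule strongly_measurable_AE_limit[where f = x])
      (use g sq_integrable_rep in \<open>auto simp: x_def sq_integrable_def elim!: eventually_mono\<close>)
  have xm: "strongly_measurable \<mu> (x k)" for k
    using sq_integrable_rep by (auto simp: x_def sq_integrable_def)
  have gxm: "strongly_measurable \<mu> (\<lambda>\<zeta>. g \<zeta> - x k \<zeta>)" for k
    by (rule strongly_measurable_compose2[OF gm xm, where h = "\<lambda>a b. a - b"]) (intro continuous_intros)
  \<comment> \<open>Fatou's lemma in the index \<open>j\<close>, with \<open>k\<close>
    fixed.\<close>
  have gx: "(\<integral>\<^sup>+\<zeta>. ennreal ((norm (g \<zeta> - x k \<zeta>))\<^sup>2) \<partial>\<mu>) \<le> ennreal (((1/2)^k)\<^sup>2)" for k
  proof -
    have "(\<integral>\<^sup>+\<zeta>. ennreal ((norm (g \<zeta> - x k \<zeta>))\<^sup>2) \<partial>\<mu>) =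
        (\<integral>\<^sup>+\<zeta>. liminf (\<lambda>j. ennreal ((norm (x j \<zeta> - x k \<zeta>))\<^sup>2)) \<partial>\<mu>)"
    proof (rule nn_integral_cong_AE, use g in eventually_elim)
      case (elim \<zeta>)
      then have "(\<lambda>j. ennreal ((norm (x j \<zeta> - x k \<zeta>))\<^sup>2)) \<longlonglongrightarrow> ennreal ((norm (g \<zeta> - x k \<zeta>))\<^sup>2)"
        by (intro tendsto_ennrealI tendsto_intros) auto
      from lim_imp_Liminf[OF _ this] show ?case by (metis sequentially_bot)
    qed
    also have "\<dots> \<le> liminf (\<lambda>j. \<integral>\<^sup>+\<zeta>. ennreal ((norm (x j \<zeta> - x k \<zeta>))\<^sup>2) \<partial>\<mu>)"
      by (intro nn_integral_liminf measurable_compose[OF _ measurable_ennreal] borel_measurable_norm_square)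
        (use sqd in \<open>auto simp: sq_integrable_def\<close>)
    also have "\<dots> \<le> ennreal (((1/2)^k)\<^sup>2)"
    proof (rule Liminf_le)
      show "\<forall>\<^sub>F j in sequentially.
          (\<integral>\<^sup>+\<zeta>. ennreal ((norm (x j \<zeta> - x k \<zeta>))\<^sup>2) \<partial>\<mu>) \<le> ennreal (((1/2)^k)\<^sup>2)"
        unfolding eventually_sequentially
      proof (intro exI allI impI)
        fix j assume "k \<le> j"
        have "(\<integral>\<^sup>+\<zeta>. ennreal ((norm (x j \<zeta> - x k \<zeta>))\<^sup>2) \<partial>\<mu>) =
            ennreal (\<integral>\<zeta>. (norm (x j \<zeta> - x k \<zeta>))\<^sup>2 \<partial>\<mu>)"
          by (intro nn_integral_eq_integral) (use sqd in \<open>auto simp: sq_integrable_def\<close>)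
        then show "(\<integral>\<^sup>+\<zeta>. ennreal ((norm (x j \<zeta> - x k \<zeta>))\<^sup>2) \<partial>\<mu>) \<le> ennreal (((1/2)^k)\<^sup>2)"
          using xn[OF \<open>k \<le> j\<close>] by (simp add: ennreal_leI del: ennreal_power)
      qed
    qed simp
    finally show ?thesis .
  qed
  have gsq: "sq_integrable (\<lambda>\<zeta>. g \<zeta> - x k \<zeta>)" for k
    unfolding sq_integrable_def
  proof (intro conjI gxm integrableI_nonneg)
    show "(\<integral>\<^sup>+\<zeta>. ennreal ((norm (g \<zeta> - x k \<zeta>))\<^sup>2) \<partial>\<mu>) < \<infinity>"
      using gx[of k] by (rule order.strict_trans1) simp
  qed (use borel_measurable_norm_square[OF gxm] in auto)
  have sqg: "sq_integrable g"
    using sq_integrable_add[OF gsq[of 0], of "x 0"] by (simp add: x_def)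
  define l where "l = abs_L2_circle g"
  have lg: "AE \<zeta> in \<mu>. rep_L2_circle l \<zeta> = g \<zeta>"
    unfolding l_def by (rule AE_rep_abs[OF sqg])
  have lx: "norm (l - s (r k)) \<le> (1/2)^k" for k
  proof -
    have "AE \<zeta> in \<mu>. rep_L2_circle (l - s (r k)) \<zeta> = g \<zeta> - x k \<zeta>"
      using AE_rep_diff[of l "s (r k)"] lg by eventually_elim (simp add: x_def)
    then have "(norm (l - s (r k)))\<^sup>2 = (\<integral>\<zeta>. (norm (g \<zeta> - x k \<zeta>))\<^sup>2 \<partial>\<mu>)"
      unfolding norm_L2 using gsq[of k] sq_integrable_rep[of "l - s (r k)"]
      by (intro AE_cong_integral) (auto simp: sq_integrable_def elim!: eventually_mono)
    then have "ennreal ((norm (l - s (r k)))\<^sup>2) = (\<integral>\<^sup>+\<zeta>. ennreal ((norm (g \<zeta> - x k \<zeta>))\<^sup>2) \<partial>\<mu>)"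
      using gsq[of k] by (subst nn_integral_eq_integral) (auto simp: sq_integrable_def)
    with gx[of k] have "(norm (l - s (r k)))\<^sup>2 \<le> ((1/2)^k)\<^sup>2"
      by (metis ennreal_le_iff zero_le_power2)
    then show ?thesis by (rule power2_le_imp_le) simp
  qed
  have "s \<longlonglongrightarrow> l"
  proof (rule LIMSEQ_I)
    fix e :: real assume "e > 0"
    then obtain k where k: "(1/2)^k < e / 2"
      using real_arch_pow_inv[of "e/2" "1/2"] by auto
    have "norm (s m - l) < e" if "m \<ge> r k" for m
    proof -
      have "norm (s m - l) \<le> norm (s m - s (r k)) + norm (l - s (r k))"
        using norm_triangle_ineq4[of "s m - s (r k)" "l - s (r k)"] by simp
      with rs[OF that] lx[of k] k show ?thesis by linarith
    qed
    then show "\<exists>no. \<forall>n\<ge>no. norm (s n - l) < e" by blast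
  qed
  moreover have "AE \<zeta> in \<mu>. rep_L2_circle l \<zeta> \<in> E"
    using lg g by eventually_elim simp
  ultimately show ?thesis by blast
qed

section \<open>Hardy spaces and lifted unitaries\<close>

lemma adj_cong: "(\<And>x. x \<in> H \<Longrightarrow> S x = T x) \<Longrightarrow> adj H S y = adj H T y"
  by (simp add: adj_def cong: conj_cong ball_cong)

text \<open>Negative powers use \<open>cnj\<close> instead of the inverse: both agree on the unit
  circle, but this form is continuous on the whole plane, where \<mu> is defined.\<close>

definition circle_power :: "int \<Rightarrow> complex \<Rightarrow> complex" where
  "circle_power m \<zeta> = (if 0 \<le> m then \<zeta> ^ nat m else cnj \<zeta> ^ nat (- m))"

lemma circle_power_0 [simp]: "circle_power 0 \<zeta> = 1"
  by (simp add: circle_power_def)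

lemma circle_power_1 [simp]: "circle_power 1 \<zeta> = \<zeta>"
  by (simp add: circle_power_def)

lemma circle_power_of_nat: "circle_power (int k) \<zeta> = \<zeta> ^ k"
  by (simp add: circle_power_def)

lemma cnj_circle_power: "cnj (circle_power m \<zeta>) = circle_power (- m) \<zeta>"
  by (auto simp: circle_power_def)

lemma circle_power_add:
  assumes "norm \<zeta> = 1"
  shows "circle_power (m + n) \<zeta> = circle_power m \<zeta> * circle_power n \<zeta>"
proof -
  have "\<zeta> * cnj \<zeta> = 1"
    by (metis assms complex_norm_square of_real_1 power_one)
  then have "circle_power k \<zeta> = \<zeta> powi k" for k
    by (auto simp: circle_power_def power_int_def inverse_unique)
  moreover have "\<zeta> \<noteq> 0" using assms by auto
  ultimately show ?thesis by (simp add: power_int_add)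
qed

lemma circle_power_cis: "circle_power m (cis t) = cis (of_int m * t)"
  by (simp add: circle_power_def cis_cnj Complex.DeMoivre)

lemma norm_circle_power: "norm \<zeta> = 1 \<Longrightarrow> norm (circle_power m \<zeta>) = 1"
  by (simp add: circle_power_def norm_power)

lemma continuous_circle_power: "continuous_on UNIV (circle_power m)"
  unfolding circle_power_def by (cases "0 \<le> m") (auto intro!: continuous_intros)

lemma measurable_circle_power [measurable]: "circle_power m \<in> borel_measurable borel"
  by (rule borel_measurable_continuous_onI[OF continuous_circle_power])

lemma integral_circle_power: "(\<integral>\<zeta>. circle_power m \<zeta> \<partial>\<mu>) = (if m = 0 then 1 else 0)"
proof (cases "m = 0")
  case False
  have "((\<lambda>t. cis (of_int m * t)) has_integral
      (cis (of_int m * (2 * pi)) / (\<i> * of_int m) - cis (of_int m * 0) / (\<i> * of_int m))) {0..2*pi}"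
  proof (rule fundamental_theorem_of_calculus)
    fix t :: real
    have "((\<lambda>z. exp (\<i> * of_int m * z) / (\<i> * of_int m)) has_field_derivative exp (\<i> * of_int m * of_real t)) (at (of_real t))"
      using False by (auto intro!: derivative_eq_intros)
    from has_vector_derivative_real_field[OF this]
    show "((\<lambda>t. cis (of_int m * t) / (\<i> * of_int m)) has_vector_derivative cis (of_int m * t)) (at t within {0..2*pi})"
      by (simp add: cis_conv_exp mult.assoc)
  qed simp
  moreover have "cis (of_int m * (2 * pi)) = 1"
    by (metis cis_multiple_2pi Ints_of_int mult.commute mult.left_commute)
  ultimately have "integral {0..2*pi} (\<lambda>t. cis (of_int m * t)) = 0"
    by (auto dest: integral_unique)
  moreover have "set_integrable lborel {0..2*pi} (\<lambda>t. cis (of_int m * t))"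
    by (intro borel_integrable_atLeastAtMost' continuous_intros)
  ultimately show ?thesis
    using False by (simp add: integral_circle circle_power_cis set_borel_integral_eq_integral(2))
qed simp

definition trig_monomial :: "int \<Rightarrow> 'e::complex_inner \<Rightarrow> 'e L2_circle" where
  "trig_monomial m x = abs_L2_circle (\<lambda>\<zeta>. circle_power m \<zeta> *\<^sub>C x)"

lemma sq_integrable_trig_monomial: "sq_integrable (\<lambda>\<zeta>. circle_power m \<zeta> *\<^sub>C (x::'e::complex_inner))"
proof (rule sq_integrable_bounded[where C = "norm x"])
  have "strongly_measurable \<mu> (circle_power m)"
    by (intro strongly_measurable_of_borel measurable_circle_measure) simp
  then show "strongly_measurable \<mu> (\<lambda>\<zeta>. circle_power m \<zeta> *\<^sub>C x)"
    by (rule strongly_measurable_compose)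
      (rule bounded_linear.isCont[OF bounded_bilinear.bounded_linear_left[OF bounded_bilinear_scaleC] continuous_ident])
  show "AE \<zeta> in \<mu>. norm (circle_power m \<zeta> *\<^sub>C x) \<le> norm x"
    using AE_circle_norm by eventually_elim (simp add: norm_scaleC norm_circle_power)
qed

lemma AE_rep_trig_monomial:
  "AE \<zeta> in \<mu>. rep_L2_circle (trig_monomial m x) \<zeta> = circle_power m \<zeta> *\<^sub>C x"
  unfolding trig_monomial_def by (rule AE_rep_abs[OF sq_integrable_trig_monomial])

lemma cinner_trig_monomial:
  "cinner g (trig_monomial m x) = (\<integral>\<zeta>. circle_power (- m) \<zeta> * cinner (rep_L2_circle g \<zeta>) x \<partial>\<mu>)"
  unfolding trig_monomial_def
  by (simp add: cinner_L2_abs[OF sq_integrable_trig_monomial] cinner_scaleC_right cnj_circle_power)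

lemma cinner_trig_monomials:
  "cinner (trig_monomial m x) (trig_monomial k y) = (if m = k then cinner x y else 0)"
proof -
  have "cinner (trig_monomial m x) (trig_monomial k y) =
      (\<integral>\<zeta>. cinner (circle_power m \<zeta> *\<^sub>C x) (circle_power k \<zeta> *\<^sub>C y) \<partial>\<mu>)"
    unfolding trig_monomial_def by (intro cinner_abs_L2 sq_integrable_trig_monomial)
  also have "\<dots> = (\<integral>\<zeta>. circle_power (m - k) \<zeta> * cinner x y \<partial>\<mu>)"
  proof (rule integral_cong_AE)
    show "AE \<zeta> in \<mu>. cinner (circle_power m \<zeta> *\<^sub>C x) (circle_power k \<zeta> *\<^sub>C y) =
        circle_power (m - k) \<zeta> * cinner x y"
      using AE_circle_norm
    proof eventually_elim
      case (elim \<zeta>)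
      then show ?case
        using circle_power_add[of \<zeta> m "- k"] by (simp add: cinner_simps cnj_circle_power)
    qed
  qed (auto intro!: measurable_circle_measure simp: cinner_simps cnj_circle_power)
  also have "\<dots> = (if m = k then cinner x y else 0)"
    by (simp add: integral_circle_power)
  finally show ?thesis .
qed

text \<open>The vanishing of Fourier coefficients becomes orthogonality to monomials, a condition
  that survives limits and unitary maps.\<close>

lemma hardy_space_iff:
  "g \<in> hardy_space E \<longleftrightarrow> (AE \<zeta> in \<mu>. rep_L2_circle g \<zeta> \<in> E) \<and>
    (\<forall>k\<ge>1. \<forall>x\<in>E. cinner g (trig_monomial (- int k) x) = 0)"
  by (simp add: hardy_space_def cinner_trig_monomial circle_power_of_nat)

lemma trig_monomial_in_hardy:
  assumes "complex_subspace E" "x \<in> E" "0 \<le> m"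
  shows "trig_monomial m x \<in> hardy_space E"
  unfolding hardy_space_iff
proof (intro conjI allI impI ballI)
  show "AE \<zeta> in \<mu>. rep_L2_circle (trig_monomial m x) \<zeta> \<in> E"
    using AE_rep_trig_monomial[of m x] by eventually_elim (simp add: complex_subspaceD[OF assms(1)] assms(2))
qed (use assms(3) in \<open>auto simp: cinner_trig_monomials\<close>)

text \<open>Limits stay E-valued by \<open>L2_circle_complete\<close>, and orthogonality to each
  monomial passes to the limit by continuity. Completeness makes the projection in
  \<open>toeplitz\<close> exist.\<close>

lemma hilbert_space_hardy:
  fixes E :: "'e::complex_inner set"
  assumes E: "hilbert_space E"
  shows "hilbert_space (hardy_space E)"
  unfolding hilbert_space_iff
proof
  have S: "complex_subspace E" "complete E" using E by (auto simp: hilbert_space_iff)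
  note D = complex_subspaceD[OF S(1)]
  show "complex_subspace (hardy_space E)"
    unfolding complex_subspace_def
  proof (intro conjI ballI allI)
    have "AE \<zeta> in \<mu>. rep_L2_circle 0 \<zeta> \<in> E"
      using AE_rep_zero[where 'a = 'e] by eventually_elim (simp add: D(1))
    then show "0 \<in> hardy_space E" by (simp add: hardy_space_iff)
  next
    fix f g assume *: "f \<in> hardy_space E" "g \<in> hardy_space E"
    then have "AE \<zeta> in \<mu>. rep_L2_circle f \<zeta> \<in> E" "AE \<zeta> in \<mu>. rep_L2_circle g \<zeta> \<in> E"
      by (auto simp: hardy_space_iff)
    with AE_rep_add[of f g] have "AE \<zeta> in \<mu>. rep_L2_circle (f + g) \<zeta> \<in> E"
      by eventually_elim (simp add: D(2))
    with * show "f + g \<in> hardy_space E" by (simp add: hardy_space_iff cinner_add_left)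
  next
    fix a f assume *: "f \<in> hardy_space E"
    then have "AE \<zeta> in \<mu>. rep_L2_circle f \<zeta> \<in> E"
      by (auto simp: hardy_space_iff)
    with AE_rep_scaleC[of a f] have "AE \<zeta> in \<mu>. rep_L2_circle (a *\<^sub>C f) \<zeta> \<in> E"
      by eventually_elim (simp add: D(3))
    with * show "a *\<^sub>C f \<in> hardy_space E" by (simp add: hardy_space_iff cinner_scaleC_left)
  qed
  show "complete (hardy_space E)"
    unfolding complete_def
  proof (intro allI impI)
    fix s assume s: "(\<forall>n. s n \<in> hardy_space E) \<and> Cauchy s"
    then obtain l where l: "AE \<zeta> in \<mu>. rep_L2_circle l \<zeta> \<in> E" "s \<longlonglongrightarrow> l"
      using L2_circle_complete[OF S(2), of s] by (auto simp: hardy_space_iff)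
    have "cinner l (trig_monomial (- int k) x) = 0" if "k \<ge> 1" "x \<in> E" for k x
    proof -
      have "(\<lambda>n. cinner (s n) (trig_monomial (- int k) x)) \<longlonglongrightarrow> cinner l (trig_monomial (- int k) x)"
        by (intro tendsto_cinner l tendsto_const)
      then show ?thesis
        using s that by (simp add: hardy_space_iff LIMSEQ_const_iff)
    qed
    with l show "\<exists>l\<in>hardy_space E. s \<longlonglongrightarrow> l"
      by (auto simp: hardy_space_iff)
  qed
qed

section \<open>The operators I tensor T on L2 and the lift of a unitary\<close>

definition L2_map :: "('e \<Rightarrow> 'f) \<Rightarrow> 'e::complex_inner L2_circle \<Rightarrow> 'f::complex_inner L2_circle" where
  "L2_map T g = abs_L2_circle (\<lambda>\<zeta>. T (rep_L2_circle g \<zeta>))"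

lemma AE_rep_L2_map:
  assumes "bounded_linear T"
  shows "AE \<zeta> in \<mu>. rep_L2_circle (L2_map T g) \<zeta> = T (rep_L2_circle g \<zeta>)"
  unfolding L2_map_def by (rule AE_rep_abs[OF sq_integrable_linear[OF sq_integrable_rep assms]])

lemma L2_map_abs:
  assumes "bounded_linear T" "sq_integrable f"
  shows "L2_map T (abs_L2_circle f) = abs_L2_circle (\<lambda>\<zeta>. T (f \<zeta>))"
  unfolding L2_map_def using AE_rep_abs[OF assms(2)]
  by (intro abs_L2_eqI sq_integrable_linear[OF sq_integrable_rep assms(1)]) (auto elim!: eventually_mono)

lemma L2_map_diff:
  assumes T: "bounded_linear T"
  shows "L2_map T (f - g) = L2_map T f - L2_map T g"
  by (rule L2_eqI)
    (use AE_rep_diff[of f g] AE_rep_diff[of "L2_map T f" "L2_map T g"] AE_rep_L2_map[OF T, of f]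
      AE_rep_L2_map[OF T, of g] AE_rep_L2_map[OF T, of "f - g"] in
      \<open>eventually_elim, simp add: linear_diff[OF bounded_linear.linear[OF T]]\<close>)

lemma L2_map_add:
  assumes T: "bounded_linear T"
  shows "L2_map T (f + g) = L2_map T f + L2_map T g"
  by (rule L2_eqI)
    (use AE_rep_add[of f g] AE_rep_add[of "L2_map T f" "L2_map T g"] AE_rep_L2_map[OF T, of f]
      AE_rep_L2_map[OF T, of g] AE_rep_L2_map[OF T, of "f + g"] in
      \<open>eventually_elim, simp add: linear_add[OF bounded_linear.linear[OF T]]\<close>)

text \<open>The unitary \<open>U\<close> is only defined on \<open>E\<close>; \<open>T\<close> and \<open>T'\<close> extend it and its inverse to bounded
  operators on the ambient types, so that composition with them preserves strong measurability.\<close>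

locale extended_unitary =
  fixes E :: "'e::complex_inner set" and E' :: "'f::complex_inner set" and U T T'
  assumes E: "hilbert_space E" and E': "hilbert_space E'" and U: "unitary_op E E' U"
    and T: "bounded_linear T" and T': "bounded_linear T'"
    and TU: "x \<in> E \<Longrightarrow> T x = U x" and T'U: "x \<in> E \<Longrightarrow> T' (U x) = x"
begin

lemma subspace: "complex_subspace E" and subspace': "complex_subspace E'"
  using E E' by (auto simp: hilbert_space_iff)

lemma adj_U: "x \<in> E \<Longrightarrow> adj E U (U x) = x" "y \<in> E' \<Longrightarrow> adj E U y \<in> E" "y \<in> E' \<Longrightarrow> U (adj E U y) = y"
  using unitary_op_adj[OF subspace U] by auto

lemmas U_simps = unitary_opD[OF U] clinear_onD[OF subspace unitary_opD(1)[OF U]]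

text \<open>The hypotheses are symmetric in U and its inverse; surjectivity of the lifted map comes
  from this symmetry.\<close>

lemma swap: "extended_unitary E' E (adj E U) T' T"
proof (rule extended_unitary.intro)
  fix y assume y: "y \<in> E'"
  show "T' y = adj E U y"
    using T'U[OF adj_U(2)[OF y]] adj_U(3)[OF y] by simp
  show "T (adj E U y) = y"
    using TU[OF adj_U(2)[OF y]] adj_U(3)[OF y] by simp
qed (rule E E' T T' unitary_op_adj_unitary[OF subspace U])+

lemma valued_L2_map:
  assumes "AE \<zeta> in \<mu>. rep_L2_circle g \<zeta> \<in> E"
  shows "AE \<zeta> in \<mu>. rep_L2_circle (L2_map T g) \<zeta> \<in> E'"
  using assms AE_rep_L2_map[OF T, of g] by eventually_elim (auto simp: TU U_simps)

lemma L2_map_inverse: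
  assumes "AE \<zeta> in \<mu>. rep_L2_circle g \<zeta> \<in> E"
  shows "L2_map T' (L2_map T g) = g"
  by (rule L2_eqI)
    (use assms AE_rep_L2_map[OF T, of g] AE_rep_L2_map[OF T', of "L2_map T g"] in
      \<open>eventually_elim, simp add: TU T'U\<close>)

lemma cinner_L2_map:
  assumes f: "AE \<zeta> in \<mu>. rep_L2_circle f \<zeta> \<in> E"
    and g: "AE \<zeta> in \<mu>. rep_L2_circle g \<zeta> \<in> E"
  shows "cinner (L2_map T f) (L2_map T g) = cinner f g"
  unfolding cinner_L2
proof (rule AE_cong_integral)
  show "AE \<zeta> in \<mu>. cinner (rep_L2_circle (L2_map T f) \<zeta>) (rep_L2_circle (L2_map T g) \<zeta>) =
      cinner (rep_L2_circle f \<zeta>) (rep_L2_circle g \<zeta>)"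
    using f g AE_rep_L2_map[OF T, of f] AE_rep_L2_map[OF T, of g]
    by eventually_elim (simp add: TU U_simps)
qed (intro integrable_cinner_sq_integrable sq_integrable_rep)+

lemma L2_map_trig_monomial:
  assumes "x \<in> E"
  shows "L2_map T (trig_monomial m x) = trig_monomial m (U x)"
proof -
  have "T (a *\<^sub>C x) = a *\<^sub>C U x" for a
    using assms by (simp add: TU complex_subspaceD(3)[OF subspace] U_simps)
  then show ?thesis
    unfolding trig_monomial_def by (simp add: L2_map_abs[OF T sq_integrable_trig_monomial])
qed

text \<open>A negative coefficient of the image tested against \<open>y\<close> is the coefficient
  of \<open>g\<close> tested against the preimage of \<open>y\<close> under U.\<close>

lemma L2_map_hardy:
  assumes g: "g \<in> hardy_space E"
  shows "L2_map T g \<in> hardy_space E'"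
  unfolding hardy_space_iff
proof (intro conjI allI impI ballI)
  have gE: "AE \<zeta> in \<mu>. rep_L2_circle g \<zeta> \<in> E"
    using g by (simp add: hardy_space_iff)
  then show "AE \<zeta> in \<mu>. rep_L2_circle (L2_map T g) \<zeta> \<in> E'"
    by (rule valued_L2_map)
  fix k :: nat and y assume k: "1 \<le> k" and y: "y \<in> E'"
  define x where "x = adj E U y"
  have x: "x \<in> E" "y = U x" using adj_U y by (auto simp: x_def)
  have "AE \<zeta> in \<mu>. rep_L2_circle (trig_monomial (- int k) x) \<zeta> \<in> E"
    using AE_rep_trig_monomial[of "- int k" x]
    by eventually_elim (simp add: complex_subspaceD(3)[OF subspace] x)
  then have "cinner (L2_map T g) (trig_monomial (- int k) y) = cinner g (trig_monomial (- int k) x)"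
    using x gE by (simp add: cinner_L2_map flip: L2_map_trig_monomial)
  also have "\<dots> = 0" using g k x by (simp add: hardy_space_iff)
  finally show "cinner (L2_map T g) (trig_monomial (- int k) y) = 0" .
qed

lemma hardy_valued: "g \<in> hardy_space E \<Longrightarrow> AE \<zeta> in \<mu>. rep_L2_circle g \<zeta> \<in> E"
  by (simp add: hardy_space_iff)

lemma L2_map_surj: "h \<in> hardy_space E' \<Longrightarrow> L2_map T' h \<in> hardy_space E \<and> L2_map T (L2_map T' h) = h"
  by (intro conjI extended_unitary.L2_map_hardy[OF swap] extended_unitary.L2_map_inverse[OF swap]
    extended_unitary.hardy_valued[OF swap])

lemma unitary_L2_map: "unitary_op (hardy_space E) (hardy_space E') (L2_map T)"
  unfolding unitary_op_def clinear_on_def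
proof (intro conjI ballI allI)
  show "L2_map T (f + g) = L2_map T f + L2_map T g" for f g
    by (rule L2_map_add[OF T])
  show "L2_map T (a *\<^sub>C f) = a *\<^sub>C L2_map T f" if f: "f \<in> hardy_space E" for a f
  proof (rule L2_eqI)
    show "AE \<zeta> in \<mu>. rep_L2_circle (L2_map T (a *\<^sub>C f)) \<zeta> = rep_L2_circle (a *\<^sub>C L2_map T f) \<zeta>"
      using hardy_valued[OF f] AE_rep_L2_map[OF T, of f] AE_rep_L2_map[OF T, of "a *\<^sub>C f"]
        AE_rep_scaleC[of a f] AE_rep_scaleC[of a "L2_map T f"]
      by eventually_elim (simp add: TU complex_subspaceD(3)[OF subspace] U_simps)
  qed
  show "L2_map T ` hardy_space E = hardy_space E'"
    using L2_map_hardy L2_map_surj by (force simp: image_iff)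
qed (simp add: cinner_L2_map hardy_valued)

text \<open>\<open>L2_map T\<close> preserves inner products between all E-valued functions and maps
  one Hardy space onto the other, so it carries the orthogonal decomposition of \<open>h\<close>
  along.\<close>

lemma orth_proj_L2_map:
  assumes h: "AE \<zeta> in \<mu>. rep_L2_circle h \<zeta> \<in> E"
  shows "orth_proj (hardy_space E') (L2_map T h) = L2_map T (orth_proj (hardy_space E) h)"
proof (rule orth_proj_eqI)
  note H = hilbert_space_hardy[OF E] and H' = hilbert_space_hardy[OF E']
  let ?p = "orth_proj (hardy_space E) h"
  have p: "?p \<in> hardy_space E" by (rule orth_proj_in[OF H])
  show "complex_subspace (hardy_space E')" using H' by (simp add: hilbert_space_iff)
  show "L2_map T ?p \<in> hardy_space E'" by (rule L2_map_hardy[OF p])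
  have hp: "AE \<zeta> in \<mu>. rep_L2_circle (h - ?p) \<zeta> \<in> E"
    using AE_rep_diff[of h ?p] h hardy_valued[OF p]
    by eventually_elim (simp add: complex_subspaceD[OF subspace])
  fix z assume z: "z \<in> hardy_space E'"
  have "cinner (L2_map T h - L2_map T ?p) z = cinner (L2_map T (h - ?p)) (L2_map T (L2_map T' z))"
    using L2_map_surj[OF z] by (simp add: L2_map_diff[OF T])
  also have "\<dots> = cinner (h - ?p) (L2_map T' z)"
    using L2_map_surj[OF z] by (intro cinner_L2_map hp hardy_valued) auto
  also have "\<dots> = 0"
    using L2_map_surj[OF z] by (intro orth_proj_orth[OF H]) auto
  finally show "cinner (L2_map T h - L2_map T ?p) z = 0" .
qed

text \<open>The symbols are compared only at unimodular \<zeta> and on E. Almost everywhere T takes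
  one product to the other and T' leads back, so the default branch of \<open>mult_op\<close> is
  taken on both sides or on neither.\<close>

lemma toeplitz_L2_map:
  assumes g: "g \<in> hardy_space E"
    and \<phi>: "\<And>\<zeta> x. norm \<zeta> = 1 \<Longrightarrow> x \<in> E \<Longrightarrow> \<phi> \<zeta> x \<in> E"
    and \<psi>: "\<And>\<zeta> x. norm \<zeta> = 1 \<Longrightarrow> x \<in> E \<Longrightarrow> \<psi> \<zeta> (U x) = U (\<phi> \<zeta> x)"
  shows "toeplitz E' \<psi> (L2_map T g) = L2_map T (toeplitz E \<phi> g)"
proof -
  let ?h = "\<lambda>\<zeta>. \<phi> \<zeta> (rep_L2_circle g \<zeta>)" and ?h' = "\<lambda>\<zeta>. \<psi> \<zeta> (rep_L2_circle (L2_map T g) \<zeta>)"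
  have hE: "AE \<zeta> in \<mu>. ?h \<zeta> \<in> E"
    using hardy_valued[OF g] AE_circle_norm by eventually_elim (simp add: \<phi>)
  have h1: "AE \<zeta> in \<mu>. T (?h \<zeta>) = ?h' \<zeta>"
    using hardy_valued[OF g] AE_circle_norm AE_rep_L2_map[OF T, of g]
    by eventually_elim (simp add: \<phi> \<psi> TU)
  have h2: "AE \<zeta> in \<mu>. T' (?h' \<zeta>) = ?h \<zeta>"
    using hE h1 by eventually_elim (metis TU T'U)
  have zero: "L2_map T 0 = 0"
    using L2_map_diff[OF T, of 0 0] by simp
  have "mult_op \<psi> (L2_map T g) = L2_map T (mult_op \<phi> g) \<and>
      (AE \<zeta> in \<mu>. rep_L2_circle (mult_op \<phi> g) \<zeta> \<in> E)"
  proof (cases "sq_integrable ?h")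
    case True
    then have 1: "sq_integrable (\<lambda>\<zeta>. T (?h \<zeta>))" by (rule sq_integrable_linear[OF _ T])
    then have "sq_integrable ?h'" by (rule sq_integrable_cong_AE[OF _ h1])
    moreover have absE: "AE \<zeta> in \<mu>. rep_L2_circle (abs_L2_circle ?h) \<zeta> \<in> E"
      using AE_rep_abs[OF True] hE by eventually_elim simp
    ultimately show ?thesis
      using True abs_L2_eqI[OF 1 h1] absE by (simp add: mult_op_def L2_map_abs[OF T])
  next
    case False
    have "\<not> sq_integrable ?h'"
      using False sq_integrable_cong_AE[OF sq_integrable_linear[OF _ T'] h2] by blast
    moreover have "AE \<zeta> in \<mu>. rep_L2_circle 0 \<zeta> \<in> E"
      using AE_rep_zero[where 'a = 'e] by eventually_elim (simp add: complex_subspaceD[OF subspace])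
    ultimately show ?thesis
      using False by (simp add: mult_op_def zero)
  qed
  then show ?thesis
    by (simp add: toeplitz_def orth_proj_L2_map)
qed

text \<open>The bounded extensions T and T' carry radial limits in both directions. A limit
  therefore exists at \<open>x\<close> exactly when it exists at \<open>U x\<close>, and the default
  value 0 is respected by U.\<close>

lemma boundary_value_intertwine:
  assumes \<zeta>: "norm \<zeta> = 1" and x: "x \<in> E"
    and F: "\<And>z. z \<in> ball 0 1 \<Longrightarrow> F z x \<in> E" and G: "\<And>z. z \<in> ball 0 1 \<Longrightarrow> G z (U x) = U (F z x)"
  shows "boundary_value F \<zeta> x \<in> E \<and> boundary_value G \<zeta> (U x) = U (boundary_value F \<zeta> x)"
proof -
  have ball: "\<forall>\<^sub>F r in at_left 1. complex_of_real r * \<zeta> \<in> ball 0 1"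
    using eventually_at_left_real[of 0 "1::real"]
    by (simp, elim eventually_mono) (auto simp: norm_mult \<zeta>)
  have FE: "\<forall>\<^sub>F r in at_left 1. F (complex_of_real r * \<zeta>) x \<in> E"
    using ball by eventually_elim (rule F)
  have GT: "\<forall>\<^sub>F r in at_left 1. T (F (complex_of_real r * \<zeta>) x) = G (complex_of_real r * \<zeta>) (U x)"
    using ball by eventually_elim (simp add: F G TU)
  have FT: "\<forall>\<^sub>F r in at_left 1. T' (G (complex_of_real r * \<zeta>) (U x)) = F (complex_of_real r * \<zeta>) x"
    using ball by eventually_elim (simp add: F G T'U)
  show ?thesis
  proof (cases "\<exists>l. ((\<lambda>r. F (complex_of_real r * \<zeta>) x) \<longlongrightarrow> l) (at_left 1)")
    case True
    then obtain l where l: "((\<lambda>r. F (complex_of_real r * \<zeta>) x) \<longlongrightarrow> l) (at_left 1)" by blast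
    have "closed E" using E by (simp add: hilbert_space_def complete_imp_closed)
    then have lE: "l \<in> E"
      by (rule Lim_in_closed_set[OF _ FE _ l]) simp
    have l': "((\<lambda>r. G (complex_of_real r * \<zeta>) (U x)) \<longlongrightarrow> U l) (at_left 1)"
      using Lim_transform_eventually[OF bounded_linear.tendsto[OF T l] GT] TU[OF lE] by simp
    have "boundary_value F \<zeta> x = l"
      using l by (auto simp: boundary_value_def intro!: tendsto_Lim)
    moreover have "boundary_value G \<zeta> (U x) = U l"
      using l' by (auto simp: boundary_value_def intro!: tendsto_Lim)
    ultimately show ?thesis using lE by simp
  next
    case False
    have "\<not> (\<exists>l. ((\<lambda>r. G (complex_of_real r * \<zeta>) (U x)) \<longlongrightarrow> l) (at_left 1))"
    proof
      assume "\<exists>l. ((\<lambda>r. G (complex_of_real r * \<zeta>) (U x)) \<longlongrightarrow> l) (at_left 1)"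
      then obtain l where "((\<lambda>r. G (complex_of_real r * \<zeta>) (U x)) \<longlongrightarrow> l) (at_left 1)" by blast
      from Lim_transform_eventually[OF bounded_linear.tendsto[OF T' this] FT] False show False by blast
    qed
    with False show ?thesis
      by (simp add: boundary_value_def complex_subspaceD[OF subspace] U_simps)
  qed
qed

lemma adj_intertwine:
  assumes "bounded_op E A" "x \<in> E"
  shows "adj E' (\<lambda>y. U (A (adj E U y))) (U x) = U (adj E A x)"
proof (rule adj_eqI[OF subspace'])
  note a = bounded_adj_in[OF E assms(1)] bounded_cinner_adj[OF E assms(1)]
  show "U (adj E A x) \<in> E'" by (intro U_simps a)
  fix y assume "y \<in> E'"
  then have y: "adj E U y \<in> E" "y = U (adj E U y)" by (simp_all add: adj_U)
  then have "A (adj E U y) \<in> E" using assms(1) by (auto simp: bounded_op_def)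
  then have "cinner (U (A (adj E U y))) (U x) = cinner (adj E U y) (adj E A x)"
    using y(1) assms(2) by (simp add: U_simps a)
  also have "\<dots> = cinner y (U (adj E A x))"
    by (metis U_simps(3) a(1) y)
  finally show "cinner (U (A (adj E U y))) (U x) = cinner y (U (adj E A x))" .
qed

end

text \<open>U and its inverse are extended by composing them with the orthogonal projections onto E
  and E', which are bounded on the ambient types because E and E' are complete.\<close>

lemma extended_unitary_exists:
  fixes E :: "'e::complex_inner set" and E' :: "'f::complex_inner set"
  assumes E: "hilbert_space E" and E': "hilbert_space E'" and U: "unitary_op E E' U"
  shows "\<exists>T T'. extended_unitary E E' U T T'"
proof -
  have ext: "bounded_linear (\<lambda>x. V (orth_proj F x))"
    if F: "hilbert_space F" and V: "unitary_op F F' V"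
    for F :: "'x::complex_inner set" and F' :: "'y::complex_inner set" and V
  proof -
    have S: "complex_subspace F" using F by (simp add: hilbert_space_iff)
    note V' = unitary_opD[OF V] clinear_onD[OF S unitary_opD(1)[OF V]]
    note P = bounded_linear_orth_proj(1)[OF F] and p = orth_proj_in[OF F]
    obtain K where K: "\<And>x. norm (orth_proj F x) \<le> norm x * K"
      using bounded_linear.bounded[OF P] by blast
    show ?thesis
      by (rule bounded_linear_intro[where K = K])
        (auto simp: linear_simps[OF P] V' p K scaleR_eq_scaleC orth_proj_scaleC[OF F])
  qed
  have S: "complex_subspace E" using E by (simp add: hilbert_space_iff)
  have S': "complex_subspace E'" using E' by (simp add: hilbert_space_iff)
  have "extended_unitary E E' U (\<lambda>x. U (orth_proj E x)) (\<lambda>y. adj E U (orth_proj E' y))"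
    by (rule extended_unitary.intro)
      (auto simp: E E' U orth_proj_id[OF S] orth_proj_id[OF S'] unitary_opD[OF U] unitary_op_adj[OF S U]
        intro!: ext[OF E U] ext[OF E' unitary_op_adj_unitary[OF S U]])
  then show ?thesis by blast
qed

lemma canonical_ay_unitarily_equiv:
  fixes E :: "'e::complex_inner set" and E' :: "'f::complex_inner set"
  assumes E: "hilbert_space E" and E': "hilbert_space E'"
    and f: "\<And>i. i \<in> {1..n-1} \<Longrightarrow> f i \<in> H_infinity E"
    and eq: "functions_unitarily_equiv n E f E' g"
  shows "tuple_unitarily_equiv n (hardy_space E) (canonical_ay n E f) (hardy_space E') (canonical_ay n E' g)"
proof -
  obtain U where U: "unitary_op E E' U"
    and g: "\<And>i z y. i \<in> {1..n-1} \<Longrightarrow> z \<in> ball 0 1 \<Longrightarrow> y \<in> E' \<Longrightarrow> g i z y = U (f i z (adj E U y))"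
    using eq unfolding functions_unitarily_equiv_def by blast
  obtain T T' where "extended_unitary E E' U T T'"
    using extended_unitary_exists[OF E E' U] by blast
  then interpret extended_unitary E E' U T T' .
  have bop: "bounded_op E (f i z)" if "i \<in> {1..n-1}" "z \<in> ball 0 1" for i z
    using f[OF that(1)] that(2) by (auto simp: H_infinity_def)
  have bv1: "boundary_value (f i) \<zeta> x \<in> E \<and> boundary_value (g i) \<zeta> (U x) = U (boundary_value (f i) \<zeta> x)"
    if "i \<in> {1..n-1}" "norm \<zeta> = 1" "x \<in> E" for i \<zeta> x
    using bop[OF that(1)] that
    by (intro boundary_value_intertwine) (auto simp: bounded_op_def g adj_U U_simps)
  have bv2: "boundary_value (\<lambda>z. adj E (f i z)) \<zeta> x \<in> E \<and>
      boundary_value (\<lambda>z. adj E' (g i z)) \<zeta> (U x) = U (boundary_value (\<lambda>z. adj E (f i z)) \<zeta> x)"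
    if i: "i \<in> {1..n-1}" and "norm \<zeta> = 1" and x: "x \<in> E" for i \<zeta> x
  proof (rule boundary_value_intertwine)
    fix z :: complex assume z: "z \<in> ball 0 1"
    show "adj E (f i z) x \<in> E" by (rule bounded_adj_in[OF E bop[OF i z]])
    \<comment> \<open>\<open>g i z\<close> is given by the conjugation formula only on E', but its
      adjoint depends on no other values.\<close>
    have "adj E' (g i z) (U x) = adj E' (\<lambda>y. U (f i z (adj E U y))) (U x)"
      by (rule adj_cong) (rule g[OF i z])
    then show "adj E' (g i z) (U x) = U (adj E (f i z) x)"
      using adj_intertwine[OF bop[OF i z] x] by simp
  qed (use that in auto)
  show ?thesis
  proof (rule tuple_unitarily_equivI[OF _ unitary_L2_map])
    show "complex_subspace (hardy_space E)"
      using hilbert_space_hardy[OF E] by (simp add: hilbert_space_iff)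
    fix i h assume i: "i \<in> {1..n}" and h: "h \<in> hardy_space E"
    show "canonical_ay n E' g i (L2_map T h) = L2_map T (canonical_ay n E f i h)"
    proof (cases "i = n")
      case True
      then show ?thesis
        by (simp add: canonical_ay_def toeplitz_L2_map[OF h] complex_subspaceD(3)[OF subspace] U_simps)
    next
      case False
      then have i: "i \<in> {1..n-1}" "n - i \<in> {1..n-1}" using i by auto
      have "ay_symbol n E f i \<zeta> x \<in> E \<and> ay_symbol n E' g i \<zeta> (U x) = U (ay_symbol n E f i \<zeta> x)"
        if "norm \<zeta> = 1" "x \<in> E" for \<zeta> x
        using bv1[OF i(1) that] bv2[OF i(2) that]
        by (auto simp: ay_symbol_def U_simps complex_subspaceD[OF subspace])
      then show ?thesis
        using False by (simp add: canonical_ay_def toeplitz_L2_map[OF h])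
    qed
  qed
qed

section \<open>Lebesgue points and monotone kernels\<close>

lemma set_integrable_bounded_scaleR:
  fixes v :: "real \<Rightarrow> 'b::{banach, second_countable_topology}"
  assumes v: "set_integrable lborel S v" and c: "c \<in> borel_measurable borel"
    and S: "S \<in> sets borel" and bound: "\<And>s. s \<in> S \<Longrightarrow> \<bar>c s\<bar> \<le> C"
  shows "set_integrable lborel S (\<lambda>s. c s *\<^sub>R v s)"
proof -
  have "integrable lborel (\<lambda>s. C *\<^sub>R (indicator S s *\<^sub>R v s))"
    using v unfolding set_integrable_def by (rule integrable_scaleR_right)
  then have "integrable lborel (\<lambda>s. c s *\<^sub>R (indicator S s *\<^sub>R v s))"
  proof (rule Bochner_Integration.integrable_bound)
    show "(\<lambda>s. c s *\<^sub>R (indicator S s *\<^sub>R v s)) \<in> borel_measurable lborel"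
      using c by (intro borel_measurable_scaleR[OF _ borel_measurable_integrable[OF v[unfolded set_integrable_def]]]) simp
    show "AE s in lborel. norm (c s *\<^sub>R (indicator S s *\<^sub>R v s)) \<le> norm (C *\<^sub>R (indicator S s *\<^sub>R v s))"
      using bound by (intro AE_I2) (force simp: indicator_def intro: mult_right_mono)
  qed
  then show ?thesis
    by (simp add: set_integrable_def mult.commute)
qed

text \<open>Compactness gives the largest point of the superlevel set, and monotonicity fills the
  interval to its left. These intervals are the layers of the following estimate.\<close>

lemma antimono_superlevel_interval:
  fixes p :: "real \<Rightarrow> real"
  assumes p: "continuous_on UNIV p" and anti: "\<And>s s'. 0 \<le> s \<Longrightarrow> s \<le> s' \<Longrightarrow> s' \<le> \<delta> \<Longrightarrow> p s' \<le> p s"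
  shows "{s\<in>{0..\<delta>}. c \<le> p s} = {} \<or> (\<exists>\<sigma>\<in>{0..\<delta>}. {s\<in>{0..\<delta>}. c \<le> p s} = {0..\<sigma>})"
proof (cases "{s\<in>{0..\<delta>}. c \<le> p s} = {}")
  case False
  have "{s\<in>{0..\<delta>}. c \<le> p s} = {0..\<delta>} \<inter> {s. c \<le> p s}" by auto
  also have "compact \<dots>"
    by (intro compact_Int_closed compact_Icc closed_Collect_le p continuous_on_const)
  finally obtain \<sigma> where "\<sigma> \<in> {s\<in>{0..\<delta>}. c \<le> p s}" "\<forall>s\<in>{s\<in>{0..\<delta>}. c \<le> p s}. s \<le> \<sigma>"
    using compact_attains_sup[OF _ False] by blast
  then have "\<sigma> \<in> {0..\<delta>}" "{s\<in>{0..\<delta>}. c \<le> p s} = {0..\<sigma>}"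
    using anti by (auto, force intro: order_trans[OF _ anti])
  then show ?thesis by blast
qed auto

text \<open>A layer-cake argument: \<open>p\<close> is uniformly approximated by positive combinations of
  indicators of intervals \<open>{0..\<sigma>}\<close>.\<close>

lemma integral_antimono_weight_le:
  fixes p :: "real \<Rightarrow> real" and v :: "real \<Rightarrow> complex"
  assumes p: "continuous_on UNIV p" and p0: "\<And>s. 0 \<le> p s"
    and anti: "\<And>s s'. 0 \<le> s \<Longrightarrow> s \<le> s' \<Longrightarrow> s' \<le> \<delta> \<Longrightarrow> p s' \<le> p s"
    and v: "set_integrable lborel {0..\<delta>} v" and "0 \<le> \<delta>"
    and V: "\<And>\<sigma>. \<sigma> \<in> {0..\<delta>} \<Longrightarrow> norm (LINT s:{0..\<sigma>}|lborel. v s) \<le> \<epsilon> * \<sigma>"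
  shows "norm (LINT s:{0..\<delta>}|lborel. p s *\<^sub>R v s) \<le> \<epsilon> * (LINT s:{0..\<delta>}|lborel. p s)"
proof -
  let ?S = "{0..\<delta>}"
  have pm [measurable]: "p \<in> borel_measurable borel"
    by (rule borel_measurable_continuous_onI[OF p])
  have ple: "p s \<le> p 0" if "s \<in> ?S" for s using anti[of 0 s] that by auto
  have one: "set_integrable lborel ?S (\<lambda>s. 1::real)"
    by (intro borel_integrable_atLeastAtMost' continuous_intros)
  have ip: "set_integrable lborel ?S p"
    by (intro borel_integrable_atLeastAtMost') (rule continuous_on_subset[OF p], simp)
  have "0 \<le> norm (LINT s:{0..\<delta>}|lborel. v s)" by simp
  also have "\<dots> \<le> \<epsilon> * \<delta>" using \<open>0 \<le> \<delta>\<close> by (intro V) auto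
  finally have ed: "0 \<le> \<epsilon> * \<delta>" .
  \<comment> \<open>For \<delta> = 0 the hypotheses do not determine the sign of \<epsilon>; that
    case is treated apart below.\<close>
  have \<epsilon>: "0 \<le> \<epsilon> \<or> \<delta> = 0" using ed \<open>0 \<le> \<delta>\<close> by (auto simp: zero_le_mult_iff)
  define J where "J = (LINT s:?S|lborel. norm (v s))"
  have J: "set_integrable lborel ?S (\<lambda>s. norm (v s))"
    using v by (rule set_integrable_norm)
  have main: "norm (LINT s:?S|lborel. p s *\<^sub>R v s) \<le> \<epsilon> * (LINT s:?S|lborel. p s) + J / real n" if n: "n > 0" for n :: nat
  proof -
    \<comment> \<open>\<open>q\<close> is \<open>p\<close> rounded down to a multiple of 1/n: the
      number of levels j/n not exceeding \<open>p s\<close> is the floor of \<open>n * p s\<close>,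
      and M levels are enough because \<open>p s\<close> is at most \<open>p 0\<close> on the
      interval.\<close>
    define M where "M = nat \<lceil>real n * p 0\<rceil>"
    define k where "k j s = (if real j / real n \<le> p s then 1 else 0 :: real)" for j :: nat and s
    define q where "q s = (\<Sum>j=1..M. k j s) / real n" for s
    have km [measurable]: "k j \<in> borel_measurable borel" for j
      unfolding k_def by measurable
    have qm [measurable]: "q \<in> borel_measurable borel"
      unfolding q_def by measurable
    have k1: "\<bar>k j s\<bar> \<le> 1" for j s by (simp add: k_def)
    have q: "q s \<le> p s \<and> p s \<le> q s + 1 / real n" if s: "s \<in> ?S" for s
    proof -
      have "(\<Sum>j=1..M. k j s) = real (card {j\<in>{1..M}. real j / real n \<le> p s})"
        by (simp add: k_def sum.If_cases Int_def)
      also have "{j\<in>{1..M}. real j / real n \<le> p s} = {1..nat \<lfloor>real n * p s\<rfloor>}"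
      proof -
        have E: "real j / real n \<le> p s \<longleftrightarrow> j \<le> nat \<lfloor>real n * p s\<rfloor>" for j
          using n p0[of s] by (simp add: le_nat_iff le_floor_iff divide_le_eq mult.commute)
        moreover have "nat \<lfloor>real n * p s\<rfloor> \<le> M"
        proof -
          have "real n * p s \<le> real n * p 0" using ple[OF s] by (simp add: mult_left_mono)
          then show ?thesis unfolding M_def by linarith
        qed
        ultimately show ?thesis
          by (simp only: set_eq_iff mem_Collect_eq atLeastAtMost_iff E) (metis order_trans)
      qed
      finally have *: "real n * q s = real_of_int \<lfloor>real n * p s\<rfloor>"
        using n p0[of s] by (simp add: q_def)
      have "real n * q s \<le> real n * p s" "real n * p s \<le> real n * q s + 1"
        unfolding * by linarith+
      then show ?thesis using n by (simp add: field_simps)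
    qed
    have q0: "0 \<le> q s" for s unfolding q_def k_def by (simp add: sum_nonneg)
    have kv: "set_integrable lborel ?S (\<lambda>s. k j s *\<^sub>R v s)" "set_integrable lborel ?S (k j)" for j
      using set_integrable_bounded_scaleR[OF v km _ k1, of j] set_integrable_bounded_scaleR[OF one km _ k1, of j] by auto
    have qv: "set_integrable lborel ?S (\<lambda>s. q s *\<^sub>R v s)" "set_integrable lborel ?S q"
      using set_integrable_bounded_scaleR[OF v qm, of "p 0"] set_integrable_bounded_scaleR[OF one qm, of "p 0"] q ple q0
      by (auto intro: order_trans)
    have pv: "set_integrable lborel ?S (\<lambda>s. p s *\<^sub>R v s)"
      using set_integrable_bounded_scaleR[OF v pm, of "p 0"] ple p0 by auto
    have kj: "norm (LINT s:?S|lborel. k j s *\<^sub>R v s) \<le> \<epsilon> * (LINT s:?S|lborel. k j s)" for j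
    proof -
      have eq: "(LINT s:?S|lborel. k j s *\<^sub>R v s) = (LINT s:{s\<in>?S. real j / real n \<le> p s}|lborel. v s)"
        "(LINT s:?S|lborel. k j s) = (LINT s:{s\<in>?S. real j / real n \<le> p s}|lborel. 1)"
        unfolding set_lebesgue_integral_def
        by (auto simp: k_def indicator_def intro!: Bochner_Integration.integral_cong)
      from antimono_superlevel_interval[OF p anti, of \<delta> "real j / real n"] show ?thesis
      proof
        assume "{s\<in>?S. real j / real n \<le> p s} = {}"
        then show ?thesis
          unfolding eq by (simp add: set_lebesgue_integral_def)
      next
        assume "\<exists>\<sigma>\<in>?S. {s\<in>?S. real j / real n \<le> p s} = {0..\<sigma>}"
        then obtain \<sigma> where \<sigma>: "\<sigma> \<in> ?S" "{s\<in>?S. real j / real n \<le> p s} = {0..\<sigma>}" by blast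
        have "(LINT s:?S|lborel. k j s *\<^sub>R v s) = (LINT s:{0..\<sigma>}|lborel. v s)"
          unfolding eq \<sigma>(2) ..
        moreover have "(LINT s:?S|lborel. k j s) = \<sigma>"
          unfolding eq \<sigma>(2) using \<sigma>(1) by (simp add: set_lebesgue_integral_def)
        ultimately show ?thesis using V[OF \<sigma>(1)] by simp
      qed
    qed
    have "(LINT s:?S|lborel. q s *\<^sub>R v s) = (LINT s:?S|lborel. (\<Sum>j=1..M. (1 / real n) *\<^sub>R (k j s *\<^sub>R v s)))"
      by (simp add: q_def sum_divide_distrib scaleR_sum_left)
    also have "\<dots> = (\<Sum>j=1..M. (1 / real n) *\<^sub>R (LINT s:?S|lborel. k j s *\<^sub>R v s))"
      using kv(1) unfolding set_lebesgue_integral_def set_integrable_def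
      by (simp add: scaleR_sum_right scaleR_left_commute[of "indicator _ _" "1 / real n"] Bochner_Integration.integral_sum del: scaleR_scaleR)
    finally have "norm (LINT s:?S|lborel. q s *\<^sub>R v s) \<le> (\<Sum>j=1..M. (1 / real n) * norm (LINT s:?S|lborel. k j s *\<^sub>R v s))"
      by (auto intro: norm_sum[THEN order_trans])
    also have "\<dots> \<le> (\<Sum>j=1..M. (1 / real n) * (\<epsilon> * (LINT s:?S|lborel. k j s)))"
      by (intro sum_mono mult_left_mono kj) auto
    also have "\<dots> = \<epsilon> * (\<Sum>j=1..M. (1 / real n) * (LINT s:?S|lborel. k j s))"
      by (simp add: sum_distrib_left mult_ac)
    also have "(\<Sum>j=1..M. (1 / real n) * (LINT s:?S|lborel. k j s)) = (LINT s:?S|lborel. q s)"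
      using kv(2) unfolding set_lebesgue_integral_def set_integrable_def q_def
      by (simp add: sum_divide_distrib sum_distrib_left Bochner_Integration.integral_sum)
    also have "\<epsilon> * (LINT s:?S|lborel. q s) \<le> \<epsilon> * (LINT s:?S|lborel. p s)"
    proof (cases "\<delta> = 0")
      case True
      then have "(LINT s:?S|lborel. q s) = 0" "(LINT s:?S|lborel. p s) = 0"
        using set_borel_integral_eq_integral(2)[OF qv(2)] set_borel_integral_eq_integral(2)[OF ip] by auto
      then show ?thesis by simp
    next
      case False
      then show ?thesis using \<epsilon> q by (intro mult_left_mono set_integral_mono qv ip) auto
    qed
    finally have 1: "norm (LINT s:?S|lborel. q s *\<^sub>R v s) \<le> \<epsilon> * (LINT s:?S|lborel. p s)" .
    \<comment> \<open>Rounding costs at most 1/n times the L1 norm J of \<open>v\<close>.\<close>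
    have "norm ((LINT s:?S|lborel. p s *\<^sub>R v s) - (LINT s:?S|lborel. q s *\<^sub>R v s))
        = norm (LINT s:?S|lborel. p s *\<^sub>R v s - q s *\<^sub>R v s)"
      using pv qv by simp
    also have "\<dots> \<le> (LINT s:?S|lborel. norm (p s *\<^sub>R v s - q s *\<^sub>R v s))"
      unfolding set_lebesgue_integral_def
      using integral_norm_bound[of lborel "\<lambda>s. indicator ?S s *\<^sub>R (p s *\<^sub>R v s - q s *\<^sub>R v s)"] by simp
    also have "\<dots> \<le> (LINT s:?S|lborel. (1 / real n) * norm (v s))"
    proof (rule set_integral_mono)
      show "set_integrable lborel ?S (\<lambda>s. norm (p s *\<^sub>R v s - q s *\<^sub>R v s))"
        using pv qv by (intro set_integrable_norm set_integral_diff(1))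
      show "set_integrable lborel ?S (\<lambda>s. 1 / real n * norm (v s))"
        using J by simp
      show "norm (p s *\<^sub>R v s - q s *\<^sub>R v s) \<le> 1 / real n * norm (v s)" if "s \<in> ?S" for s
        unfolding scaleR_diff_left[symmetric] norm_scaleR
        using q[OF that] by (intro mult_right_mono) auto
    qed
    also have "\<dots> = J / real n" by (simp add: J_def)
    finally have 2: "norm ((LINT s:?S|lborel. p s *\<^sub>R v s) - (LINT s:?S|lborel. q s *\<^sub>R v s)) \<le> J / real n" .
    show ?thesis
      using 1 2 norm_triangle_sub[of "(LINT s:?S|lborel. p s *\<^sub>R v s)" "(LINT s:?S|lborel. q s *\<^sub>R v s)"] by linarith
  qed
  have "(\<lambda>n. \<epsilon> * (LINT s:?S|lborel. p s) + J / real n) \<longlonglongrightarrow> \<epsilon> * (LINT s:?S|lborel. p s) + 0"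
    by (intro tendsto_add tendsto_const lim_const_over_n)
  then have "norm (LINT s:?S|lborel. p s *\<^sub>R v s) \<le> \<epsilon> * (LINT s:?S|lborel. p s) + 0"
    by (rule LIMSEQ_le_const) (use main in \<open>auto intro!: exI[of _ 1]\<close>)
  then show ?thesis by simp
qed

text \<open>Lebesgue differentiation on intervals to the right of \<open>t\<close>. The norm stands
  outside the integral; this weaker form is enough because the weight to be used is decreasing, so
  only integrals over initial intervals matter.\<close>

lemma Lebesgue_point_AE:
  fixes U :: "real \<Rightarrow> complex"
  assumes U: "integrable lborel U"
  shows "AE t in lborel. \<forall>e>0. \<exists>d>0. \<forall>h. 0 \<le> h \<and> h < d \<longrightarrow>
    norm (LINT x:{t..t+h}|lborel. U x - U t) \<le> e * h"
proof -
  have Ui: "set_integrable lborel {a..b} U" for a b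
    using U unfolding set_integrable_def by (intro integrable_mult_indicator) auto
  have "U integrable_on cbox a b" for a b
    using set_borel_integral_eq_integral(1)[OF Ui] by simp
  then obtain N where N: "negligible N"
    "\<And>x e. \<lbrakk>x \<notin> N; 0 < e\<rbrakk> \<Longrightarrow> \<exists>d>0. \<forall>h. 0 < h \<and> h < d \<longrightarrow>
        norm (integral (cbox x (x + h *\<^sub>R One)) U /\<^sub>R h ^ DIM(real) - U x) < e"
    using integrable_ccontinuous_explicit[of U] by metis
  have "AE t in lebesgue. t \<notin> N"
    using N(1) by (intro AE_not_in) (simp add: negligible_iff_null_sets)
  then have "AE t in lborel. t \<notin> N" by (simp add: AE_completion_iff)
  then show ?thesis
  proof eventually_elim
    case (elim t)
    show ?case
    proof (intro allI impI)
      fix e :: real assume "e > 0"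
      from N(2)[OF elim this] obtain d where d: "d > 0"
        "\<And>h. 0 < h \<Longrightarrow> h < d \<Longrightarrow> norm (integral {t..t+h} U /\<^sub>R h - U t) < e" by auto
      have "norm (LINT x:{t..t+h}|lborel. U x - U t) \<le> e * h" if h: "0 \<le> h" "h < d" for h
      proof (cases "h = 0")
        case True
        have "set_integrable lborel {t..t+h} (\<lambda>x. U x - U t)"
          by (intro set_integral_diff(1) Ui borel_integrable_atLeastAtMost' continuous_intros)
        then show ?thesis using set_borel_integral_eq_integral(2) True by fastforce
      next
        case False
        have c: "set_integrable lborel {t..t+h} (\<lambda>x. U t)"
          by (intro borel_integrable_atLeastAtMost' continuous_intros)
        have "(LINT x:{t..t+h}|lborel. U x - U t) = integral {t..t+h} U - h *\<^sub>R U t"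
          using h by (simp add: set_integral_diff(2)[OF Ui c] set_borel_integral_eq_integral(2)[OF Ui]
            set_borel_integral_eq_integral(2)[OF c])
        also have "\<dots> = h *\<^sub>R (integral {t..t+h} U /\<^sub>R h - U t)"
          using False by (simp add: scaleR_diff_right)
        also have "norm \<dots> \<le> h * e"
          using d(2)[of h] False h by (simp add: mult_left_mono)
        finally show ?thesis by (simp add: mult.commute)
      qed
      with d(1) show "\<exists>d>0. \<forall>h. 0 \<le> h \<and> h < d \<longrightarrow> norm (LINT x:{t..t+h}|lborel. U x - U t) \<le> e * h" by blast
    qed
  qed
qed

lemma set_integral_shift:
  fixes f :: "real \<Rightarrow> 'b::euclidean_space"
  shows "(LINT x:{t..t+h}|lborel. f x) = (LINT s:{0..h}|lborel. f (t + s))"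
  unfolding set_lebesgue_integral_def
  by (subst lborel_integral_real_affine[where c = 1 and t = t]) (auto intro!: Bochner_Integration.integral_cong simp: indicator_def)

lemma set_integral_reflect:
  fixes f :: "real \<Rightarrow> 'b::euclidean_space"
  shows "(LINT x:{t-h..t}|lborel. f x) = (LINT s:{0..h}|lborel. f (t - s))"
  unfolding set_lebesgue_integral_def
  by (subst lborel_integral_real_affine[where c = "-1" and t = t]) (auto intro!: Bochner_Integration.integral_cong simp: indicator_def)

text \<open>Obtained from the right-hand version for the reflected function
  \<open>U (- x)\<close>.\<close>

lemma Lebesgue_point_left_AE:
  fixes U :: "real \<Rightarrow> complex"
  assumes U: "integrable lborel U"
  shows "AE t in lborel. \<forall>e>0. \<exists>d>0. \<forall>h. 0 \<le> h \<and> h < d \<longrightarrow>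
    norm (LINT x:{t-h..t}|lborel. U x - U t) \<le> e * h"
proof -
  have "integrable lborel (\<lambda>x. U (0 + (-1) * x))"
    using U by (subst lborel_integrable_real_affine_iff) auto
  then have "AE t in lborel. \<forall>e>0. \<exists>d>0. \<forall>h. 0 \<le> h \<and> h < d \<longrightarrow>
      norm (LINT x:{t..t+h}|lborel. U (- x) - U (- t)) \<le> e * h"
    using Lebesgue_point_AE[of "\<lambda>x. U (- x)"] by simp
  then obtain N where N: "N \<in> null_sets lborel"
    "\<And>t. t \<notin> N \<Longrightarrow> \<forall>e>0. \<exists>d>0. \<forall>h. 0 \<le> h \<and> h < d \<longrightarrow>
      norm (LINT x:{t..t+h}|lborel. U (- x) - U (- t)) \<le> e * h"
    by (rule AE_E3) auto
  \<comment> \<open>Reflection preserves Lebesgue measure, so the reflected exceptional set is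
    null.\<close>
  have "AE t in lborel. - t \<notin> N"
  proof -
    have "AE t in distr lborel borel uminus. t \<notin> N"
      unfolding lborel_distr_uminus by (rule AE_not_in[OF N(1)])
    then show ?thesis
      using N(1) by (subst (asm) AE_distr_iff) (auto simp: null_sets_def)
  qed
  then show ?thesis
  proof eventually_elim
    case (elim t)
    have "(LINT x:{-t..-t+h}|lborel. U (- x) - U t) = (LINT x:{t-h..t}|lborel. U x - U t)" for h
      by (simp only: set_integral_shift set_integral_reflect) simp
    moreover have "\<forall>e>0. \<exists>d>0. \<forall>h. 0 \<le> h \<and> h < d \<longrightarrow>
      norm (LINT x:{-t..-t+h}|lborel. U (- x) - U (- (- t))) \<le> e * h"
      by (rule N(2)[OF elim])
    ultimately show ?case by simp
  qed
qed

text \<open>Written through \<open>cos t\<close>, so that evenness and monotonicity on [0, pi] are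
  immediate. The integral over a period is 2 pi, the factor 1/(2 pi) being part of \<mu>.\<close>

definition poisson_kernel :: "real \<Rightarrow> real \<Rightarrow> real" where
  "poisson_kernel r t = (1 - r\<^sup>2) / (1 - 2 * r * cos t + r\<^sup>2)"

section \<open>Positivity, monotonicity and decay of the Poisson kernel\<close>

lemma poisson_denominator:
  fixes r t :: real
  assumes "0 \<le> r" "r < 1"
  shows "0 < 1 - 2 * r * cos t + r\<^sup>2"
proof -
  have "r * cos t \<le> r * 1" using assms by (intro mult_left_mono) auto
  moreover have "0 < (1 - r)\<^sup>2" using assms by simp
  ultimately show ?thesis by (simp add: power2_diff)
qed

lemma poisson_kernel_nonneg: "0 \<le> r \<Longrightarrow> r < 1 \<Longrightarrow> 0 \<le> poisson_kernel r t"
  unfolding poisson_kernel_def using poisson_denominator[of r t]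
  by (intro divide_nonneg_pos) (auto simp: power_le_one)

lemma continuous_on_poisson_kernel: "0 \<le> r \<Longrightarrow> r < 1 \<Longrightarrow> continuous_on UNIV (poisson_kernel r)"
  unfolding poisson_kernel_def using poisson_denominator[of r]
  by (intro continuous_intros) (metis less_irrefl)

text \<open>The denominator decreases as the cosine grows. Comparing cosines instead of angles
  serves both monotonicity near a point and smallness away from it.\<close>

lemma poisson_kernel_le:
  assumes "0 \<le> r" "r < 1" "cos t \<le> cos s"
  shows "poisson_kernel r t \<le> poisson_kernel r s"
proof -
  have "r * cos t \<le> r * cos s" using assms by (intro mult_left_mono) auto
  then show ?thesis
    unfolding poisson_kernel_def using poisson_denominator[of r s] assms
    by (intro divide_left_mono) (auto simp: power_le_one intro!: mult_pos_pos poisson_denominator)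
qed

lemma poisson_kernel_minus: "poisson_kernel r (- t) = poisson_kernel r t"
  by (simp add: poisson_kernel_def)

lemma poisson_kernel_tendsto_0:
  assumes "cos \<delta> < 1"
  shows "((\<lambda>r. poisson_kernel r \<delta>) \<longlongrightarrow> 0) (at_left 1)"
proof -
  have "((\<lambda>r. poisson_kernel r \<delta>) \<longlongrightarrow> (1 - 1\<^sup>2) / (1 - 2 * 1 * cos \<delta> + 1\<^sup>2)) (at_left 1)"
    unfolding poisson_kernel_def using assms by (intro tendsto_intros) auto
  then show ?thesis by simp
qed

section \<open>The Poisson kernel\<close>

text \<open>The range of \<open>y\<close> consists of the angles whose distance from 0 on the circle
  is at least \<delta>, also when measured across the end of the period.\<close>

lemma cos_le_cos_if:
  assumes "0 \<le> \<delta>" "\<delta> \<le> pi" "\<delta> \<le> y" "y \<le> 2 * pi - \<delta>"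
  shows "cos y \<le> cos (\<delta>::real)"
proof (cases "y \<le> pi")
  case True
  then show ?thesis using assms by (intro cos_monotone_0_pi_le) auto
next
  case False
  have "cos y = cos (2 * pi - y)" by (simp add: cos_diff)
  also have "\<dots> \<le> cos \<delta>" using assms False by (intro cos_monotone_0_pi_le) auto
  finally show ?thesis .
qed

text \<open>Near \<open>t\<close> the kernel decreases with the distance, so
  \<open>integral_antimono_weight_le\<close> applies on either side; away from \<open>t\<close> the
  kernel itself tends to 0. The total mass is a hypothesis here and is obtained afterwards from the
  geometric expansion of the kernel.\<close>

lemma poisson_convergence_real:
  fixes U :: "real \<Rightarrow> complex"
  assumes U: "integrable lborel U"
    and total: "\<And>r t. 0 \<le> r \<Longrightarrow> r < 1 \<Longrightarrow> (LINT x:{0..2*pi}|lborel. poisson_kernel r (x - t)) = 2 * pi"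
  shows "AE t in lborel. t \<in> {0<..<2*pi} \<longrightarrow>
    ((\<lambda>r. LINT x:{0..2*pi}|lborel. poisson_kernel r (x - t) *\<^sub>R U x) \<longlongrightarrow> (2*pi) *\<^sub>R U t) (at_left 1)"
  using Lebesgue_point_AE[OF U] Lebesgue_point_left_AE[OF U]
proof eventually_elim
  case (elim t)
  show ?case
  proof (intro impI tendstoI)
    fix e :: real assume t: "t \<in> {0<..<2*pi}" and "e > 0"
    \<comment> \<open>Each side of \<open>t\<close> contributes at most 2 pi \<epsilon>, together
      e/2; the far part gets the other half.\<close>
    define \<epsilon> where "\<epsilon> = e / (8 * pi)"
    have "\<epsilon> > 0" using \<open>e > 0\<close> by (simp add: \<epsilon>_def)
    obtain d1 where d1: "d1 > 0" "\<And>h. 0 \<le> h \<Longrightarrow> h < d1 \<Longrightarrow> norm (LINT x:{t..t+h}|lborel. U x - U t) \<le> \<epsilon> * h"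
      using elim(1) \<open>\<epsilon> > 0\<close> by metis
    obtain d2 where d2: "d2 > 0" "\<And>h. 0 \<le> h \<Longrightarrow> h < d2 \<Longrightarrow> norm (LINT x:{t-h..t}|lborel. U x - U t) \<le> \<epsilon> * h"
      using elim(2) \<open>\<epsilon> > 0\<close> by metis
    \<comment> \<open>Small enough for both one-sided estimates, and such that
      [t - \<delta>, t + \<delta>] stays within one period, which also forces \<delta> \<le>
      pi.\<close>
    define \<delta> where "\<delta> = min (min d1 d2 / 2) (min t (2*pi - t))"
    have \<delta>: "0 < \<delta>" "\<delta> < d1" "\<delta> < d2" "\<delta> \<le> t" "\<delta> \<le> 2*pi - t"
      using d1 d2 t by (auto simp: \<delta>_def min_def)
    define v where "v x = U x - U t" for x
    have c: "set_integrable lborel {a..b} (\<lambda>x. U t)" for a b :: real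
      by (intro borel_integrable_atLeastAtMost' continuous_intros)
    have vi: "set_integrable lborel {a..b} v" for a b
    proof -
      have "set_integrable lborel {a..b} U"
        using U unfolding set_integrable_def by (intro integrable_mult_indicator) auto
      then show ?thesis
        unfolding v_def by (intro set_integral_diff(1) c)
    qed
    have vr: "set_integrable lborel {a..b} (\<lambda>s. v (t + s))" and vl: "set_integrable lborel {a..b} (\<lambda>s. v (t - s))" for a b
    proof -
      have "integrable lborel (\<lambda>s. U (t + 1 * s))" "integrable lborel (\<lambda>s. U (t + (-1) * s))"
        using U by (simp_all only: lborel_integrable_real_affine_iff[of 1] lborel_integrable_real_affine_iff[of "-1"])
      then have "set_integrable lborel {a..b} (\<lambda>s. U (t + s))" "set_integrable lborel {a..b} (\<lambda>s. U (t - s))"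
        unfolding set_integrable_def by (auto intro: integrable_mult_indicator)
      then show "set_integrable lborel {a..b} (\<lambda>s. v (t + s))" "set_integrable lborel {a..b} (\<lambda>s. v (t - s))"
        unfolding v_def by (auto intro!: set_integral_diff(1) c)
    qed
    define B where "B = (LINT x:{0..2*pi}|lborel. norm (v x))"
    define Far where "Far = {0..2*pi} - {t-\<delta>..t+\<delta>}"
    have key: "norm (LINT x:{0..2*pi}|lborel. poisson_kernel r (x - t) *\<^sub>R v x) \<le> e / 2 + poisson_kernel r \<delta> * B"
      if r: "0 \<le> r" "r < 1" for r
    proof -
      let ?P = "poisson_kernel r"
      have Pc: "continuous_on S (\<lambda>x. ?P (x - t))" for S
        by (rule continuous_on_compose2[OF continuous_on_poisson_kernel[OF r]]) (auto intro!: continuous_intros)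
      have Pm: "(\<lambda>x. ?P (x - t)) \<in> borel_measurable borel"
        by (rule borel_measurable_continuous_onI[OF Pc])
      have P0: "0 \<le> ?P x" "?P x \<le> ?P 0" for x
        using poisson_kernel_nonneg[OF r] poisson_kernel_le[OF r, of x 0] by auto
      have Pv: "set_integrable lborel {a..b} (\<lambda>x. ?P (x - t) *\<^sub>R v x)" for a b
        by (rule set_integrable_bounded_scaleR[OF vi Pm, of _ _ "?P 0"]) (use P0 in auto)
      have anti: "?P s' \<le> ?P s" if "0 \<le> s" "s \<le> s'" "s' \<le> \<delta>" for s s'
        using that \<delta> by (intro poisson_kernel_le[OF r] cos_monotone_0_pi_le) auto
      have total_le: "(LINT x:{a..b}|lborel. ?P (x - t)) \<le> 2 * pi" if "0 \<le> a" "b \<le> 2*pi" for a b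
      proof -
        have "(LINT x:{a..b}|lborel. ?P (x - t)) \<le> (LINT x:{0..2*pi}|lborel. ?P (x - t))"
          unfolding set_lebesgue_integral_def
        proof (rule integral_mono)
          show "integrable lborel (\<lambda>x. indicator {a..b} x *\<^sub>R ?P (x - t))"
            "integrable lborel (\<lambda>x. indicator {0..2*pi} x *\<^sub>R ?P (x - t))"
            using borel_integrable_atLeastAtMost'[OF Pc] unfolding set_integrable_def by blast+
        qed (use that P0 in \<open>auto simp: indicator_def\<close>)
        then show ?thesis using total[OF r] by simp
      qed
      have right: "norm (LINT x:{t..t+\<delta>}|lborel. ?P (x - t) *\<^sub>R v x) \<le> \<epsilon> * (2*pi)"
      proof -
        have "norm (LINT s:{0..\<delta>}|lborel. ?P s *\<^sub>R v (t + s)) \<le> \<epsilon> * (LINT s:{0..\<delta>}|lborel. ?P s)"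
        proof (rule integral_antimono_weight_le[OF continuous_on_poisson_kernel[OF r] P0(1) anti vr])
          fix \<sigma> assume "\<sigma> \<in> {0..\<delta>}"
          then show "norm (LINT s:{0..\<sigma>}|lborel. v (t + s)) \<le> \<epsilon> * \<sigma>"
            using d1(2)[of \<sigma>] \<delta> by (simp add: set_integral_shift v_def)
        qed (use \<delta> in auto)
        also have "(LINT s:{0..\<delta>}|lborel. ?P s) = (LINT x:{t..t+\<delta>}|lborel. ?P (x - t))"
          by (simp add: set_integral_shift)
        also have "\<epsilon> * \<dots> \<le> \<epsilon> * (2 * pi)"
          using t \<delta> \<open>\<epsilon> > 0\<close> by (intro mult_left_mono total_le) auto
        finally show ?thesis by (simp add: set_integral_shift)
      qed
      have left: "norm (LINT x:{t-\<delta>..t}|lborel. ?P (x - t) *\<^sub>R v x) \<le> \<epsilon> * (2*pi)"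
      proof -
        have "norm (LINT s:{0..\<delta>}|lborel. ?P s *\<^sub>R v (t - s)) \<le> \<epsilon> * (LINT s:{0..\<delta>}|lborel. ?P s)"
        proof (rule integral_antimono_weight_le[OF continuous_on_poisson_kernel[OF r] P0(1) anti vl])
          fix \<sigma> assume "\<sigma> \<in> {0..\<delta>}"
          then show "norm (LINT s:{0..\<sigma>}|lborel. v (t - s)) \<le> \<epsilon> * \<sigma>"
            using d2(2)[of \<sigma>] \<delta> by (simp add: set_integral_reflect v_def)
        qed (use \<delta> in auto)
        also have "(LINT s:{0..\<delta>}|lborel. ?P s) = (LINT x:{t-\<delta>..t}|lborel. ?P (x - t))"
          by (simp add: set_integral_reflect poisson_kernel_minus)
        also have "\<epsilon> * \<dots> \<le> \<epsilon> * (2 * pi)"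
          using t \<delta> \<open>\<epsilon> > 0\<close> by (intro mult_left_mono total_le) auto
        finally show ?thesis by (simp add: set_integral_reflect poisson_kernel_minus)
      qed
      have FarB: "Far \<in> sets lborel" "Far \<subseteq> {0..2*pi}" by (auto simp: Far_def)
      note Farv = set_integrable_subset[OF Pv FarB] set_integrable_subset[OF set_integrable_norm[OF vi] FarB]
      have far: "norm (LINT x:Far|lborel. ?P (x - t) *\<^sub>R v x) \<le> ?P \<delta> * B"
      proof -
        have "norm (LINT x:Far|lborel. ?P (x - t) *\<^sub>R v x) \<le> (LINT x:Far|lborel. norm (?P (x - t) *\<^sub>R v x))"
          unfolding set_lebesgue_integral_def
          using integral_norm_bound[of lborel "\<lambda>x. indicator Far x *\<^sub>R (?P (x - t) *\<^sub>R v x)"]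
          by (simp add: abs_mult mult.assoc)
        also have "\<dots> \<le> (LINT x:Far|lborel. ?P \<delta> * norm (v x))"
        proof (rule set_integral_mono)
          show "set_integrable lborel Far (\<lambda>x. norm (?P (x - t) *\<^sub>R v x))"
            by (rule set_integrable_norm[OF Farv(1)])
          show "set_integrable lborel Far (\<lambda>x. ?P \<delta> * norm (v x))"
            using Farv(2) by simp
          show "norm (?P (x - t) *\<^sub>R v x) \<le> ?P \<delta> * norm (v x)" if x: "x \<in> Far" for x
          proof -
            \<comment> \<open>Since \<delta> is at most \<open>t\<close> and at most
              \<open>2 * pi - t\<close>, the distance of \<open>x\<close> from \<open>t\<close> lies
              between \<delta> and 2 pi - \<delta>.\<close>
            have "cos (x - t) = cos \<bar>x - t\<bar>" by simp
            also have "\<dots> \<le> cos \<delta>"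
              using x t \<delta> by (intro cos_le_cos_if) (auto simp: Far_def abs_if)
            finally have "?P (x - t) \<le> ?P \<delta>" by (rule poisson_kernel_le[OF r])
            then show ?thesis using P0 by (simp add: mult_right_mono)
          qed
        qed
        also have "\<dots> = ?P \<delta> * (LINT x:Far|lborel. norm (v x))" by simp
        also have "\<dots> \<le> ?P \<delta> * B"
          unfolding B_def
        proof (rule mult_left_mono)
          show "(LINT x:Far|lborel. norm (v x)) \<le> (LINT x:{0..2*pi}|lborel. norm (v x))"
            unfolding set_lebesgue_integral_def
            using Farv(2) set_integrable_norm[OF vi, of 0 "2*pi"] FarB unfolding set_integrable_def
            by (intro integral_mono) (auto simp: indicator_def)
        qed (rule P0)
        finally show ?thesis .
      qed
      have "{0..2*pi} = ({t-\<delta>..t} \<union> {t..t+\<delta>}) \<union> Far"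
        using t \<delta> by (auto simp: Far_def)
      then have "(LINT x:{0..2*pi}|lborel. ?P (x - t) *\<^sub>R v x) =
          (LINT x:({t-\<delta>..t} \<union> {t..t+\<delta>}) \<union> Far|lborel. ?P (x - t) *\<^sub>R v x)"
        by simp
      also have "\<dots> = (LINT x:{t-\<delta>..t} \<union> {t..t+\<delta>}|lborel. ?P (x - t) *\<^sub>R v x) +
          (LINT x:Far|lborel. ?P (x - t) *\<^sub>R v x)"
        by (intro set_integral_Un set_integrable_Un Pv Farv) (auto simp: Far_def)
      also have "(LINT x:{t-\<delta>..t} \<union> {t..t+\<delta>}|lborel. ?P (x - t) *\<^sub>R v x) =
          (LINT x:{t-\<delta>..t}|lborel. ?P (x - t) *\<^sub>R v x) + (LINT x:{t..t+\<delta>}|lborel. ?P (x - t) *\<^sub>R v x)"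
      proof (rule set_integral_Un_AE[OF _ _ _ Pv Pv])
        show "AE x in lborel. \<not> (x \<in> {t-\<delta>..t} \<and> x \<in> {t..t+\<delta>})"
          using AE_lborel_singleton[of t] by eventually_elim auto
      qed auto
      finally have "norm (LINT x:{0..2*pi}|lborel. ?P (x - t) *\<^sub>R v x) \<le> \<epsilon> * (2*pi) + \<epsilon> * (2*pi) + ?P \<delta> * B"
        using norm_triangle_mono[OF norm_triangle_mono[OF left right] far] by (simp only:)
      also have "\<epsilon> * (2*pi) + \<epsilon> * (2*pi) = e / 2" by (simp add: \<epsilon>_def)
      finally show ?thesis .
    qed
    have "\<delta> \<le> pi" using \<delta> by linarith
    then have "cos \<delta> < cos 0" using \<delta> by (intro cos_monotone_0_pi) auto
    then have "((\<lambda>r. poisson_kernel r \<delta> * B) \<longlongrightarrow> 0 * B) (at_left 1)"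
      by (intro tendsto_mult poisson_kernel_tendsto_0 tendsto_const) simp
    then have "\<forall>\<^sub>F r in at_left 1. poisson_kernel r \<delta> * B < e / 2"
      using \<open>e > 0\<close> by (intro order_tendstoD) auto
    moreover have "\<forall>\<^sub>F r in at_left (1::real). r \<in> {0<..<1}"
      by (rule eventually_at_left_real) simp
    ultimately show "\<forall>\<^sub>F r in at_left 1.
        dist (LINT x:{0..2*pi}|lborel. poisson_kernel r (x - t) *\<^sub>R U x) ((2*pi) *\<^sub>R U t) < e"
    proof eventually_elim
      case (elim r)
      then have r: "0 \<le> r" "r < 1" by auto
      have Pc: "continuous_on S (\<lambda>x. poisson_kernel r (x - t))" for S
        by (rule continuous_on_compose2[OF continuous_on_poisson_kernel[OF r]]) (auto intro!: continuous_intros)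
      have Pi: "set_integrable lborel {0..2*pi} (\<lambda>x. poisson_kernel r (x - t))"
        by (rule borel_integrable_atLeastAtMost'[OF Pc])
      have PU: "set_integrable lborel {0..2*pi} (\<lambda>x. poisson_kernel r (x - t) *\<^sub>R U x)"
      proof (rule set_integrable_bounded_scaleR)
        show "set_integrable lborel {0..2*pi} U"
          using U unfolding set_integrable_def by (intro integrable_mult_indicator) auto
        show "\<bar>poisson_kernel r (s - t)\<bar> \<le> poisson_kernel r 0" for s
          using poisson_kernel_nonneg[OF r] poisson_kernel_le[OF r, of "s - t" 0] by simp
      qed (auto intro: borel_measurable_continuous_onI Pc)
      have Pt: "set_integrable lborel {0..2*pi} (\<lambda>x. poisson_kernel r (x - t) *\<^sub>R U t)"
        using Pi by simp
      have "(LINT x:{0..2*pi}|lborel. poisson_kernel r (x - t) *\<^sub>R U t) = (2*pi) *\<^sub>R U t"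
        using total[OF r, of t] Pi unfolding set_lebesgue_integral_def set_integrable_def
        by simp
      then have "(LINT x:{0..2*pi}|lborel. poisson_kernel r (x - t) *\<^sub>R v x) =
          (LINT x:{0..2*pi}|lborel. poisson_kernel r (x - t) *\<^sub>R U x) - (2*pi) *\<^sub>R U t"
        using set_integral_diff(2)[OF PU Pt] by (simp add: v_def scaleR_diff_right)
      with key[OF r] elim show ?case by (simp add: dist_norm)
    qed
  qed
qed

text \<open>The same kernel in circle variables, complex valued so that it multiplies complex
  functions directly. \<open>circle_poisson_cis\<close> returns to the angle.\<close>

definition circle_poisson :: "real \<Rightarrow> complex \<Rightarrow> complex \<Rightarrow> complex" where
  "circle_poisson r \<zeta> \<eta> = complex_of_real ((1 - r\<^sup>2) / (norm (1 - of_real r * \<zeta> * cnj \<eta>))\<^sup>2)"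

lemma measurable_circle_poisson: "circle_poisson r \<zeta> \<in> borel_measurable borel"
proof -
  have [measurable]: "(\<lambda>\<eta>. norm (1 - of_real r * \<zeta> * cnj \<eta>)) \<in> borel_measurable borel"
    by (intro borel_measurable_continuous_onI continuous_intros)
  show ?thesis unfolding circle_poisson_def by measurable
qed

abbreviation poisson_integral :: "(complex \<Rightarrow> complex) \<Rightarrow> real \<Rightarrow> complex \<Rightarrow> complex" where
  "poisson_integral F r \<zeta> \<equiv> \<integral>\<eta>. circle_poisson r \<zeta> \<eta> * F \<eta> \<partial>\<mu>"

lemma circle_poisson_cis: "circle_poisson r (cis t) (cis x) = complex_of_real (poisson_kernel r (x - t))"
proof -
  have "(norm (1 - of_real r * cis t * cnj (cis x)))\<^sup>2 = (norm (1 - of_real r * cis (t - x)))\<^sup>2"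
    by (simp add: cis_cnj cis_mult mult.assoc)
  also have "\<dots> = (1 - r * cos (t - x))\<^sup>2 + (r * sin (t - x))\<^sup>2"
    by (simp add: cmod_power2)
  also have "\<dots> = 1 - 2 * r * cos (t - x) + r\<^sup>2 * ((sin (t - x))\<^sup>2 + (cos (t - x))\<^sup>2)"
    by algebra
  also have "\<dots> = 1 - 2 * r * cos (t - x) + r\<^sup>2"
    by (simp only: sin_cos_squared_add mult_1_right)
  also have "cos (t - x) = cos (x - t)"
    by (metis cos_minus minus_diff_eq)
  finally show ?thesis by (simp add: circle_poisson_def poisson_kernel_def)
qed

text \<open>With w = r \<zeta> cnj \<eta> of modulus r, the two geometric series add up to (1 -
  |w|^2) / |1 - w|^2. The first carries the non-negative powers of \<zeta>, the second the negative
  ones.\<close>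

lemma circle_poisson_geometric:
  assumes "norm \<zeta> = 1" "norm \<eta> = 1" "0 \<le> r" "r < 1"
  shows "circle_poisson r \<zeta> \<eta> =
    (\<Sum>k. (of_real r * \<zeta> * cnj \<eta>) ^ k) + (\<Sum>k. (of_real r * cnj \<zeta> * \<eta>) ^ Suc k)"
proof -
  define w where "w = of_real r * \<zeta> * cnj \<eta>"
  have w: "norm w = r" "norm (cnj w) < 1" "norm w < 1"
    using assms by (simp_all add: w_def norm_mult)
  have ne: "1 - w \<noteq> 0" "1 - cnj w \<noteq> 0" using w by auto
  have ww: "w * cnj w = of_real (r\<^sup>2)" using w(1) by (simp add: complex_norm_square[symmetric])
  have 1: "(\<Sum>k. w ^ k) = 1 / (1 - w)" using w by (simp add: suminf_geometric)
  have 2: "(\<Sum>k. cnj w ^ Suc k) = cnj w / (1 - cnj w)"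
    using w summable_geometric[OF w(2)] by (simp add: suminf_mult suminf_geometric)
  have 3: "1 / (1 - w) + cnj w / (1 - cnj w) = (1 - w * cnj w) / ((1 - w) * (1 - cnj w))"
    using ne by (simp add: field_simps)
  have 4: "(1 - w) * (1 - cnj w) = of_real ((norm (1 - w))\<^sup>2)"
    unfolding complex_norm_square by simp
  have 5: "circle_poisson r \<zeta> \<eta> = (1 - w * cnj w) / ((1 - w) * (1 - cnj w))"
    unfolding circle_poisson_def w_def[symmetric] 4 ww by simp
  have 6: "of_real r * cnj \<zeta> * \<eta> = cnj w" by (simp add: w_def)
  show ?thesis
    unfolding 6 w_def[symmetric] by (simp only: 1 2 3 5)
qed

text \<open>Integrating the expanded kernel termwise, the half with conjugate powers of \<zeta>
  meets only coefficients that vanish by \<open>neg\<close>. What remains is the power series of the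
  Fourier coefficients of F at r \<zeta>.\<close>

lemma circle_poisson_sums:
  fixes F :: "complex \<Rightarrow> complex"
  assumes F: "integrable \<mu> F" and \<zeta>: "norm \<zeta> = 1" and r: "0 \<le> r" "r < 1"
    and neg: "\<And>k. k \<ge> 1 \<Longrightarrow> (\<integral>\<eta>. circle_power (int k) \<eta> * F \<eta> \<partial>\<mu>) = 0"
  shows "(\<lambda>k. (\<integral>\<eta>. circle_power (- int k) \<eta> * F \<eta> \<partial>\<mu>) * (of_real r * \<zeta>) ^ k) sums
    poisson_integral F r \<zeta>"
proof -
  have Fm [measurable]: "F \<in> borel_measurable \<mu>" using F by auto
  have cpm: "circle_power m \<in> borel_measurable \<mu>" for m
    by (rule measurable_circle_measure) simp
  have cpF: "integrable \<mu> (\<lambda>\<eta>. circle_power m \<eta> * F \<eta>)" for m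
    by (rule Bochner_Integration.integrable_bound[OF F borel_measurable_times[OF cpm Fm]])
      (use AE_circle_norm in \<open>eventually_elim, simp add: norm_mult norm_circle_power\<close>)
  \<comment> \<open>Termwise integration, justified by the majorants r^k |F|; the exponents
    \<open>m k\<close> are left free so that both halves of the kernel are covered.\<close>
  have series: "integrable \<mu> (\<lambda>\<eta>. \<Sum>k. a ^ k * (circle_power (m k) \<eta> * F \<eta>))"
    "(\<lambda>k. \<integral>\<eta>. a ^ k * (circle_power (m k) \<eta> * F \<eta>) \<partial>\<mu>) sums
      (\<integral>\<eta>. (\<Sum>k. a ^ k * (circle_power (m k) \<eta> * F \<eta>)) \<partial>\<mu>)"
    if a: "norm a = r" for a and m :: "nat \<Rightarrow> int"
  proof -
    have i: "integrable \<mu> (\<lambda>\<eta>. a ^ k * (circle_power (m k) \<eta> * F \<eta>))" for k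
      by (intro integrable_mult_right cpF)
    have n: "AE \<eta> in \<mu>. \<forall>k. norm (a ^ k * (circle_power (m k) \<eta> * F \<eta>)) = r ^ k * norm (F \<eta>)"
      using AE_circle_norm by eventually_elim (simp add: norm_mult norm_power a norm_circle_power)
    have s: "AE \<eta> in \<mu>. summable (\<lambda>k. norm (a ^ k * (circle_power (m k) \<eta> * F \<eta>)))"
      using n by eventually_elim (use r in \<open>simp add: summable_mult2 summable_geometric\<close>)
    have "(\<integral>\<eta>. norm (a ^ k * (circle_power (m k) \<eta> * F \<eta>)) \<partial>\<mu>) =
        r ^ k * (\<integral>\<eta>. norm (F \<eta>) \<partial>\<mu>)" for k
    proof -
      have "(\<integral>\<eta>. norm (a ^ k * (circle_power (m k) \<eta> * F \<eta>)) \<partial>\<mu>) =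
          (\<integral>\<eta>. r ^ k * norm (F \<eta>) \<partial>\<mu>)"
        using n by (intro AE_cong_integral integrable_norm i integrable_mult_right F) (auto elim!: eventually_mono)
      then show ?thesis by simp
    qed
    then have t: "summable (\<lambda>k. \<integral>\<eta>. norm (a ^ k * (circle_power (m k) \<eta> * F \<eta>)) \<partial>\<mu>)"
      using r by (simp add: summable_mult2 summable_geometric)
    show "integrable \<mu> (\<lambda>\<eta>. \<Sum>k. a ^ k * (circle_power (m k) \<eta> * F \<eta>))"
      "(\<lambda>k. \<integral>\<eta>. a ^ k * (circle_power (m k) \<eta> * F \<eta>) \<partial>\<mu>) sums
      (\<integral>\<eta>. (\<Sum>k. a ^ k * (circle_power (m k) \<eta> * F \<eta>)) \<partial>\<mu>)"
      by (rule integrable_suminf[OF i s t], rule sums_integral[OF i s t])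
  qed
  have a1: "norm (of_real r * \<zeta>) = r" "norm (of_real r * cnj \<zeta>) = r"
    using r \<zeta> by (simp_all add: norm_mult)
  let ?f = "\<lambda>\<eta>. \<Sum>k. (of_real r * \<zeta>) ^ k * (circle_power (- int k) \<eta> * F \<eta>)"
  \<comment> \<open>One factor \<open>of_real r * cnj \<zeta>\<close> is left out to match the power
    \<open>a ^ k\<close> in \<open>series\<close>; it is restored in \<open>eq\<close>.\<close>
  let ?g = "\<lambda>\<eta>. \<Sum>k. (of_real r * cnj \<zeta>) ^ k * (circle_power (int (Suc k)) \<eta> * F \<eta>)"
  have "(\<lambda>k. 0) sums (\<integral>\<eta>. ?g \<eta> \<partial>\<mu>)"
    using series(2)[OF a1(2), of "\<lambda>k. int (Suc k)"] neg[of "Suc _"] by simp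
  then have g0: "(\<integral>\<eta>. ?g \<eta> \<partial>\<mu>) = 0" by (simp add: sums_unique2[OF _ sums_zero])
  have eq: "AE \<eta> in \<mu>. ?f \<eta> + of_real r * cnj \<zeta> * ?g \<eta> = circle_poisson r \<zeta> \<eta> * F \<eta>"
    using AE_circle_norm
  proof eventually_elim
    case (elim \<eta>)
    have n: "norm (of_real r * \<zeta> * cnj \<eta>) < 1" "norm (of_real r * cnj \<zeta> * \<eta>) < 1"
      using elim r \<zeta> by (simp_all add: norm_mult)
    have "?f \<eta> = (\<Sum>k. (of_real r * \<zeta> * cnj \<eta>) ^ k * F \<eta>)"
      by (intro suminf_cong) (simp add: circle_power_of_nat power_mult_distrib mult_ac flip: cnj_circle_power)
    also have "\<dots> = (\<Sum>k. (of_real r * \<zeta> * cnj \<eta>) ^ k) * F \<eta>"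
      using summable_geometric[OF n(1)] by (rule suminf_mult2[symmetric])
    finally have f: "?f \<eta> = (\<Sum>k. (of_real r * \<zeta> * cnj \<eta>) ^ k) * F \<eta>" .
    have "?g \<eta> = (\<Sum>k. (of_real r * cnj \<zeta> * \<eta>) ^ k * (\<eta> * F \<eta>))"
      by (intro suminf_cong) (simp add: circle_power_of_nat power_mult_distrib mult_ac del: of_nat_Suc)
    also have "\<dots> = (\<Sum>k. (of_real r * cnj \<zeta> * \<eta>) ^ k) * (\<eta> * F \<eta>)"
      using summable_geometric[OF n(2)] by (rule suminf_mult2[symmetric])
    finally have "of_real r * cnj \<zeta> * ?g \<eta> = (of_real r * cnj \<zeta> * \<eta>) * (\<Sum>k. (of_real r * cnj \<zeta> * \<eta>) ^ k) * F \<eta>"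
      by (simp add: mult_ac)
    also have "(of_real r * cnj \<zeta> * \<eta>) * (\<Sum>k. (of_real r * cnj \<zeta> * \<eta>) ^ k) = (\<Sum>k. (of_real r * cnj \<zeta> * \<eta>) ^ Suc k)"
      using suminf_mult[OF summable_geometric[OF n(2)], of "of_real r * cnj \<zeta> * \<eta>"] by simp
    finally show ?case
      using f by (simp add: circle_poisson_geometric[OF \<zeta> elim r] distrib_right)
  qed
  have i: "integrable \<mu> (\<lambda>\<eta>. ?f \<eta> + of_real r * cnj \<zeta> * ?g \<eta>)"
    by (intro Bochner_Integration.integrable_add integrable_mult_right series a1)
  have "poisson_integral F r \<zeta> = (\<integral>\<eta>. ?f \<eta> + of_real r * cnj \<zeta> * ?g \<eta> \<partial>\<mu>)"
  proof (rule integral_cong_AE[symmetric])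
    show "(\<lambda>\<eta>. circle_poisson r \<zeta> \<eta> * F \<eta>) \<in> borel_measurable \<mu>"
      using borel_measurable_times[OF measurable_circle_measure[OF measurable_circle_poisson] Fm] by simp
  qed (use i eq in auto)
  also have "\<dots> = (\<integral>\<eta>. ?f \<eta> \<partial>\<mu>)"
    using g0 series(1)[OF a1(1)] series(1)[OF a1(2)] by simp
  finally show ?thesis
    using series(2)[OF a1(1), of "\<lambda>k. - int k"] by (simp add: mult.commute)
qed

section \<open>Fourier coefficients and Fatou's theorem\<close>

text \<open>The inverse of \<^const>\<open>cis\<close> on \<open>[0, 2\<pi>)\<close>, chosen to be visibly Borel measurable. It transports
  null sets from the line to the circle without any measurability assumption on the property.\<close>

definition circle_angle :: "complex \<Rightarrow> real" where
  "circle_angle z = (let a = arccos (max (-1) (min 1 (Re z))) in if 0 \<le> Im z then a else 2*pi - a)"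

lemma measurable_circle_angle: "circle_angle \<in> borel_measurable borel"
proof -
  have [measurable]: "(\<lambda>z. arccos (max (-1) (min 1 (Re z)))) \<in> borel_measurable borel"
    by (intro borel_measurable_continuous_onI continuous_on_arccos continuous_intros) auto
  have [measurable]: "Measurable.pred borel (\<lambda>z. 0 \<le> Im z)" by measurable
  show ?thesis unfolding circle_angle_def Let_def by measurable
qed

lemma circle_angle_cis:
  assumes "0 \<le> t" "t < 2*pi"
  shows "circle_angle (cis t) = t"
proof (cases "t \<le> pi")
  case True
  then show ?thesis
    using assms sin_ge_zero[of t]
    by (simp add: circle_angle_def min_absorb2 max_absorb2 arccos_cos Let_def)
next
  case False
  have "arccos (cos t) = arccos (cos (2*pi - t))" by (simp add: cos_diff)
  also have "\<dots> = 2*pi - t" using False assms by (intro arccos_cos) auto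
  finally have "arccos (cos t) = 2*pi - t" .
  moreover have "sin t < 0" using False assms by (intro sin_lt_zero) auto
  ultimately show ?thesis by (simp add: circle_angle_def min_absorb2 max_absorb2 Let_def)
qed

lemma cis_circle_angle:
  assumes "norm z = 1"
  shows "cis (circle_angle z) = z" "0 \<le> circle_angle z" "circle_angle z \<le> 2*pi"
proof -
  have sq: "(Re z)\<^sup>2 + (Im z)\<^sup>2 = 1" using assms cmod_power2[of z] by simp
  have b: "- 1 \<le> Re z" "Re z \<le> 1" using abs_Re_le_cmod[of z] assms by auto
  have "sin (arccos (Re z)) = \<bar>Im z\<bar>"
    using sq b by (simp add: sin_arccos algebra_simps flip: real_sqrt_abs)
  then show "cis (circle_angle z) = z"
    using b by (auto simp: circle_angle_def Let_def min_def max_def complex_eq_iff cos_diff sin_diff)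
  show "0 \<le> circle_angle z" "circle_angle z \<le> 2*pi"
    using b arccos_bounded[of "Re z"] by (auto simp: circle_angle_def Let_def min_def max_def)
qed

lemma AE_circle_if_AE_angle:
  assumes "AE t in lborel. t \<in> {0<..<2*pi} \<longrightarrow> P (cis t)"
  shows "AE \<zeta> in \<mu>. P \<zeta>"
proof -
  obtain N0 where N0: "N0 \<in> null_sets lborel" "\<And>t. t \<notin> N0 \<Longrightarrow> t \<in> {0<..<2*pi} \<longrightarrow> P (cis t)"
    using assms by (rule AE_E3) auto
  \<comment> \<open>The angles 0 and 2 pi have the same image 1. Excluding both leaves angles in the
    open interval, to which the assumption applies.\<close>
  define N where "N = {0, 2*pi} \<union> N0"
  have N: "N \<in> null_sets lborel"
    unfolding N_def by (intro null_sets.Un N0(1) finite_imp_null_set_lborel) simp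
  then have Nb: "N \<in> sets borel" by (auto simp: null_sets_def)
  have "AE \<zeta> in \<mu>. circle_angle \<zeta> \<notin> N"
  proof (rule AE_circle_measureI)
    show "AE t in lborel. t \<in> {0..2*pi} \<longrightarrow> circle_angle (cis t) \<notin> N"
      using AE_not_in[OF N]
    proof eventually_elim
      case (elim t)
      then have "t \<noteq> 2*pi" by (auto simp: N_def)
      with elim show ?case by (auto simp: circle_angle_cis)
    qed
    have "circle_angle -` (- N) \<inter> space borel \<in> sets borel"
      by (rule measurable_sets[OF measurable_circle_angle]) (use Nb in auto)
    then show "{z. circle_angle z \<notin> N} \<in> sets borel" by (simp add: vimage_def)
  qed
  then show ?thesis
    using AE_circle_norm
  proof eventually_elim
    case (elim \<zeta>)
    then have "circle_angle \<zeta> \<in> {0<..<2*pi}" "circle_angle \<zeta> \<notin> N0"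
      using cis_circle_angle[of \<zeta>] by (auto simp: N_def less_le)
    then show ?case using N0(2) cis_circle_angle(1)[OF elim(2)] by metis
  qed
qed

text \<open>\<mu> is a completion, while the change of variables to the angle requires a Borel
  integrand. Real and imaginary parts are modified separately.\<close>

lemma borel_modification:
  fixes F :: "complex \<Rightarrow> complex"
  assumes F: "F \<in> borel_measurable \<mu>"
  obtains G where "G \<in> borel_measurable borel" "AE \<zeta> in \<mu>. F \<zeta> = G \<zeta>"
proof -
  define M where "M = distr (uniform_measure lborel {0..2*pi}) borel cis"
  have "(\<lambda>z. Re (F z)) \<in> borel_measurable (completion M)" "(\<lambda>z. Im (F z)) \<in> borel_measurable (completion M)"
    using F by (simp_all add: circle_measure_def M_def)
  then obtain A B where AB: "A \<in> borel_measurable M" "AE z in M. Re (F z) = A z"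
      "B \<in> borel_measurable M" "AE z in M. Im (F z) = B z"
    using completion_ex_borel_measurable_real by metis
  show ?thesis
  proof
    have "A \<in> borel_measurable borel" "B \<in> borel_measurable borel" using AB by (simp_all add: M_def)
    then show "(\<lambda>z. Complex (A z) (B z)) \<in> borel_measurable borel"
      by (subst borel_measurable_complex_iff) simp
    have "AE z in M. F z = Complex (A z) (B z)"
      using AB(2,4) by eventually_elim (simp add: complex_eq_iff)
    then show "AE z in \<mu>. F z = Complex (A z) (B z)"
      unfolding circle_measure_def M_def by (rule AE_completion)
  qed
qed

text \<open>In the series of the constant function 1 only the term k = 0 survives. This provides the
  total mass of the kernel without an integration in the angle.\<close>

lemma integral_circle_poisson:
  assumes "norm \<zeta> = 1" "0 \<le> r" "r < 1"
  shows "(\<integral>\<eta>. circle_poisson r \<zeta> \<eta> \<partial>\<mu>) = 1"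
proof -
  have c: "(\<integral>\<eta>. circle_power m \<eta> * 1 \<partial>\<mu>) = (if m = 0 then 1 else 0)" for m
    by (simp add: integral_circle_power)
  have "(\<lambda>k. (\<integral>\<eta>. circle_power (- int k) \<eta> * 1 \<partial>\<mu>) * (of_real r * \<zeta>) ^ k) sums
      (\<integral>\<eta>. circle_poisson r \<zeta> \<eta> * 1 \<partial>\<mu>)"
    by (rule circle_poisson_sums) (use assms in \<open>auto simp: integral_circle_power\<close>)
  moreover have "(\<lambda>k. (\<integral>\<eta>. circle_power (- int k) \<eta> * 1 \<partial>\<mu>) * (of_real r * \<zeta>) ^ k) =
      (\<lambda>k. if k = 0 then 1 else 0)"
    unfolding c by auto
  ultimately show ?thesis
    using sums_unique2[OF sums_single[of 0 "\<lambda>_. 1 :: complex"]] by fastforce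
qed

lemma poisson_integral_radial_limit:
  fixes F :: "complex \<Rightarrow> complex"
  assumes F: "integrable \<mu> F"
  shows "AE \<zeta> in \<mu>. ((\<lambda>r. poisson_integral F r \<zeta>) \<longlongrightarrow> F \<zeta>) (at_left 1)"
proof -
  have Fm: "F \<in> borel_measurable \<mu>" using F by auto
  then obtain G where G: "G \<in> borel_measurable borel" "AE \<zeta> in \<mu>. F \<zeta> = G \<zeta>"
    by (rule borel_modification)
  have Gi: "integrable \<mu> G"
    using F G by (intro integrable_cong_AE_imp[OF F measurable_circle_measure[OF G(1)]]) (auto elim!: eventually_mono)
  \<comment> \<open>Cut off outside one period rather than extended periodically; the convergence
    statement only concerns interior points \<open>t\<close>.\<close>
  define U where "U t = indicator {0..2*pi} t *\<^sub>R G (cis t)" for t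
  have U: "integrable lborel U"
    using Gi by (simp only: integrable_circle_iff[OF G(1)] set_integrable_def U_def[abs_def])
  have total: "(LINT x:{0..2*pi}|lborel. poisson_kernel r (x - t)) = 2 * pi" if r: "0 \<le> r" "r < 1" for r t
  proof -
    have "1 = (\<integral>\<eta>. circle_poisson r (cis t) \<eta> \<partial>\<mu>)"
      using r by (simp add: integral_circle_poisson)
    also have "\<dots> = (1 / (2*pi)) *\<^sub>R (LINT x:{0..2*pi}|lborel. circle_poisson r (cis t) (cis x))"
      by (rule integral_circle[OF measurable_circle_poisson])
    also have "(LINT x:{0..2*pi}|lborel. circle_poisson r (cis t) (cis x)) =
        complex_of_real (LINT x:{0..2*pi}|lborel. poisson_kernel r (x - t))"
      by (simp add: circle_poisson_cis set_lebesgue_integral_def scaleR_conv_of_real flip: of_real_mult integral_complex_of_real)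
    finally have "complex_of_real (2 * pi) = complex_of_real (LINT x:{0..2*pi}|lborel. poisson_kernel r (x - t))"
      by (simp add: scaleR_conv_of_real field_simps)
    then show ?thesis by (simp only: of_real_eq_iff)
  qed
  have conv: "AE t in lborel. t \<in> {0<..<2*pi} \<longrightarrow>
      ((\<lambda>r. LINT x:{0..2*pi}|lborel. poisson_kernel r (x - t) *\<^sub>R U x) \<longlongrightarrow> (2*pi) *\<^sub>R U t) (at_left 1)"
    by (rule poisson_convergence_real[OF U total])
  have "AE \<zeta> in \<mu>. ((\<lambda>r. poisson_integral G r \<zeta>) \<longlongrightarrow> G \<zeta>) (at_left 1)"
  proof (rule AE_circle_if_AE_angle)
    show "AE t in lborel. t \<in> {0<..<2*pi} \<longrightarrow>
        ((\<lambda>r. poisson_integral G r (cis t)) \<longlongrightarrow> G (cis t)) (at_left 1)"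
      using conv
    proof eventually_elim
      case (elim t)
      show ?case
      proof
        assume t: "t \<in> {0<..<2*pi}"
        have "poisson_integral G r (cis t) =
            (1 / (2*pi)) *\<^sub>R (LINT x:{0..2*pi}|lborel. poisson_kernel r (x - t) *\<^sub>R U x)" for r
        proof -
          have "(LINT x:{0..2*pi}|lborel. circle_poisson r (cis t) (cis x) * G (cis x)) =
              (LINT x:{0..2*pi}|lborel. poisson_kernel r (x - t) *\<^sub>R U x)"
            unfolding set_lebesgue_integral_def
            by (intro Bochner_Integration.integral_cong) (auto simp: U_def circle_poisson_cis scaleR_conv_of_real indicator_def)
          then show ?thesis
            by (subst integral_circle) (auto intro!: borel_measurable_times measurable_circle_poisson G)
        qed
        moreover have "((\<lambda>r. (1 / (2*pi)) *\<^sub>R (LINT x:{0..2*pi}|lborel. poisson_kernel r (x - t) *\<^sub>R U x)) \<longlongrightarrow>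
            (1 / (2*pi)) *\<^sub>R (2*pi) *\<^sub>R U t) (at_left 1)"
          using elim t by (intro tendsto_scaleR tendsto_const) auto
        moreover have "U t = G (cis t)" using t by (simp add: U_def)
        ultimately show "((\<lambda>r. poisson_integral G r (cis t)) \<longlongrightarrow> G (cis t)) (at_left 1)"
          by simp
      qed
    qed
  qed
  then show ?thesis
    using G(2)
  proof eventually_elim
    case (elim \<zeta>)
    have "poisson_integral F r \<zeta> = poisson_integral G r \<zeta>" for r
    proof (rule integral_cong_AE)
      show "AE \<eta> in \<mu>. circle_poisson r \<zeta> \<eta> * F \<eta> = circle_poisson r \<zeta> \<eta> * G \<eta>"
        using G(2) by eventually_elim simp
    qed (intro borel_measurable_times measurable_circle_measure measurable_circle_poisson G(1) Fm)+
    with elim show ?case by simp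
  qed
qed

text \<open>All Poisson integrals of F vanish, and F is their radial limit almost
  everywhere.\<close>

lemma AE_zero_if_fourier_coefficients_zero:
  fixes F :: "complex \<Rightarrow> complex"
  assumes F: "integrable \<mu> F"
    and zero: "\<And>m. (\<integral>\<eta>. circle_power m \<eta> * F \<eta> \<partial>\<mu>) = 0"
  shows "AE \<zeta> in \<mu>. F \<zeta> = 0"
  using poisson_integral_radial_limit[OF F] AE_circle_norm
proof eventually_elim
  case (elim \<zeta>)
  have "poisson_integral F r \<zeta> = 0" if "r \<in> {0<..<1}" for r
    using circle_poisson_sums[OF F elim(2), of r] that by (simp add: zero sums_unique2[OF _ sums_zero])
  then have "\<forall>\<^sub>F r in at_left 1. poisson_integral F r \<zeta> = 0"
    using eventually_at_left_real[of 0 "1::real"] by (auto elim!: eventually_mono)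
  then have "((\<lambda>r. poisson_integral F r \<zeta>) \<longlongrightarrow> 0) (at_left 1)"
    by (rule tendsto_eventually)
  then show ?case using elim(1) tendsto_unique[OF trivial_limit_at_left_real] by blast
qed

section \<open>Square summable coefficients and boundary functions\<close>

lemma integrable_if_sq_integrable:
  assumes "sq_integrable (F :: complex \<Rightarrow> complex)"
  shows "integrable \<mu> F"
proof -
  have "sq_integrable (\<lambda>_. 1 :: complex)"
    by (rule sq_integrable_bounded[where C = 1]) (auto intro: strongly_measurable_const)
  from integrable_cinner_sq_integrable[OF assms this] show ?thesis
    by (simp add: cinner_complex_def)
qed

lemma norm_sum_trig_monomial:
  fixes b :: "nat \<Rightarrow> complex"
  shows "(norm (\<Sum>n<N. trig_monomial (int n) (b n)))\<^sup>2 = (\<Sum>n<N. (norm (b n))\<^sup>2)"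
proof -
  have "complex_of_real ((norm (\<Sum>n<N. trig_monomial (int n) (b n)))\<^sup>2) =
      cinner (\<Sum>n<N. trig_monomial (int n) (b n)) (\<Sum>n<N. trig_monomial (int n) (b n))"
    by (rule cinner_self_norm[symmetric])
  also have "\<dots> = (\<Sum>n<N. \<Sum>m<N. if n = m then cinner (b n) (b m) else 0)"
    by (simp add: cinner_sum_left cinner_sum_right cinner_trig_monomials)
  also have "\<dots> = complex_of_real (\<Sum>n<N. (norm (b n))\<^sup>2)"
    by (simp add: cinner_self_norm)
  finally show ?thesis by (simp only: of_real_eq_iff)
qed

lemma AE_rep_sum_trig_monomial:
  "AE \<zeta> in \<mu>. rep_L2_circle (\<Sum>n<N. trig_monomial (int n) (b n)) \<zeta> = (\<Sum>n<N. \<zeta> ^ n * (b n :: complex))"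
proof (induction N)
  case 0
  then show ?case using AE_rep_zero[where 'a = complex] by simp
next
  case (Suc N)
  then show ?case
    using AE_rep_trig_monomial[of "int N" "b N"] AE_rep_add[of "\<Sum>n<N. trig_monomial (int n) (b n)" "trig_monomial (int N) (b N)"]
    by eventually_elim (simp add: scaleC_complex_def circle_power_of_nat)
qed

text \<open>Parseval on circles of radius r < 1 bounds the sums of |a n|^2 r^(2n) independently of
  r; then r tends to 1 in each finite partial sum.\<close>

lemma bounded_power_series_square_summable:
  fixes \<phi> :: "complex \<Rightarrow> complex"
  assumes a: "\<And>z. z \<in> ball 0 1 \<Longrightarrow> (\<lambda>n. a n * z ^ n) sums \<phi> z"
    and C: "\<And>z. z \<in> ball 0 1 \<Longrightarrow> norm (\<phi> z) \<le> C"
  shows "summable (\<lambda>n. (norm (a n))\<^sup>2)"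
proof (rule summableI_nonneg_bounded)
  fix N :: nat
  have le: "(\<Sum>n<N. (norm (a n * of_real r ^ n))\<^sup>2) \<le> (C + 1)\<^sup>2" if r: "0 < r" "r < 1" for r :: real
  proof -
    \<comment> \<open>Convergence at the larger radius (1 + r) / 2 gives absolute convergence at
      radius r.\<close>
    have "summable (\<lambda>n. a n * of_real ((1 + r) / 2) ^ n)"
      using r by (intro sums_summable[OF a]) (simp only: mem_ball_0 norm_of_real, simp)
    then have s: "summable (\<lambda>n. norm (a n * of_real r ^ n))"
      by (rule powser_insidea) (use r in \<open>simp only: norm_of_real, simp\<close>)
    \<comment> \<open>A tail below 1 makes the truncated polynomial bounded by C + 1 on the circle
      of radius r, so that Parseval is used for finite sums only.\<close>
    then obtain M0 where M0: "\<And>M. M \<ge> M0 \<Longrightarrow> norm (\<Sum>n. norm (a (n + M) * of_real r ^ (n + M))) < 1"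
      using suminf_exist_split[OF zero_less_one s] by auto
    define M where "M = max M0 N"
    let ?e = "\<Sum>n<M. trig_monomial (int n) (a n * of_real r ^ n)"
    have "AE \<zeta> in \<mu>. norm (rep_L2_circle ?e \<zeta>) \<le> C + 1"
      using AE_rep_sum_trig_monomial[of "\<lambda>n. a n * of_real r ^ n" M] AE_circle_norm
    proof eventually_elim
      case (elim \<zeta>)
      have z: "of_real r * \<zeta> \<in> ball 0 1" using r elim by (simp add: norm_mult)
      define t where "t n = a n * (of_real r * \<zeta>) ^ n" for n
      have tn: "norm (t n) = norm (a n * of_real r ^ n)" for n
        by (simp add: t_def norm_mult norm_power elim power_mult_distrib)
      have ts: "summable (\<lambda>n. norm (t n))" unfolding tn by (rule s)
      have "\<phi> (of_real r * \<zeta>) = (\<Sum>n. t n)"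
        using a[OF z] by (simp add: t_def sums_iff)
      also have "\<dots> = (\<Sum>n. t (n + M)) + (\<Sum>n<M. t n)"
        by (rule suminf_split_initial_segment[OF summable_norm_cancel[OF ts]])
      finally have "(\<Sum>n<M. t n) = \<phi> (of_real r * \<zeta>) - (\<Sum>n. t (n + M))" by simp
      moreover have "norm (\<Sum>n. t (n + M)) \<le> 1"
      proof -
        have "norm (\<Sum>n. t (n + M)) \<le> (\<Sum>n. norm (t (n + M)))"
          by (rule summable_norm) (use ts in \<open>simp add: summable_iff_shift[of "\<lambda>n. norm (t n)"]\<close>)
        also have "\<dots> \<le> 1" using M0[of M] unfolding tn by (simp add: M_def)
        finally show ?thesis .
      qed
      ultimately have "norm (\<Sum>n<M. t n) \<le> C + 1"
        using C[OF z] norm_triangle_ineq4[of "\<phi> (of_real r * \<zeta>)" "\<Sum>n. t (n + M)"] by simp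
      moreover have "(\<Sum>n<M. t n) = (\<Sum>n<M. \<zeta> ^ n * (a n * of_real r ^ n))"
        by (simp add: t_def power_mult_distrib mult_ac)
      ultimately show ?case using elim by simp
    qed
    then have "(norm ?e)\<^sup>2 \<le> (\<integral>\<zeta>. (C + 1)\<^sup>2 \<partial>\<mu>)"
      unfolding norm_L2 using sq_integrable_rep[of ?e]
      by (intro integral_mono_AE) (auto simp: sq_integrable_def elim!: eventually_mono intro: power_mono)
    then have "(\<Sum>n<M. (norm (a n * of_real r ^ n))\<^sup>2) \<le> (C + 1)\<^sup>2"
      by (simp add: norm_sum_trig_monomial)
    moreover have "(\<Sum>n<N. (norm (a n * of_real r ^ n))\<^sup>2) \<le> (\<Sum>n<M. (norm (a n * of_real r ^ n))\<^sup>2)"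
      by (intro sum_mono2) (auto simp: M_def)
    ultimately show ?thesis by linarith
  qed
  have "((\<lambda>r. \<Sum>n<N. (norm (a n * of_real r ^ n))\<^sup>2) \<longlongrightarrow> (\<Sum>n<N. (norm (a n * of_real 1 ^ n))\<^sup>2)) (at_left (1::real))"
    by (intro tendsto_intros)
  moreover have "\<forall>\<^sub>F r in at_left (1::real). (\<Sum>n<N. (norm (a n * of_real r ^ n))\<^sup>2) \<le> (C + 1)\<^sup>2"
    using eventually_at_left_real[of 0 "1::real"] by (auto elim!: eventually_mono intro: le)
  ultimately have "(\<Sum>n<N. (norm (a n * of_real 1 ^ n))\<^sup>2) \<le> (C + 1)\<^sup>2"
    by (rule tendsto_upperbound) simp
  then show "(\<Sum>n<N. (norm (a n))\<^sup>2) \<le> (C + 1)\<^sup>2" by simp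
qed simp

text \<open>By orthogonality the partial sums are Cauchy, and each coefficient, being an inner
  product, is continuous along the limit.\<close>

lemma square_summable_fourier_series:
  fixes a :: "nat \<Rightarrow> complex"
  assumes "summable (\<lambda>n. (norm (a n))\<^sup>2)"
  shows "\<exists>F. sq_integrable F \<and> (\<forall>m. (\<integral>\<zeta>. circle_power (- m) \<zeta> * F \<zeta> \<partial>\<mu>) = (if m \<ge> 0 then a (nat m) else 0))"
proof -
  define e where "e N = (\<Sum>n<N. trig_monomial (int n) (a n))" for N
  have "Cauchy e"
  proof (rule metric_CauchyI)
    fix \<epsilon> :: real assume "\<epsilon> > 0"
    then have "\<exists>N. \<forall>m\<ge>N. \<forall>n. norm (\<Sum>k=m..<n. (norm (a k))\<^sup>2) < \<epsilon>\<^sup>2"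
      using assms by (subst (asm) summable_Cauchy) auto
    then obtain N where N: "\<And>m n. m \<ge> N \<Longrightarrow> norm (\<Sum>k=m..<n. (norm (a k))\<^sup>2) < \<epsilon>\<^sup>2" by blast
    have le: "dist (e m) (e n) < \<epsilon>" if "N \<le> m" "m \<le> n" for m n
    proof -
      \<comment> \<open>Padding with zero coefficients brings the block from \<open>m\<close> to
        \<open>n\<close> into the form covered by \<open>norm_sum_trig_monomial\<close>.\<close>
      have *: "(\<Sum>k<n. if k < m then 0 else f k) = (\<Sum>k=m..<n. f k)" for f :: "nat \<Rightarrow> 'b::comm_monoid_add"
        by (rule sum.mono_neutral_cong_right) auto
      have "e n - e m = (\<Sum>k=m..<n. trig_monomial (int k) (a k))"
        using that unfolding e_def by (simp add: sum_diff_nat_ivl lessThan_atLeast0)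
      also have "\<dots> = (\<Sum>k<n. trig_monomial (int k) (if k < m then 0 else a k))"
        unfolding *[symmetric] by (intro sum.cong) (auto simp: trig_monomial_def zero_L2_circle_def)
      finally have "(norm (e n - e m))\<^sup>2 = (\<Sum>k<n. if k < m then 0 else (norm (a k))\<^sup>2)"
        by (simp add: norm_sum_trig_monomial if_distrib[of norm] if_distrib[of "\<lambda>x. x\<^sup>2"] cong: if_cong)
      also have "\<dots> < \<epsilon>\<^sup>2"
        using N[OF that(1), of n] unfolding * by simp
      finally have "norm (e n - e m) < \<epsilon>"
        using \<open>\<epsilon> > 0\<close> by (simp add: power_less_imp_less_base)
      then show ?thesis by (simp add: dist_norm norm_minus_commute)
    qed
    show "\<exists>M. \<forall>m\<ge>M. \<forall>n\<ge>M. dist (e m) (e n) < \<epsilon>"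
      by (rule exI[of _ N]) (metis le dist_commute linear)
  qed
  then obtain l where l: "e \<longlonglongrightarrow> l"
    using L2_circle_complete[of UNIV e] complete_UNIV by auto
  have "(\<integral>\<zeta>. circle_power (- m) \<zeta> * rep_L2_circle l \<zeta> \<partial>\<mu>) = (if m \<ge> 0 then a (nat m) else 0)" for m
  proof -
    have "(\<lambda>N. cinner (e N) (trig_monomial m 1)) \<longlonglongrightarrow> cinner l (trig_monomial m 1)"
      by (intro tendsto_cinner l tendsto_const)
    moreover have "\<forall>\<^sub>F N in sequentially. cinner (e N) (trig_monomial m 1) = (if m \<ge> 0 then a (nat m) else 0)"
      using eventually_gt_at_top[of "nat m"]
    proof eventually_elim
      case (elim N)
      have "cinner (e N) (trig_monomial m 1) = (\<Sum>n<N. if int n = m then a n else 0)"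
        by (simp add: e_def cinner_sum_left cinner_trig_monomials cinner_complex_def cong: if_cong)
      also have "\<dots> = (if m \<ge> 0 then a (nat m) else 0)"
      proof (cases "m \<ge> 0")
        case True
        then have "int n = m \<longleftrightarrow> n = nat m" for n by auto
        then show ?thesis using True elim by simp
      qed auto
      finally show ?case .
    qed
    ultimately have "cinner l (trig_monomial m 1) = (if m \<ge> 0 then a (nat m) else 0)"
      by (rule LIMSEQ_unique[OF _ tendsto_eventually])
    then show ?thesis by (simp add: cinner_trig_monomial cinner_complex_def)
  qed
  then show ?thesis by (intro exI[of _ "rep_L2_circle l"]) simp
qed

text \<open>F is built from the Taylor coefficients, not from radial limits. Its Poisson integral is
  then the Taylor series of \<phi> at r \<zeta>, so the convergence of Poisson integrals yields the
  radial limits of \<phi> and identifies them with F.\<close>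

lemma Fatou_bounded_holomorphic:
  fixes \<phi> :: "complex \<Rightarrow> complex"
  assumes hol: "\<phi> holomorphic_on ball 0 1" and C: "\<And>z. z \<in> ball 0 1 \<Longrightarrow> norm (\<phi> z) \<le> C"
  obtains F a where "sq_integrable F" "\<And>z. z \<in> ball 0 1 \<Longrightarrow> (\<lambda>n. a n * z ^ n) sums \<phi> z"
    "AE \<zeta> in \<mu>. ((\<lambda>r. \<phi> (of_real r * \<zeta>)) \<longlongrightarrow> F \<zeta>) (at_left 1)"
    "\<And>m. (\<integral>\<zeta>. circle_power (- m) \<zeta> * F \<zeta> \<partial>\<mu>) = (if m \<ge> 0 then a (nat m) else 0)"
proof -
  define a where "a n = (deriv ^^ n) \<phi> 0 / fact n" for n
  have a: "(\<lambda>n. a n * z ^ n) sums \<phi> z" if "z \<in> ball 0 1" for z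
    using holomorphic_power_series[OF hol that] by (simp add: a_def)
  obtain F where F: "sq_integrable F"
    "\<And>m. (\<integral>\<zeta>. circle_power (- m) \<zeta> * F \<zeta> \<partial>\<mu>) = (if m \<ge> 0 then a (nat m) else 0)"
    using square_summable_fourier_series[OF bounded_power_series_square_summable[OF a C]] by blast
  note Fi = integrable_if_sq_integrable[OF F(1)]
  have "AE \<zeta> in \<mu>. ((\<lambda>r. \<phi> (of_real r * \<zeta>)) \<longlongrightarrow> F \<zeta>) (at_left 1)"
    using poisson_integral_radial_limit[OF Fi] AE_circle_norm
  proof eventually_elim
    case (elim \<zeta>)
    have "poisson_integral F r \<zeta> = \<phi> (of_real r * \<zeta>)" if r: "r \<in> {0<..<1}" for r
    proof (rule sums_unique2[OF _ a])
      have "(\<lambda>k. (\<integral>\<eta>. circle_power (- int k) \<eta> * F \<eta> \<partial>\<mu>) * (of_real r * \<zeta>) ^ k) sums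
          poisson_integral F r \<zeta>"
        by (rule circle_poisson_sums[OF Fi elim(2)]) (use r F(2)[of "- int _"] in auto)
      then show "(\<lambda>k. a k * (of_real r * \<zeta>) ^ k) sums poisson_integral F r \<zeta>"
        unfolding F(2) by simp
      show "of_real r * \<zeta> \<in> ball 0 1" using r elim by (simp add: norm_mult)
    qed
    then have "\<forall>\<^sub>F r in at_left 1. poisson_integral F r \<zeta> = \<phi> (of_real r * \<zeta>)"
      using eventually_at_left_real[of 0 "1::real"] by (auto elim!: eventually_mono)
    with elim(1) show ?case by (rule Lim_transform_eventually)
  qed
  with F a show ?thesis using that by blast
qed

section \<open>Recovering the fundamental functions\<close>

text \<open>Differentiability and bounds in operator norm pass to entries by Cauchy-Schwarz, which
  gives access to scalar function theory.\<close>

lemma H_infinity_matrix_entry: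
  assumes f: "f \<in> H_infinity E" and xy: "x \<in> E"
  shows "(\<lambda>z. cinner (f z x) y) holomorphic_on ball 0 1" "\<exists>C. \<forall>z\<in>ball 0 1. norm (cinner (f z x) y) \<le> C"
proof -
  show "(\<lambda>z. cinner (f z x) y) holomorphic_on ball 0 1"
    unfolding holomorphic_on_def
  proof
    fix z :: complex assume z: "z \<in> ball 0 1"
    then obtain L where L: "\<And>\<epsilon>. \<epsilon> > 0 \<Longrightarrow> \<exists>\<delta>>0. \<forall>w\<in>ball 0 1. norm (w - z) < \<delta> \<longrightarrow>
           (\<forall>x\<in>E. norm (f w x - f z x - (w - z) *\<^sub>C L x) \<le> \<epsilon> * norm (w - z) * norm x)"
      using f unfolding H_infinity_def by blast
    have "((\<lambda>z. cinner (f z x) y) has_derivative (\<lambda>h. cinner (L x) y * h)) (at z within ball 0 1)"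
      unfolding has_derivative_within_alt
    proof (intro conjI allI impI bounded_linear_mult_right)
      fix e :: real assume "e > 0"
      \<comment> \<open>The summand 1 keeps the denominator positive when \<open>x\<close> or
        \<open>y\<close> is zero.\<close>
      define \<epsilon> where "\<epsilon> = e / (norm x * norm y + 1)"
      have p: "0 < norm x * norm y + 1" by (intro add_nonneg_pos mult_nonneg_nonneg) auto
      then have "\<epsilon> > 0" using \<open>e > 0\<close> by (simp add: \<epsilon>_def)
      then obtain \<delta> where \<delta>: "\<delta> > 0" "\<And>w. w \<in> ball 0 1 \<Longrightarrow> norm (w - z) < \<delta> \<Longrightarrow>
           norm (f w x - f z x - (w - z) *\<^sub>C L x) \<le> \<epsilon> * norm (w - z) * norm x"
        using L xy by blast
      have "norm (cinner (f w x) y - cinner (f z x) y - cinner (L x) y * (w - z)) \<le> e * norm (w - z)"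
        if "w \<in> ball 0 1" "norm (w - z) < \<delta>" for w
      proof -
        have "cinner (f w x) y - cinner (f z x) y - cinner (L x) y * (w - z) =
            cinner (f w x - f z x - (w - z) *\<^sub>C L x) y"
          by (simp add: cinner_simps)
        also have "norm \<dots> \<le> norm (f w x - f z x - (w - z) *\<^sub>C L x) * norm y"
          by (rule norm_cinner_le)
        also have "\<dots> \<le> \<epsilon> * norm (w - z) * norm x * norm y"
          using \<delta>(2)[OF that] by (rule mult_right_mono) simp
        also have "\<dots> = norm (w - z) * (\<epsilon> * (norm x * norm y))" by simp
        also have "\<dots> \<le> norm (w - z) * e"
        proof (rule mult_left_mono)
          have "\<epsilon> * (norm x * norm y) \<le> \<epsilon> * (norm x * norm y + 1)"
            using \<open>\<epsilon> > 0\<close> by (intro mult_left_mono) auto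
          also have "\<dots> = e" using p by (simp add: \<epsilon>_def)
          finally show "\<epsilon> * (norm x * norm y) \<le> e" .
        qed simp
        finally show ?thesis by (simp add: mult.commute)
      qed
      with \<delta>(1) show "\<exists>d>0. \<forall>w\<in>ball 0 1. norm (w - z) < d \<longrightarrow>
          norm (cinner (f w x) y - cinner (f z x) y - cinner (L x) y * (w - z)) \<le> e * norm (w - z)" by blast
    qed
    then show "(\<lambda>z. cinner (f z x) y) field_differentiable at z within ball 0 1"
      unfolding field_differentiable_def has_field_derivative_def by blast
  qed
  obtain C where C: "\<And>z. z \<in> ball 0 1 \<Longrightarrow> norm (f z x) \<le> C * norm x"
    using f xy unfolding H_infinity_def by blast
  have "norm (cinner (f z x) y) \<le> C * norm x * norm y" if "z \<in> ball 0 1" for z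
    using norm_cinner_le[of "f z x" y] mult_right_mono[OF C[OF that] norm_ge_zero[of y]] by linarith
  then show "\<exists>C. \<forall>z\<in>ball 0 1. norm (cinner (f z x) y) \<le> C" by blast
qed

lemma H_infinity_entry_boundary:
  assumes f: "f \<in> H_infinity E" and x: "x \<in> E"
  obtains F a where "sq_integrable F" "\<And>z. z \<in> ball 0 1 \<Longrightarrow> (\<lambda>n. a n * z ^ n) sums cinner (f z x) y"
    "AE \<zeta> in \<mu>. ((\<lambda>r. cinner (f (of_real r * \<zeta>) x) y) \<longlongrightarrow> F \<zeta>) (at_left 1)"
    "\<And>m. (\<integral>\<zeta>. circle_power (- m) \<zeta> * F \<zeta> \<partial>\<mu>) = (if m \<ge> 0 then a (nat m) else 0)"
proof -
  obtain C where "\<And>z. z \<in> ball 0 1 \<Longrightarrow> norm (cinner (f z x) y) \<le> C"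
    using H_infinity_matrix_entry(2)[OF f x, of y] by blast
  from Fatou_bounded_holomorphic[OF H_infinity_matrix_entry(1)[OF f x] this] that show ?thesis by blast
qed

lemma sq_integrable_circle_power_scaleC:
  assumes g: "sq_integrable g"
  shows "sq_integrable (\<lambda>\<zeta>. circle_power m \<zeta> *\<^sub>C g \<zeta>)"
proof -
  have c: "strongly_measurable \<mu> (circle_power m)"
    by (intro strongly_measurable_of_borel measurable_circle_measure) simp
  have gm: "strongly_measurable \<mu> g" using g by (simp add: sq_integrable_def)
  have sm: "strongly_measurable \<mu> (\<lambda>\<zeta>. circle_power m \<zeta> *\<^sub>C g \<zeta>)"
    by (rule strongly_measurable_compose2[OF c gm])
      (intro bounded_bilinear.isCont[OF bounded_bilinear_scaleC] continuous_intros)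
  have "integrable \<mu> (\<lambda>\<zeta>. (norm (circle_power m \<zeta> *\<^sub>C g \<zeta>))\<^sup>2)"
  proof (rule integrable_cong_AE_imp[OF _ borel_measurable_norm_square[OF sm]])
    show "integrable \<mu> (\<lambda>\<zeta>. (norm (g \<zeta>))\<^sup>2)" using g by (simp add: sq_integrable_def)
    show "AE \<zeta> in \<mu>. (norm (g \<zeta>))\<^sup>2 = (norm (circle_power m \<zeta> *\<^sub>C g \<zeta>))\<^sup>2"
      using AE_circle_norm by eventually_elim (simp add: norm_scaleC norm_circle_power)
  qed
  with sm show ?thesis by (simp add: sq_integrable_def)
qed

lemma sq_integrable_sum:
  assumes "\<And>i. i \<in> A \<Longrightarrow> sq_integrable (f i)"
  shows "sq_integrable (\<lambda>\<zeta>. \<Sum>i\<in>A. f i \<zeta>)"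
  using assms by (induction A rule: infinite_finite_induct) (auto intro: sq_integrable_zero sq_integrable_add)

text \<open>Entrywise limits combine to a limit in norm because only finitely many basis vectors are
  tested and finitely many null sets discarded. F is a general function so that the adjoints, which
  are antiholomorphic, are covered too.\<close>

lemma boundary_value_finite_dim:
  assumes D: "complex_subspace D" "finite_cdim D" and x: "x \<in> D"
    and FD: "\<And>z. z \<in> ball 0 1 \<Longrightarrow> F z x \<in> D"
    and lim: "\<And>y. y \<in> D \<Longrightarrow> sq_integrable (b y) \<and>
      (AE \<zeta> in \<mu>. ((\<lambda>r. cinner (F (of_real r * \<zeta>) x) y) \<longlongrightarrow> b y \<zeta>) (at_left 1))"
  shows "sq_integrable (\<lambda>\<zeta>. boundary_value F \<zeta> x)"
    and "y \<in> D \<Longrightarrow> AE \<zeta> in \<mu>. cinner (boundary_value F \<zeta> x) y = b y \<zeta>"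
proof -
  obtain B where B: "finite B" "B \<subseteq> D" "\<And>x. x \<in> D \<Longrightarrow> x = (\<Sum>e\<in>B. cinner x e *\<^sub>C e)"
    using finite_cdim_basis[OF D] by blast
  define h where "h \<zeta> = (\<Sum>e\<in>B. b e \<zeta> *\<^sub>C e)" for \<zeta>
  have hs: "sq_integrable h"
    unfolding h_def
    by (intro sq_integrable_sum sq_integrable_linear[OF _ bounded_bilinear.bounded_linear_left[OF bounded_bilinear_scaleC]])
      (use lim B(2) in blast)
  have "AE \<zeta> in \<mu>. \<forall>e\<in>B. ((\<lambda>r. cinner (F (of_real r * \<zeta>) x) e) \<longlongrightarrow> b e \<zeta>) (at_left 1)"
    using lim B by (intro AE_finite_allI) auto
  then have tend: "AE \<zeta> in \<mu>. ((\<lambda>r. F (of_real r * \<zeta>) x) \<longlongrightarrow> h \<zeta>) (at_left 1)"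
    using AE_circle_norm
  proof eventually_elim
    case (elim \<zeta>)
    have "((\<lambda>r. \<Sum>e\<in>B. cinner (F (of_real r * \<zeta>) x) e *\<^sub>C e) \<longlongrightarrow> h \<zeta>) (at_left 1)"
      unfolding h_def by (intro tendsto_sum tendsto_scaleC tendsto_const) (use elim in blast)
    moreover have "\<forall>\<^sub>F r in at_left (1::real). (\<Sum>e\<in>B. cinner (F (of_real r * \<zeta>) x) e *\<^sub>C e) = F (of_real r * \<zeta>) x"
      using eventually_at_left_real[of 0 "1::real", simplified]
    proof eventually_elim
      case (elim r)
      then have "of_real r * \<zeta> \<in> ball 0 1" using \<open>norm \<zeta> = 1\<close> by (simp add: norm_mult)
      from B(3)[OF FD[OF this]] show ?case by (rule sym)
    qed
    ultimately show ?case by (rule Lim_transform_eventually)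
  qed
  then have bv: "AE \<zeta> in \<mu>. h \<zeta> = boundary_value F \<zeta> x"
    by eventually_elim (auto simp: boundary_value_def intro!: tendsto_Lim[symmetric])
  show "sq_integrable (\<lambda>\<zeta>. boundary_value F \<zeta> x)"
    by (rule sq_integrable_cong_AE[OF hs bv])
  assume y: "y \<in> D"
  have "AE \<zeta> in \<mu>. ((\<lambda>r. cinner (F (of_real r * \<zeta>) x) y) \<longlongrightarrow> b y \<zeta>) (at_left 1)"
    using lim[OF y] by blast
  with bv tend show "AE \<zeta> in \<mu>. cinner (boundary_value F \<zeta> x) y = b y \<zeta>"
  proof eventually_elim
    case (elim \<zeta>)
    have "((\<lambda>r. cinner (F (of_real r * \<zeta>) x) y) \<longlongrightarrow> cinner (h \<zeta>) y) (at_left 1)"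
      by (intro tendsto_cinner elim tendsto_const)
    from tendsto_unique[OF _ this elim(3)] elim(1) show ?case by simp
  qed
qed

text \<open>The adjoint term of the symbol is antianalytic, so it does not contribute to the positive
  Fourier coefficients.\<close>

lemma canonical_ay_coefficients:
  assumes D: "hilbert_space D" "finite_cdim D"
    and f: "\<And>i. i \<in> {1..n-1} \<Longrightarrow> f i \<in> H_infinity D" and i: "i \<in> {1..n-1}"
    and x: "x \<in> D" and y: "y \<in> D" and z: "z \<in> ball 0 1"
  shows "(\<lambda>m. cinner (canonical_ay n D f i (trig_monomial 0 x)) (trig_monomial (int m + 1) y) * z ^ m)
    sums cinner (f i z x) y"
proof -
  have S: "complex_subspace D" using D by (simp add: hilbert_space_iff)
  have i': "n - i \<in> {1..n-1}" "i \<noteq> n" using i by auto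
  note fi = f[OF i] and fj = f[OF i'(1)]
  have bop: "bounded_op D (f j z)" if "j \<in> {1..n-1}" "z \<in> ball 0 1" for j z
    using f[OF that(1)] that(2) by (auto simp: H_infinity_def)
  \<comment> \<open>Collects what Fatou's theorem gives for one entry, so that boundary functions
    and coefficients can be chosen for all \<open>y\<close> at once.\<close>
  define P where "P y F a \<longleftrightarrow> sq_integrable F \<and> (\<forall>z\<in>ball 0 1. (\<lambda>n. a n * z ^ n) sums cinner (f i z x) y) \<and>
    (AE \<zeta> in \<mu>. ((\<lambda>r. cinner (f i (of_real r * \<zeta>) x) y) \<longlongrightarrow> F \<zeta>) (at_left 1)) \<and>
    (\<forall>m. (\<integral>\<zeta>. circle_power (- m) \<zeta> * F \<zeta> \<partial>\<mu>) = (if m \<ge> 0 then a (nat m) else 0))" for y F a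
  have "\<exists>F a. P y F a" for y
    by (rule H_infinity_entry_boundary[OF fi x, of y]) (unfold P_def, blast)
  then obtain F a where "\<And>y. P y (F y) (a y)" by metis
  then have F: "sq_integrable (F y)" "z \<in> ball 0 1 \<Longrightarrow> (\<lambda>n. a y n * z ^ n) sums cinner (f i z x) y"
    "AE \<zeta> in \<mu>. ((\<lambda>r. cinner (f i (of_real r * \<zeta>) x) y) \<longlongrightarrow> F y \<zeta>) (at_left 1)"
    "(\<integral>\<zeta>. circle_power (- m) \<zeta> * F y \<zeta> \<partial>\<mu>) = (if m \<ge> 0 then a y (nat m) else 0)" for y z m
    unfolding P_def by blast+
  \<comment> \<open>Entries of the adjoint are conjugates of entries of \<open>f (n - i)\<close>
    with \<open>x\<close> and \<open>y\<close> exchanged; G is the boundary function before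
    conjugation. Its moments against positive powers are coefficients of negative index, hence
    zero.\<close>
  define R where "R y G \<longleftrightarrow> sq_integrable G \<and>
    (AE \<zeta> in \<mu>. ((\<lambda>r. cinner (f (n - i) (of_real r * \<zeta>) y) x) \<longlongrightarrow> G \<zeta>) (at_left 1)) \<and>
    (\<forall>m>0. (\<integral>\<zeta>. circle_power m \<zeta> * G \<zeta> \<partial>\<mu>) = 0)" for y G
  have "\<exists>G. R y G" if "y \<in> D" for y
  proof (rule H_infinity_entry_boundary[OF fj that, of x])
    fix G b assume G: "sq_integrable G" "AE \<zeta> in \<mu>. ((\<lambda>r. cinner (f (n - i) (of_real r * \<zeta>) y) x) \<longlongrightarrow> G \<zeta>) (at_left 1)"
      and b: "\<And>m. (\<integral>\<zeta>. circle_power (- m) \<zeta> * G \<zeta> \<partial>\<mu>) = (if m \<ge> 0 then b (nat m) else 0)"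
    have "(\<integral>\<zeta>. circle_power m \<zeta> * G \<zeta> \<partial>\<mu>) = 0" if "m > 0" for m
      using b[of "- m"] that by simp
    with G show ?thesis unfolding R_def by blast
  qed
  then obtain G where "\<And>y. y \<in> D \<Longrightarrow> R y (G y)" by metis
  then have G: "y \<in> D \<Longrightarrow> sq_integrable (G y)"
    "y \<in> D \<Longrightarrow> AE \<zeta> in \<mu>. ((\<lambda>r. cinner (f (n - i) (of_real r * \<zeta>) y) x) \<longlongrightarrow> G y \<zeta>) (at_left 1)"
    "y \<in> D \<Longrightarrow> m > 0 \<Longrightarrow> (\<integral>\<zeta>. circle_power m \<zeta> * G y \<zeta> \<partial>\<mu>) = 0" for y m
    unfolding R_def by blast+
  have Gs: "sq_integrable (\<lambda>\<zeta>. cnj (G y \<zeta>))" if "y \<in> D" for y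
    by (rule sq_integrable_linear[OF G(1)[OF that] bounded_linear_cnj])
  have fiD: "f i z x \<in> D" if "z \<in> ball 0 1" for z
    using bop[OF i that] x by (auto simp: bounded_op_def)
  have adD: "adj D (f (n - i) z) x \<in> D" if "z \<in> ball 0 1" for z
    by (rule bounded_adj_in[OF D(1) bop[OF i'(1) that]])
  have adlim: "sq_integrable (\<lambda>\<zeta>. cnj (G y \<zeta>)) \<and>
      (AE \<zeta> in \<mu>. ((\<lambda>r. cinner (adj D (f (n - i) (of_real r * \<zeta>)) x) y) \<longlongrightarrow> cnj (G y \<zeta>)) (at_left 1))"
    if y: "y \<in> D" for y
  proof
    show "AE \<zeta> in \<mu>. ((\<lambda>r. cinner (adj D (f (n - i) (of_real r * \<zeta>)) x) y) \<longlongrightarrow> cnj (G y \<zeta>)) (at_left 1)"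
      using G(2)[OF y] AE_circle_norm
    proof eventually_elim
      case (elim \<zeta>)
      have "\<forall>\<^sub>F r in at_left (1::real). cnj (cinner (f (n - i) (of_real r * \<zeta>) y) x) = cinner (adj D (f (n - i) (of_real r * \<zeta>)) x) y"
        using eventually_at_left_real[of 0 "1::real", simplified]
      proof eventually_elim
        case (elim r)
        then have "of_real r * \<zeta> \<in> ball 0 1" using \<open>norm \<zeta> = 1\<close> by (simp add: norm_mult)
        from bounded_cinner_adj[OF D(1) bop[OF i'(1) this] y] show ?case
          by (metis cinner_commute)
      qed
      with tendsto_cnj[OF elim(1)] show ?case by (rule Lim_transform_eventually)
    qed
  qed (rule Gs[OF y])
  have bv1: "sq_integrable (\<lambda>\<zeta>. boundary_value (f i) \<zeta> x)"
    "\<And>y. y \<in> D \<Longrightarrow> AE \<zeta> in \<mu>. cinner (boundary_value (f i) \<zeta> x) y = F y \<zeta>"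
    by (rule boundary_value_finite_dim[where F = "f i" and x = x and b = F, OF S D(2) x fiD conjI[OF F(1) F(3)]]; assumption)+
  have bv2: "sq_integrable (\<lambda>\<zeta>. boundary_value (\<lambda>z. adj D (f (n - i) z)) \<zeta> x)"
    "\<And>y. y \<in> D \<Longrightarrow> AE \<zeta> in \<mu>. cinner (boundary_value (\<lambda>z. adj D (f (n - i) z)) \<zeta> x) y = cnj (G y \<zeta>)"
    by (rule boundary_value_finite_dim[where F = "\<lambda>z. adj D (f (n - i) z)" and x = x and b = "\<lambda>y \<zeta>. cnj (G y \<zeta>)", OF S D(2) x adD adlim]; assumption)+
  define h where "h \<zeta> = ay_symbol n D f i \<zeta> x" for \<zeta>
  have hs: "sq_integrable h"
    using sq_integrable_add[OF sq_integrable_circle_power_scaleC[OF bv1(1), of 1] bv2(1)]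
    by (simp add: h_def[abs_def] ay_symbol_def)
  have "AE \<zeta> in \<mu>. h \<zeta> = ay_symbol n D f i \<zeta> (rep_L2_circle (trig_monomial 0 x) \<zeta>)"
    using AE_rep_trig_monomial[of 0 x] by eventually_elim (simp add: h_def)
  then have mult: "mult_op (ay_symbol n D f i) (trig_monomial 0 x) = abs_L2_circle h"
    using sq_integrable_cong_AE[OF hs] abs_L2_eqI[OF hs] by (simp add: mult_op_def)
  have coef: "cinner (canonical_ay n D f i (trig_monomial 0 x)) (trig_monomial (int m + 1) y) = a y m" for m
  proof -
    have "cinner (canonical_ay n D f i (trig_monomial 0 x)) (trig_monomial (int m + 1) y) =
        cinner (abs_L2_circle h) (trig_monomial (int m + 1) y)"
      using i'(2) by (simp add: canonical_ay_def toeplitz_def mult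
        orth_proj_cinner[OF hilbert_space_hardy[OF D(1)] trig_monomial_in_hardy[OF S y]])
    also have "\<dots> = (\<integral>\<zeta>. cinner (h \<zeta>) (circle_power (int m + 1) \<zeta> *\<^sub>C y) \<partial>\<mu>)"
      unfolding trig_monomial_def by (rule cinner_abs_L2[OF hs sq_integrable_trig_monomial])
    \<comment> \<open>The factor \<zeta> of the symbol turns the power -(m + 1) into -m, so that the
      Taylor coefficient of index m appears; the second summand is the conjugate of a moment of
      \<open>G y\<close> with positive exponent and integrates to 0.\<close>
    also have "\<dots> = (\<integral>\<zeta>. circle_power (- int m) \<zeta> * F y \<zeta> + cnj (circle_power (int m + 1) \<zeta> * G y \<zeta>) \<partial>\<mu>)"
    proof (rule AE_cong_integral)
      show "integrable \<mu> (\<lambda>\<zeta>. cinner (h \<zeta>) (circle_power (int m + 1) \<zeta> *\<^sub>C y))"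
        by (rule integrable_cinner_sq_integrable[OF hs sq_integrable_trig_monomial])
      show "integrable \<mu> (\<lambda>\<zeta>. circle_power (- int m) \<zeta> * F y \<zeta> + cnj (circle_power (int m + 1) \<zeta> * G y \<zeta>))"
        using sq_integrable_circle_power_scaleC[OF F(1)] sq_integrable_circle_power_scaleC[OF G(1)[OF y]]
        by (intro Bochner_Integration.integrable_add integrable_cnj integrable_if_sq_integrable)
          (simp_all add: scaleC_complex_def)
      show "AE \<zeta> in \<mu>. cinner (h \<zeta>) (circle_power (int m + 1) \<zeta> *\<^sub>C y) =
          circle_power (- int m) \<zeta> * F y \<zeta> + cnj (circle_power (int m + 1) \<zeta> * G y \<zeta>)"
        using bv1(2)[OF y] bv2(2)[OF y] AE_circle_norm
      proof eventually_elim
        case (elim \<zeta>)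
        have "circle_power (- (int m + 1)) \<zeta> * \<zeta> = circle_power (- int m) \<zeta>"
          using circle_power_add[OF elim(3), of "- (int m + 1)" 1] by simp
        then show ?case
          using elim by (simp add: h_def ay_symbol_def cinner_simps cnj_circle_power distrib_left mult.assoc[symmetric])
      qed
    qed
    also have "\<dots> = (\<integral>\<zeta>. circle_power (- int m) \<zeta> * F y \<zeta> \<partial>\<mu>) +
        cnj (\<integral>\<zeta>. circle_power (int m + 1) \<zeta> * G y \<zeta> \<partial>\<mu>)"
    proof -
      have "integrable \<mu> (\<lambda>\<zeta>. circle_power (- int m) \<zeta> * F y \<zeta>)"
        "integrable \<mu> (\<lambda>\<zeta>. circle_power (int m + 1) \<zeta> * G y \<zeta>)"
        using integrable_if_sq_integrable[OF sq_integrable_circle_power_scaleC[OF F(1)]]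
          integrable_if_sq_integrable[OF sq_integrable_circle_power_scaleC[OF G(1)[OF y]]]
        by (simp_all add: scaleC_complex_def)
      then show ?thesis
        by (subst Bochner_Integration.integral_add) (auto simp del: complex_cnj_mult)
    qed
    also have "\<dots> = a y m" by (simp add: F(4) G(3)[OF y])
    finally show ?thesis .
  qed
  show ?thesis unfolding coef by (rule F(2)[OF z])
qed

section \<open>The shift and its wandering subspace\<close>

lemma shift_hardy:
  assumes D: "hilbert_space D" and g: "g \<in> hardy_space D"
  shows "canonical_ay n D f n g \<in> hardy_space D"
    and "cinner (canonical_ay n D f n g) (trig_monomial m y) = cinner g (trig_monomial (m - 1) y)"
    and "canonical_ay n D f n g = abs_L2_circle (\<lambda>\<zeta>. \<zeta> *\<^sub>C rep_L2_circle g \<zeta>)"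
proof -
  have S: "complex_subspace D" using D by (simp add: hilbert_space_iff)
  let ?h = "\<lambda>\<zeta>. \<zeta> *\<^sub>C rep_L2_circle g \<zeta>"
  have hs: "sq_integrable ?h"
    using sq_integrable_circle_power_scaleC[OF sq_integrable_rep, of 1] by simp
  have gD: "AE \<zeta> in \<mu>. rep_L2_circle g \<zeta> \<in> D" using g by (simp add: hardy_space_iff)
  have c: "cinner (abs_L2_circle ?h) (trig_monomial m y) = cinner g (trig_monomial (m - 1) y)" for m y
  proof -
    have "cinner (abs_L2_circle ?h) (trig_monomial m y) = (\<integral>\<zeta>. cinner (?h \<zeta>) (circle_power m \<zeta> *\<^sub>C y) \<partial>\<mu>)"
      unfolding trig_monomial_def by (rule cinner_abs_L2[OF hs sq_integrable_trig_monomial])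
    also have "\<dots> = (\<integral>\<zeta>. cinner (rep_L2_circle g \<zeta>) (circle_power (m - 1) \<zeta> *\<^sub>C y) \<partial>\<mu>)"
    proof (rule AE_cong_integral)
      show "AE \<zeta> in \<mu>. cinner (?h \<zeta>) (circle_power m \<zeta> *\<^sub>C y) =
          cinner (rep_L2_circle g \<zeta>) (circle_power (m - 1) \<zeta> *\<^sub>C y)"
        using AE_circle_norm
      proof eventually_elim
        case (elim \<zeta>)
        then show ?case
          using circle_power_add[OF elim, of "- m" 1] by (simp add: cinner_simps cnj_circle_power)
      qed
    qed (intro integrable_cinner_sq_integrable hs sq_integrable_trig_monomial sq_integrable_rep)+
    also have "\<dots> = cinner g (trig_monomial (m - 1) y)"
      unfolding trig_monomial_def by (rule cinner_L2_abs[OF sq_integrable_trig_monomial, symmetric])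
    finally show ?thesis .
  qed
  have h: "abs_L2_circle ?h \<in> hardy_space D"
    unfolding hardy_space_iff
  proof (intro conjI allI impI ballI)
    show "AE \<zeta> in \<mu>. rep_L2_circle (abs_L2_circle ?h) \<zeta> \<in> D"
      using AE_rep_abs[OF hs] gD by eventually_elim (simp add: complex_subspaceD(3)[OF S])
    fix k :: nat and x assume "1 \<le> k" "x \<in> D"
    \<comment> \<open>The coefficient of index -k of the product is that of index -(k + 1) of
      \<open>g\<close>, so negative coefficients still vanish.\<close>
    moreover have "- int k - 1 = - int (Suc k)" by simp
    ultimately show "cinner (abs_L2_circle ?h) (trig_monomial (- int k) x) = 0"
      using g unfolding c hardy_space_iff by (metis le_Suc_eq)
  qed
  \<comment> \<open>The product already lies in the Hardy space, so the projection acts as the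
    identity.\<close>
  show *: "canonical_ay n D f n g = abs_L2_circle ?h"
    using hs hilbert_space_hardy[OF D] h
    by (simp add: canonical_ay_def toeplitz_def mult_op_def orth_proj_id hilbert_space_iff)
  show "canonical_ay n D f n g \<in> hardy_space D"
    "cinner (canonical_ay n D f n g) (trig_monomial m y) = cinner g (trig_monomial (m - 1) y)"
    unfolding * by (rule h c)+
qed

lemma shift_trig_monomial:
  assumes D: "hilbert_space D" and x: "x \<in> D" and m: "0 \<le> m"
  shows "canonical_ay n D f n (trig_monomial m x) = trig_monomial (m + 1) x"
proof -
  have S: "complex_subspace D" using D by (simp add: hilbert_space_iff)
  have "canonical_ay n D f n (trig_monomial m x) = abs_L2_circle (\<lambda>\<zeta>. \<zeta> *\<^sub>C rep_L2_circle (trig_monomial m x) \<zeta>)"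
    by (rule shift_hardy(3)[OF D trig_monomial_in_hardy[OF S x m]])
  also have "\<dots> = trig_monomial (m + 1) x"
    unfolding trig_monomial_def[of "m + 1"]
  proof (rule abs_L2_eqI[symmetric, OF sq_integrable_trig_monomial])
    show "AE \<zeta> in \<mu>. circle_power (m + 1) \<zeta> *\<^sub>C x = \<zeta> *\<^sub>C rep_L2_circle (trig_monomial m x) \<zeta>"
      using AE_rep_trig_monomial[of m x] AE_circle_norm
    proof eventually_elim
      case (elim \<zeta>)
      then show ?case using circle_power_add[OF elim(2), of m 1] by (simp add: scaleC_scaleC mult.commute)
    qed
  qed
  finally show ?thesis .
qed

text \<open>Each scalar entry minus its mean has only zero Fourier coefficients: negative ones
  vanish by membership in the Hardy space, positive ones by assumption. By finite dimension,
  finitely many entries determine \<open>h\<close>.\<close>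

lemma constant_if_fourier_coefficients_zero:
  assumes D: "complex_subspace D" "finite_cdim D" and h: "h \<in> hardy_space D"
    and pos: "\<And>m y. m \<ge> 1 \<Longrightarrow> y \<in> D \<Longrightarrow> cinner h (trig_monomial m y) = 0"
  shows "\<exists>u\<in>D. h = trig_monomial 0 u"
proof -
  obtain B where B: "finite B" "B \<subseteq> D" "\<And>x. x \<in> D \<Longrightarrow> x = (\<Sum>e\<in>B. cinner x e *\<^sub>C e)"
    using finite_cdim_basis[OF D] by blast
  define c where "c e = cinner h (trig_monomial 0 e)" for e
  define u where "u = (\<Sum>e\<in>B. c e *\<^sub>C e)"
  have uD: "u \<in> D"
    unfolding u_def using B(2) by (intro complex_subspace_sum[OF D(1)] complex_subspaceD(3)[OF D(1)]) auto
  have const: "AE \<zeta> in \<mu>. cinner (rep_L2_circle h \<zeta>) e - c e = 0" if e: "e \<in> D" for e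
  proof (rule AE_zero_if_fourier_coefficients_zero)
    have hi: "integrable \<mu> (\<lambda>\<zeta>. circle_power m \<zeta> * cinner (rep_L2_circle h \<zeta>) e)" for m
      using integrable_cinner_sq_integrable[OF sq_integrable_rep[of h] sq_integrable_trig_monomial[of "- m" e]]
      by (simp add: cinner_scaleC_right cnj_circle_power)
    show "integrable \<mu> (\<lambda>\<zeta>. cinner (rep_L2_circle h \<zeta>) e - c e)"
      using hi[of 0] by simp
    fix m
    have ci: "integrable \<mu> (circle_power m)"
      using integrable_if_sq_integrable[OF sq_integrable_trig_monomial[of m "1::complex"]] by (simp add: scaleC_complex_def)
    have "(\<integral>\<zeta>. circle_power m \<zeta> * (cinner (rep_L2_circle h \<zeta>) e - c e) \<partial>\<mu>) =
        (\<integral>\<zeta>. circle_power m \<zeta> * cinner (rep_L2_circle h \<zeta>) e \<partial>\<mu>) - (\<integral>\<zeta>. circle_power m \<zeta> * c e \<partial>\<mu>)"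
      using hi[of m] ci by (simp add: right_diff_distrib)
    also have "\<dots> = cinner h (trig_monomial (- m) e) - (if m = 0 then c e else 0)"
      by (simp add: cinner_trig_monomial integral_circle_power)
    also have "\<dots> = 0"
    proof -
      consider "m = 0" | "m < 0" | k where "k \<ge> 1" "m = int k"
        by (metis linorder_neqE_linordered_idom zero_less_imp_eq_int Suc_leI One_nat_def)
      then show ?thesis
      proof cases
        case 3
        then show ?thesis using h e by (simp add: hardy_space_iff)
      qed (use pos[of "- m"] e in \<open>auto simp: c_def\<close>)
    qed
    finally show "(\<integral>\<zeta>. circle_power m \<zeta> * (cinner (rep_L2_circle h \<zeta>) e - c e) \<partial>\<mu>) = 0" .
  qed
  have "AE \<zeta> in \<mu>. \<forall>e\<in>B. cinner (rep_L2_circle h \<zeta>) e - c e = 0"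
    using const B by (intro AE_finite_allI) auto
  moreover have "AE \<zeta> in \<mu>. rep_L2_circle h \<zeta> \<in> D"
    using h by (simp add: hardy_space_iff)
  ultimately have "AE \<zeta> in \<mu>. rep_L2_circle h \<zeta> = rep_L2_circle (trig_monomial 0 u) \<zeta>"
    using AE_rep_trig_monomial[of 0 u]
  proof eventually_elim
    case (elim \<zeta>)
    have "rep_L2_circle h \<zeta> = (\<Sum>e\<in>B. cinner (rep_L2_circle h \<zeta>) e *\<^sub>C e)" by (rule B(3)[OF elim(2)])
    also have "\<dots> = u" unfolding u_def using elim(1) by (intro sum.cong) auto
    finally show ?case using elim(3) by simp
  qed
  with uD show ?thesis using L2_eqI by blast
qed

text \<open>The constants are the orthogonal complement of the range of the shift, so a unitary
  commuting with the shifts maps constants to constants.\<close>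

lemma shift_intertwiner_constant:
  assumes D: "hilbert_space D" and D': "hilbert_space D'" "finite_cdim D'"
    and V: "unitary_op (hardy_space D) (hardy_space D') V"
    and comm: "\<And>h. h \<in> hardy_space D \<Longrightarrow> V (canonical_ay n D f n h) = canonical_ay n D' g n (V h)"
    and x: "x \<in> D"
  shows "\<exists>u\<in>D'. V (trig_monomial 0 x) = trig_monomial 0 u"
proof (rule constant_if_fourier_coefficients_zero)
  have S: "complex_subspace D" "complex_subspace D'" using D D' by (auto simp: hilbert_space_iff)
  have SH: "complex_subspace (hardy_space D)" using hilbert_space_hardy[OF D] by (simp add: hilbert_space_iff)
  show "complex_subspace D'" "finite_cdim D'" by fact+
  have c: "trig_monomial 0 x \<in> hardy_space D" by (rule trig_monomial_in_hardy[OF S(1) x]) simp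
  then show "V (trig_monomial 0 x) \<in> hardy_space D'" by (rule unitary_opD(2)[OF V])
  fix m :: int and y assume m: "1 \<le> m" and y: "y \<in> D'"
  \<comment> \<open>For m \<ge> 1, \<open>trig_monomial m y\<close> is the shift of the monomial of
    index m - 1, whose preimage under V is \<open>k\<close>. Pulled back, the inner product becomes
    the conjugate of a coefficient of \<open>k\<close> of index -1, which is zero.\<close>
  define k where "k = adj (hardy_space D) V (trig_monomial (m - 1) y)"
  have "trig_monomial (m - 1) y \<in> hardy_space D'" using m by (intro trig_monomial_in_hardy[OF S(2) y]) simp
  then have k: "k \<in> hardy_space D" "V k = trig_monomial (m - 1) y"
    unfolding k_def using unitary_op_adj[OF SH V] by auto
  have "trig_monomial m y = V (canonical_ay n D f n k)"
    using shift_trig_monomial[OF D'(1) y, of "m - 1"] m by (simp add: comm[OF k(1)] k(2))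
  then have "cinner (V (trig_monomial 0 x)) (trig_monomial m y) = cinner (trig_monomial 0 x) (canonical_ay n D f n k)"
    using unitary_opD(3)[OF V c shift_hardy(1)[OF D k(1)]] by simp
  also have "\<dots> = cnj (cinner k (trig_monomial (- 1) x))"
    using shift_hardy(2)[OF D k(1), of n f 0 x] cinner_commute[of "trig_monomial 0 x"] by simp
  also have "\<dots> = 0" using k(1) x unfolding hardy_space_iff by (metis One_nat_def complex_cnj_zero of_nat_1 order_refl)
  finally show "cinner (V (trig_monomial 0 x)) (trig_monomial m y) = 0" .
qed

section \<open>The unitary between the coefficient spaces\<close>

lemma trig_monomial_add: "trig_monomial m (x + y) = trig_monomial m x + trig_monomial m y"
  by (rule L2_eqI)
    (use AE_rep_trig_monomial[of m x] AE_rep_trig_monomial[of m y] AE_rep_trig_monomial[of m "x + y"]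
      AE_rep_add[of "trig_monomial m x" "trig_monomial m y"] in \<open>eventually_elim, simp add: scaleC_add_right\<close>)

lemma trig_monomial_scaleC: "trig_monomial m (a *\<^sub>C x) = a *\<^sub>C trig_monomial m x"
  by (rule L2_eqI)
    (use AE_rep_trig_monomial[of m x] AE_rep_trig_monomial[of m "a *\<^sub>C x"]
      AE_rep_scaleC[of a "trig_monomial m x"] in \<open>eventually_elim, simp add: scaleC_scaleC mult.commute\<close>)

lemma trig_monomial_inject: "trig_monomial m x = trig_monomial m y \<longleftrightarrow> x = y"
proof
  assume "trig_monomial m x = trig_monomial m y"
  then have "cinner x x = cinner y x" "cinner x y = cinner y y"
    using cinner_trig_monomials[of m x m] cinner_trig_monomials[of m y m] by metis+
  then have "cinner (x - y) (x - y) = 0" by (simp add: cinner_simps)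
  then show "x = y" by simp
qed simp

lemma fundamental_functions_unitarily_equiv:
  assumes n: "n \<ge> 2"
    and D: "hilbert_space D" "finite_cdim D" and D': "hilbert_space D'" "finite_cdim D'"
    and f: "\<And>i. i \<in> {1..n-1} \<Longrightarrow> f i \<in> H_infinity D" and g: "\<And>i. i \<in> {1..n-1} \<Longrightarrow> g i \<in> H_infinity D'"
    and V: "unitary_op (hardy_space D) (hardy_space D') V"
    and comm: "\<And>i h. i \<in> {1..n} \<Longrightarrow> h \<in> hardy_space D \<Longrightarrow> V (canonical_ay n D f i h) = canonical_ay n D' g i (V h)"
  shows "functions_unitarily_equiv n D f D' g"
proof -
  have S: "complex_subspace D" "complex_subspace D'" using D D' by (auto simp: hilbert_space_iff)
  note H = hilbert_space_hardy[OF D(1)]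
  have SH: "complex_subspace (hardy_space D)" using H by (simp add: hilbert_space_iff)
  note adjV = unitary_op_adj[OF SH V] and V' = unitary_op_adj_unitary[OF SH V]
  have nn: "n \<in> {1..n}" using n by simp
  have trig: "trig_monomial (int m) x \<in> hardy_space D" if "x \<in> D" for m x
    using that by (intro trig_monomial_in_hardy[OF S(1)]) auto
  have trig': "trig_monomial (int m) x \<in> hardy_space D'" if "x \<in> D'" for m x
    using that by (intro trig_monomial_in_hardy[OF S(2)]) auto
  have "\<forall>x\<in>D. \<exists>u\<in>D'. V (trig_monomial 0 x) = trig_monomial 0 u"
    using shift_intertwiner_constant[OF D(1) D' V comm[OF nn]] by blast
  then obtain U where U: "\<And>x. x \<in> D \<Longrightarrow> U x \<in> D'" "\<And>x. x \<in> D \<Longrightarrow> V (trig_monomial 0 x) = trig_monomial 0 (U x)"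
    by metis
  note VL = clinear_onD[OF SH unitary_opD(1)[OF V]] and Vc = unitary_opD(3)[OF V]
  have t0: "trig_monomial 0 x \<in> hardy_space D" if "x \<in> D" for x using trig[OF that, of 0] by simp
  \<comment> \<open>Pushing powers of the shift through V extends the action of U from constants to
    all analytic monomials.\<close>
  have Vm: "V (trig_monomial (int m) x) = trig_monomial (int m) (U x)" if x: "x \<in> D" for m x
  proof (induction m)
    case 0
    then show ?case using U(2)[OF x] by simp
  next
    case (Suc m)
    have "V (trig_monomial (int (Suc m)) x) = V (canonical_ay n D f n (trig_monomial (int m) x))"
      by (simp add: shift_trig_monomial[OF D(1) x] add.commute)
    also have "\<dots> = canonical_ay n D' g n (trig_monomial (int m) (U x))"
      by (simp add: comm[OF nn trig[OF x]] Suc)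
    also have "\<dots> = trig_monomial (int (Suc m)) (U x)"
      by (simp add: shift_trig_monomial[OF D'(1) U(1)[OF x]] add.commute)
    finally show ?case .
  qed
  have Uc: "cinner (U x) (U y) = cinner x y" if "x \<in> D" "y \<in> D" for x y
    using Vc[OF t0 t0, OF that] that by (simp add: U(2) cinner_trig_monomials)
  have Uun: "unitary_op D D' U"
    unfolding unitary_op_def clinear_on_def
  proof (intro conjI ballI allI Uc)
    fix x y assume xy: "x \<in> D" "y \<in> D"
    have "trig_monomial 0 (U (x + y)) = trig_monomial 0 (U x + U y)"
      using xy VL(1)[OF t0 t0, OF xy] by (simp add: U(2)[symmetric] complex_subspaceD(2)[OF S(1)] trig_monomial_add)
    then show "U (x + y) = U x + U y" by (simp only: trig_monomial_inject)
  next
    fix a x assume x: "x \<in> D"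
    have "trig_monomial 0 (U (a *\<^sub>C x)) = trig_monomial 0 (a *\<^sub>C U x)"
      using x VL(2)[OF t0, OF x] by (simp add: U(2)[symmetric] complex_subspaceD(3)[OF S(1)] trig_monomial_scaleC)
    then show "U (a *\<^sub>C x) = a *\<^sub>C U x" by (simp only: trig_monomial_inject)
  next
    \<comment> \<open>Surjectivity of U: the inverse of V intertwines the shifts as well, so it too
      maps constants to constants.\<close>
    have "\<exists>x\<in>D. y = U x" if y: "y \<in> D'" for y
    proof -
      have "adj (hardy_space D) V (canonical_ay n D' g n h) = canonical_ay n D f n (adj (hardy_space D) V h)"
        if h: "h \<in> hardy_space D'" for h
        using comm[OF nn adjV(2)[OF h]] adjV(1)[OF shift_hardy(1)[OF D(1) adjV(2)[OF h]]] adjV(3)[OF h] by metis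
      from shift_intertwiner_constant[OF D'(1) D V' this y]
      obtain x where x: "x \<in> D" "adj (hardy_space D) V (trig_monomial 0 y) = trig_monomial 0 x" by blast
      have "trig_monomial 0 y = trig_monomial 0 (U x)"
        using adjV(3)[of "trig_monomial 0 y"] trig'[OF y, of 0] x U(2)[OF x(1)] by simp
      then show ?thesis using x(1) by (auto simp: trig_monomial_inject)
    qed
    then show "U ` D = D'" using U(1) by blast
  qed
  have inC: "canonical_ay n D f i h \<in> hardy_space D" for i h
    by (simp add: canonical_ay_def toeplitz_def orth_proj_in[OF H])
  \<comment> \<open>Both entries are sums of power series in \<open>z\<close> whose coefficients
    agree, because V preserves inner products and intertwines the Toeplitz operators.\<close>
  have key: "cinner (g i z (U x)) (U y) = cinner (f i z x) y"
    if i: "i \<in> {1..n-1}" and z: "z \<in> ball 0 1" and x: "x \<in> D" and y: "y \<in> D" for i z x y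
  proof -
    have i': "i \<in> {1..n}" using i by auto
    have "cinner (canonical_ay n D' g i (trig_monomial 0 (U x))) (trig_monomial (int m + 1) (U y)) =
        cinner (canonical_ay n D f i (trig_monomial 0 x)) (trig_monomial (int m + 1) y)" for m
    proof -
      have "canonical_ay n D' g i (trig_monomial 0 (U x)) = V (canonical_ay n D f i (trig_monomial 0 x))"
        using comm[OF i' t0[OF x]] by (simp add: U(2)[OF x])
      moreover have "trig_monomial (int m + 1) (U y) = V (trig_monomial (int m + 1) y)"
        using Vm[OF y, of "Suc m"] by (simp add: add.commute)
      moreover have "trig_monomial (int m + 1) y \<in> hardy_space D"
        using trig[OF y, of "Suc m"] by (simp add: add.commute)
      ultimately show ?thesis using Vc[OF inC] by simp
    qed
    with canonical_ay_coefficients[where f = g, OF D' g i U(1)[OF x] U(1)[OF y] z]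
    have "(\<lambda>m. cinner (canonical_ay n D f i (trig_monomial 0 x)) (trig_monomial (int m + 1) y) * z ^ m)
        sums cinner (g i z (U x)) (U y)" by simp
    then show ?thesis
      by (rule sums_unique2) (rule canonical_ay_coefficients[where f = f, OF D f i x y z])
  qed
  have "g i z y = U (f i z (adj D U y))" if i: "i \<in> {1..n-1}" and z: "z \<in> ball 0 1" and y: "y \<in> D'" for i z y
  proof -
    note aU = unitary_op_adj[OF S(1) Uun]
    have b: "f i z ` D \<subseteq> D" "g i z ` D' \<subseteq> D'"
      using f[OF i] g[OF i] z by (auto simp: H_infinity_def bounded_op_def)
    have fD: "f i z (adj D U y) \<in> D" using b aU(2)[OF y] by blast
    show ?thesis
    proof (rule eq_if_cinner_eq'[OF S(2)])
      show "g i z y \<in> D'" using b y by blast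
      show "U (f i z (adj D U y)) \<in> D'" by (rule U(1)[OF fD])
      fix w assume w: "w \<in> D'"
      show "cinner (g i z y) w = cinner (U (f i z (adj D U y))) w"
        using key[OF i z aU(2)[OF y] aU(2)[OF w]] Uc[OF fD aU(2)[OF w]] aU(3)[OF y] aU(3)[OF w] by simp
    qed
  qed
  with Uun show ?thesis unfolding functions_unitarily_equiv_def by blast
qed

theorem proposition3p6:
  fixes n :: nat
  assumes "n \<ge> 2"
  shows
    "(\<forall>(E :: 'e::complex_inner set) (E' :: 'f::complex_inner set) f g.
        hilbert_space E \<and> hilbert_space E' \<and>
        (\<forall>i\<in>{1..n-1}. f i \<in> H_infinity E) \<and> (\<forall>i\<in>{1..n-1}. g i \<in> H_infinity E') \<and>
        functions_unitarily_equiv n E f E' g \<longrightarrow>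
        tuple_unitarily_equiv n (hardy_space E) (canonical_ay n E f)
          (hardy_space E') (canonical_ay n E' g)) \<and>
     (\<forall>(H :: 'h::complex_inner set) (K :: 'k::complex_inner set) A B f g.
        hilbert_space H \<and> hilbert_space K \<and>
        pure_agler_young_isometry n H A \<and> pure_agler_young_isometry n K B \<and>
        finite_cdim (defect_space H (adj H (A n))) \<and>
        finite_cdim (defect_space K (adj K (B n))) \<and>
        tuple_unitarily_equiv n H A K B \<and>
        fundamental_functions n H A f \<and> fundamental_functions n K B g \<longrightarrow>
        functions_unitarily_equiv n
          (defect_space H (adj H (A n))) f (defect_space K (adj K (B n))) g)"
proof (intro conjI allI impI; elim conjE)
  fix E :: "'e set" and E' :: "'f set" and f g
  assume "hilbert_space E" "hilbert_space E'" "\<forall>i\<in>{1..n-1}. f i \<in> H_infinity E"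
    "functions_unitarily_equiv n E f E' g"
  then show "tuple_unitarily_equiv n (hardy_space E) (canonical_ay n E f)
      (hardy_space E') (canonical_ay n E' g)"
    by (intro canonical_ay_unitarily_equiv) auto
next
  fix H :: "'h set" and K :: "'k set" and A B f g
  assume H: "hilbert_space H" and K: "hilbert_space K"
    and A: "pure_agler_young_isometry n H A" and B: "pure_agler_young_isometry n K B"
    and fin: "finite_cdim (defect_space H (adj H (A n)))" "finite_cdim (defect_space K (adj K (B n)))"
    and AB: "tuple_unitarily_equiv n H A K B"
    and f: "fundamental_functions n H A f" and g: "fundamental_functions n K B g"
  let ?D = "defect_space H (adj H (A n))" and ?D' = "defect_space K (adj K (B n))"
  have SH: "complex_subspace H" and SK: "complex_subspace K" using H K by (auto simp: hilbert_space_iff)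
  have nn: "n \<in> {1..n}" using assms by simp
  have Ab: "bounded_op H (A i)" if "i \<in> {1..n}" for i
    using A that by (auto simp: pure_agler_young_isometry_def agler_young_isometry_def)
  have Bb: "bounded_op K (B i)" if "i \<in> {1..n}" for i
    using B that by (auto simp: pure_agler_young_isometry_def agler_young_isometry_def)
  have D: "hilbert_space ?D"
    using A by (intro hilbert_space_defect_space[OF H Ab[OF nn]])
      (auto simp: pure_agler_young_isometry_def agler_young_isometry_def)
  have D': "hilbert_space ?D'"
    using B by (intro hilbert_space_defect_space[OF K Bb[OF nn]])
      (auto simp: pure_agler_young_isometry_def agler_young_isometry_def)
  obtain W where W: "unitary_op H K W" "\<And>i x. i \<in> {1..n} \<Longrightarrow> x \<in> H \<Longrightarrow> B i (W x) = W (A i x)"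
    using tuple_unitarily_equivE[OF SH AB] by blast
  obtain P where P: "unitary_op H (hardy_space ?D) P"
    "\<And>i x. i \<in> {1..n} \<Longrightarrow> x \<in> H \<Longrightarrow> canonical_ay n ?D f i (P x) = P (A i x)"
    using f tuple_unitarily_equivE[OF SH] unfolding fundamental_functions_def Let_def by metis
  obtain Q where Q: "unitary_op K (hardy_space ?D') Q"
    "\<And>i x. i \<in> {1..n} \<Longrightarrow> x \<in> K \<Longrightarrow> canonical_ay n ?D' g i (Q x) = Q (B i x)"
    using g tuple_unitarily_equivE[OF SK] unfolding fundamental_functions_def Let_def by metis
  note aP = unitary_op_adj[OF SH P(1)]
  \<comment> \<open>From the model of A back to H, across to K, and into the model of B.\<close>
  define V where "V h = Q (W (adj H P h))" for h
  have V: "unitary_op (hardy_space ?D) (hardy_space ?D') V"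
    unfolding V_def
    by (rule unitary_op_compose[OF unitary_op_compose[OF unitary_op_adj_unitary[OF SH P(1)] W(1)] Q(1)])
  show "functions_unitarily_equiv n ?D f ?D' g"
  proof (rule fundamental_functions_unitarily_equiv[OF assms D fin(1) D' fin(2) _ _ V])
    fix i h assume i: "i \<in> {1..n}" and h: "h \<in> hardy_space ?D"
    define k where "k = adj H P h"
    have k: "k \<in> H" "h = P k" using aP(2,3)[OF h] by (simp_all add: k_def)
    have Aik: "A i k \<in> H" using Ab[OF i] k(1) by (auto simp: bounded_op_def)
    have Wk: "W k \<in> K" by (rule unitary_opD(2)[OF W(1) k(1)])
    show "V (canonical_ay n ?D f i h) = canonical_ay n ?D' g i (V h)"
      by (simp add: V_def k(2) P(2)[OF i k(1)] aP(1)[OF Aik] aP(1)[OF k(1)] Q(2)[OF i Wk] W(2)[OF i k(1)])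
  qed (use f g in \<open>auto simp: fundamental_functions_def Let_def\<close>)
qed

end
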